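(* Let $\kappa>0$, $\alpha_0=\frac{4\pi}{\kappa}$ and $\beta>\alpha_0$. Consider the problem $$-\Delta u+e^{\kappa u}=\beta\delta_0\quad\text{in } \mathbb{Z}^2. \qquad (\ast)$$ There is a family $\{\mathbf{u}_\alpha\}_{\alpha\in[\alpha_0,\beta)}$ of solutions of $(\ast)$ with the following properties. (i) For any $\alpha\in(\alpha_0,\beta)$, the solution $\mathbf{u}_\alpha$ of $(\ast)$ satisfies $$\mathbf{u}_\alpha(x)=-\frac{\alpha}{2\pi}\ln|x|+\mathbf{d}_{\kappa,\alpha,\beta}+O\Big(|x|^{\frac{4\pi-\alpha\kappa}{\alpha\kappa+2\pi}}(\ln|x|)^{\frac{2\pi}{\alpha\kappa+2\pi}}\Big)\quad\text{as } x\to\infty,$$ where $\mathbf{d}_{\kappa,\alpha,\beta}\in\mathbb{R}$ is a constant such that $$\mathbf{d}_{\kappa,\alpha,\beta}\le\frac1\kappa\ln(\beta-\alpha)-\frac{\gamma_0}{2}\alpha,$$ with $\gamma_0=\frac1\pi(\gamma_E+\frac12\ln2)$ and $\gamma_E$ the Euler constant. (ii) The solution $\mathbf{u}_{\alpha_0}$ of $(\ast)$ satisfies $$\mathbf{u}_{\alpha_0}(x)=-\frac2\kappa\ln|x|-\frac2\kappa\ln\ln|x|+O(1)\quad\text{as } x\to\infty.$$ (iii) The mapping $\alpha\in[\alpha_0,\beta)\mapsto\mathbf{u}_\alpha$ is strictly decreasing and continuous locally in $\mathbb{Z}^2$, i.e. $$\mathbf{u}_{\alpha_1}\ge\mathbf{u}_{\alpha_2}\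 \text{ in } \mathbb{Z}^2\quad\text{for } \alpha_0\le\alpha_1\le\alpha_2<\beta,$$ $$\mathbf{u}_{\tilde\alpha}=\lim_{\alpha\to\tilde\alpha}\mathbf{u}_\alpha\ \text{ in } \mathbb{Z}^2\quad\text{for } \tilde\alpha\in(\alpha_0,\beta),$$ $$\mathbf{u}_{\alpha_0}=\lim_{\alpha\to\alpha_0^+}\mathbf{u}_\alpha\ \text{ in } \mathbb{Z}^2,$$ and for every $\alpha\in[\alpha_0,\beta)$ $$\int_{\mathbb{Z}^2}e^{\kappa\mathbf{u}_\alpha}\,dx=\beta-\alpha.$$
   Context: $\mathbb{Z}^2$ is the integer lattice graph: $x,y\in\mathbb{Z}^2$ are adjacent ($x\sim y$) iff $|x-y|=1$, where $|\cdot|$ is the Euclidean norm. The discrete Laplacian of $u:\mathbb{Z}^2\to\mathbb{R}$ is $\Delta u(x)=\sum_{y\sim x}(u(y)-u(x))$. $\delta_0$ is the indicator function of the vertex $0$. Integrals over $\mathbb{Z}^2$ are with respect to the counting measure, i.e. $\int_{\mathbb{Z}^2}f\,dx=\sum_{x\in\mathbb{Z}^2}f(x)$. Limits of functions in $\mathbb{Z}^2$ are pointwise limits. *)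

theory Defs
  imports "HOL-Analysis.Analysis" "HOL-Library.Landau_Symbols"
begin

definition lattice_norm :: "int \<times> int \<Rightarrow> real" where
  "lattice_norm x = norm (real_of_int (fst x), real_of_int (snd x))"

lemma lattice_norm_eq: "lattice_norm (a, b) = sqrt ((real_of_int a)\<^sup>2 + (real_of_int b)\<^sup>2)"
  by (simp add: lattice_norm_def norm_Pair)

definition adjacent :: "int \<times> int \<Rightarrow> int \<times> int \<Rightarrow> bool" where
  "adjacent x y \<longleftrightarrow> lattice_norm (x - y) = 1"

definition discrete_laplacian :: "(int \<times> int \<Rightarrow> real) \<Rightarrow> int \<times> int \<Rightarrow> real" where
  "discrete_laplacian u x = (\<Sum>y | adjacent x y. u y - u x)"

text \<open>The sum above is not a degenerate sum over an infinite set.\<close>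

lemma adjacent_iff:
  "adjacent (a, b) y \<longleftrightarrow> y \<in> {(a + 1, b), (a - 1, b), (a, b + 1), (a, b - 1)}"
proof -
  obtain c d where y: "y = (c, d)" by (cases y)
  define p q where "p = a - c" and "q = b - d"
  have "adjacent (a, b) y \<longleftrightarrow> (real_of_int p)\<^sup>2 + (real_of_int q)\<^sup>2 = 1"
    by (simp add: adjacent_def y lattice_norm_eq p_def q_def)
  also have "\<dots> \<longleftrightarrow> real_of_int (p\<^sup>2 + q\<^sup>2) = real_of_int 1"
    by simp
  also have "\<dots> \<longleftrightarrow> p\<^sup>2 + q\<^sup>2 = 1"
    by (simp only: of_int_eq_iff)
  also have "\<dots> \<longleftrightarrow> (p = 0 \<and> \<bar>q\<bar> = 1) \<or> (\<bar>p\<bar> = 1 \<and> q = 0)"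
  proof
    assume eq: "p\<^sup>2 + q\<^sup>2 = 1"
    have "p\<^sup>2 \<le> 1" "q\<^sup>2 \<le> 1"
      using eq zero_le_power2[of p] zero_le_power2[of q] by linarith+
    then have "\<bar>p\<bar> \<le> 1" "\<bar>q\<bar> \<le> 1"
      by (simp_all add: abs_square_le_1)
    then have "p \<in> {-1, 0, 1}" "q \<in> {-1, 0, 1}" by auto
    then show "(p = 0 \<and> \<bar>q\<bar> = 1) \<or> (\<bar>p\<bar> = 1 \<and> q = 0)"
      using eq by auto
  next
    assume "(p = 0 \<and> \<bar>q\<bar> = 1) \<or> (\<bar>p\<bar> = 1 \<and> q = 0)"
    then show "p\<^sup>2 + q\<^sup>2 = 1"
      by (metis add.commute add_0 one_power2 power2_abs zero_power2)
  qed
  also have "\<dots> \<longleftrightarrow> y \<in> {(a + 1, b), (a - 1, b), (a, b + 1), (a, b - 1)}"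
    unfolding p_def q_def y by (simp add: abs_if) presburger
  finally show ?thesis .
qed

lemma finite_adjacent: "finite {y. adjacent x y}"
  by (cases x) (simp only: adjacent_iff, simp)

definition lattice_at_infinity :: "(int \<times> int) filter" where
  "lattice_at_infinity = filtercomap lattice_norm at_top"

definition is_solution :: "real \<Rightarrow> real \<Rightarrow> (int \<times> int \<Rightarrow> real) \<Rightarrow> bool" where
  "is_solution \<kappa> \<beta> u \<longleftrightarrow>
     (\<forall>x. - discrete_laplacian u x + exp (\<kappa> * u x) = \<beta> * indicator {0} x)"

definition gamma0 :: real where
  "gamma0 = 1 / pi * (euler_mascheroni + 1 / 2 * ln 2)"

end

theory Submission
  imports Defs
begin

text \<open>
  The equation has the form \<open>\<Delta> u = exp (\<kappa> u) - \<beta> \<delta>\<^sub>0\<close>, whose right-hand side increases with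
  \<open>u\<close>. Hence differences of solutions obey a maximum principle, and everything reduces to
  comparing solutions with explicit functions. The random walk on the plane lattice is recurrent:
  there is a potential kernel \<open>A \<ge> 0\<close> (called \<open>kernel\<close> below) with \<open>\<Delta> A = \<delta>\<^sub>0\<close> that tends to
  infinity, and subtracting a small multiple of it lets the maximum principle ignore everything that is \<open>o(A)\<close> at infinity
  (\<open>maximum_principle\<close>); bounded harmonic functions are constant for the same reason.

  The kernel is built by hand. In the rotated coordinates \<open>m = a + b\<close>, \<open>n = a - b\<close> the Laplacian
  sums over the four diagonal neighbours, and \<open>lam k ^ |n| * cos (m * k)\<close> is harmonic for \<open>n \<noteq> 0\<close>
  when \<open>lam k = cos k / (1 + sin k)\<close>. Superposing these functions gives \<open>corner_kernel\<close>. Its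
  increments in \<open>m\<close> are Laplace-type integrals of \<open>lam k ^ n\<close> without singularity, and its
  values on the axis are odd harmonic sums; together they yield
  \<open>A x = ln |x| / (2 pi) + c_kernel + O(1/|x|)\<close> with an explicit constant that exceeds \<open>gamma0 / 2\<close>.

  For \<open>\<alpha> \<kappa> > 4 pi\<close> write \<open>u = v - \<alpha> A\<close>. Then \<open>exp (- \<kappa> \<alpha> A)\<close> is summable, the constant
  \<open>ln (\<beta> - \<alpha>) / \<kappa>\<close> is a supersolution for \<open>v\<close>, and a multiple of the convolution of \<open>A\<close> with
  \<open>exp (- \<kappa> \<alpha> A)\<close> minus a large constant is a bounded subsolution. A monotone fixed point
  argument produces a bounded \<open>v\<close> between them (\<open>admissible_exists\<close>). As \<open>\<Delta> v\<close> decays fast,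
  \<open>v\<close> differs from a decaying convolution with \<open>A\<close> by a bounded function whose Laplacian is a
  point mass; Liouville's theorem makes that mass vanish, which is the formula for the total mass
  \<open>\<beta> - \<alpha>\<close>, and makes the function constant, which is the asymptotic expansion
  (\<open>admissible_decay\<close>). The supersolution bounds the constant in the expansion.

  Two solutions with parameters \<open>\<alpha>1 \<le> \<alpha>2\<close> differ by \<open>(\<alpha>2 - \<alpha>1) A + O(1)\<close>, so comparison gives
  monotonicity in \<open>\<alpha>\<close>. One-sided limits in \<open>\<alpha>\<close> are again solutions, and they differ from the
  expected one by \<open>o(A)\<close>, hence not at all: this is continuity. The critical solution is defined
  as the limit \<open>\<alpha> \<down> \<alpha>\<^sub>0\<close>. It is trapped between the two barriers
  \<open>- (ln s + 2 ln (ln s)) / \<kappa> \<plusminus> const\<close>, \<open>s = |x|\<^sup>2\<close>, because in the plane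
  \<open>ln s + 2 ln (ln s)\<close> has Laplacian \<open>- 8 / (s (ln s)\<^sup>2)\<close>, which is \<open>- 8\<close> times the exponential
  of its negative.
\<close>

section \<open>The lattice Laplacian\<close>

lemma discrete_laplacian_eq:
  "discrete_laplacian u (a, b) = u (a + 1, b) + u (a - 1, b) + u (a, b + 1) + u (a, b - 1) - 4 * u (a, b)"
proof -
  have *: "{y. adjacent (a, b) y} = {(a + 1, b), (a - 1, b), (a, b + 1), (a, b - 1)}"
    using adjacent_iff[of a b] by blast
  show ?thesis
    unfolding discrete_laplacian_def * by (simp add: algebra_simps)
qed

section \<open>The corner integrals\<close>

text \<open>For \<open>k < pi/2\<close> the root in \<open>[0, 1]\<close> of \<open>(t + 1 / t) * cos k = 2\<close>, equivalently \<open>exp (- s)\<close> with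
  \<open>cosh s * cos k = 1\<close>. This form of the root is smooth on the whole of \<open>[0, pi/2]\<close>.\<close>
definition lam :: "real \<Rightarrow> real" where
  "lam k = cos k / (1 + sin k)"

lemma sin_cos_nonneg:
  assumes "k \<in> {0..pi/2}"
  shows "0 \<le> sin k" "0 \<le> cos k"
  using assms by (auto intro!: sin_ge_zero cos_ge_zero)

lemma lam_nonneg: "k \<in> {0..pi/2} \<Longrightarrow> 0 \<le> lam k"
  using sin_cos_nonneg[of k] by (simp add: lam_def)

lemma lam_le_1: "k \<in> {0..pi/2} \<Longrightarrow> lam k \<le> 1"
  using sin_cos_nonneg[of k] cos_le_one[of k] 
  unfolding lam_def by (subst divide_le_eq_1_pos) linarith+

lemma lam_0 [simp]: "lam 0 = 1"
  by (simp add: lam_def)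

lemma one_plus_sin_pos: "k \<in> {0..pi/2} \<Longrightarrow> 1 + sin k > 0"
  using sin_cos_nonneg[of k] by simp

lemma lam_cos: assumes "k \<in> {0..pi/2}" shows "lam k * cos k = 1 - sin k"
proof -
  have "cos k * cos k = (1 - sin k) * (1 + sin k)"
    using sin_cos_squared_add[of k] by (simp add: power2_eq_square algebra_simps)
  thus ?thesis using one_plus_sin_pos[OF assms] by (simp add: lam_def divide_eq_eq)
qed

lemma one_plus_lam2: assumes "k \<in> {0..pi/2}" shows "1 + (lam k)\<^sup>2 = 2 / (1 + sin k)"
proof -
  have "(1 + sin k)\<^sup>2 + (cos k)\<^sup>2 = 2 * (1 + sin k)"
    using sin_cos_squared_add[of k] by (simp add: power2_eq_square algebra_simps)
  hence "(1 + (lam k)\<^sup>2) * (1 + sin k)\<^sup>2 = 2 * (1 + sin k)"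
    using one_plus_sin_pos[OF assms] by (simp add: lam_def power_divide distrib_right)
  hence "(1 + (lam k)\<^sup>2) * (1 + sin k) = 2"
    using one_plus_sin_pos[OF assms] mult_right_cancel[of "1 + sin k" "(1 + (lam k)\<^sup>2) * (1 + sin k)" 2]
    by (simp only: power2_eq_square[of "1 + sin k"] mult.assoc) simp
  thus ?thesis using one_plus_sin_pos[OF assms] by (simp add: eq_divide_eq)
qed

text \<open>This is the dispersion relation that makes \<open>lam k ^ n * cos (m * k)\<close> harmonic with
  respect to the four diagonal neighbours of \<open>(m, n)\<close>.\<close>
lemma lam_quadratic: assumes "k \<in> {0..pi/2}" shows "(1 + (lam k)\<^sup>2) * cos k = 2 * lam k"
  using one_plus_lam2[OF assms] by (simp add: lam_def)

lemma one_minus_lam2: assumes "k \<in> {0..pi/2}" shows "1 - (lam k)\<^sup>2 = sin k * (1 + (lam k)\<^sup>2)"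
  using one_plus_lam2[OF assms] one_plus_sin_pos[OF assms] by (simp add: field_simps)

text \<open>The Riccati equation for \<open>lam\<close> allows all integrals of \<open>lam k ^ n * (1 + (lam k)\<^sup>2)\<close> to be
  evaluated in closed form.\<close>
lemma lam_deriv: 
  assumes "k \<in> {0..pi/2}" 
  shows "(lam has_real_derivative - (1 + (lam k)\<^sup>2) / 2) (at k within S)"
proof -
  have p: "1 + sin k > 0" by (rule one_plus_sin_pos[OF assms])
  have e: "(- sin k * (1 + sin k) - cos k * (0 + cos k)) = - (1 + sin k)"
    using sin_cos_squared_add[of k] by (simp add: power2_eq_square algebra_simps)
  have "(lam has_real_derivative (- sin k * (1 + sin k) - cos k * (0 + cos k)) / ((1 + sin k) * (1 + sin k))) (at k within S)"
    unfolding lam_def using p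
    by (intro DERIV_divide DERIV_add DERIV_const DERIV_subset[OF DERIV_sin] DERIV_subset[OF DERIV_cos]) auto
  also have "(- sin k * (1 + sin k) - cos k * (0 + cos k)) / ((1 + sin k) * (1 + sin k)) = - (1 + (lam k)\<^sup>2) / 2"
    unfolding e one_plus_lam2[OF assms] using p by (simp add: divide_simps) (simp add: algebra_simps)
  finally show ?thesis .
qed

lemma lam_continuous: "continuous_on {0..pi/2} lam"
  by (rule DERIV_continuous_on[OF lam_deriv])

text \<open>The singularity of \<open>1 / sin k\<close> at the origin is cancelled by a zero of the numerator.\<close>
lemma sin_quotient_integrable:
  fixes F :: "real \<Rightarrow> real"
  assumes c: "continuous_on {0..pi/2} F" and "F 0 = 0" and d: "(F has_real_derivative D) (at 0 within {0..pi/2})"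
  shows "(\<lambda>k. F k / sin k) integrable_on {0..pi/2}"
proof -
  define h where "h = (\<lambda>k. if k = 0 then D else F k / sin k)"
  have pos: "sin k \<noteq> 0" if "k \<in> {0..pi/2}" "k \<noteq> 0" for k
    using sin_gt_zero[of k] that by auto
  have l1: "((\<lambda>k. F k / k) \<longlongrightarrow> D) (at 0 within {0..pi/2})"
    using d assms(2) by (simp add: has_field_derivative_iff)
  have l2: "((\<lambda>k. sin k / k) \<longlongrightarrow> 1) (at 0 within {0..pi/2})"
    using DERIV_sin[of 0] by (auto simp: has_field_derivative_iff intro: tendsto_within_subset)
  have "((\<lambda>k. (F k / k) / (sin k / k)) \<longlongrightarrow> D / 1) (at 0 within {0..pi/2})"
    by (intro tendsto_divide l1 l2) auto
  hence "(h \<longlongrightarrow> D) (at 0 within {0..pi/2})"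
    by (rule filterlim_cong[THEN iffD1, rotated -1]) (auto simp: h_def eventually_at_filter)
  hence 0: "continuous (at 0 within {0..pi/2}) h"
    by (simp add: continuous_within h_def)
  have "continuous_on {0..pi/2} h"
    unfolding continuous_on_eq_continuous_within
  proof
    fix k assume k: "k \<in> {0..pi/2}"
    show "continuous (at k within {0..pi/2}) h"
    proof (cases "k = 0")
      case False
      have "continuous (at k within {0..pi/2}) (\<lambda>k. F k / sin k)"
        using c k pos[OF k False] 
        by (intro continuous_intros) (auto simp: continuous_on_eq_continuous_within)
      moreover have "\<forall>\<^sub>F x in at k within {0..pi/2}. F x / sin x = h x"
        using tendsto_imp_eventually_ne[OF tendsto_ident_at False]
        by (rule eventually_mono) (simp add: h_def)
      ultimately show ?thesis
        using False unfolding continuous_within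
        by (auto simp: h_def intro: Lim_transform_eventually)
    qed (use 0 in simp)
  qed
  hence "h integrable_on {0..pi/2}" by (rule integrable_continuous_interval)
  thus ?thesis
    by (rule integrable_spike[where S = "{0}"]) (auto simp: h_def)
qed

definition corner_integrand :: "int \<Rightarrow> nat \<Rightarrow> real \<Rightarrow> real" where
  "corner_integrand m n k = (1 - lam k ^ n * cos (of_int m * k)) / sin k"

definition corner_kernel :: "int \<Rightarrow> nat \<Rightarrow> real" where
  "corner_kernel m n = integral {0..pi/2} (corner_integrand m n)"

lemma corner_integrand_integrable: "corner_integrand m n integrable_on {0..pi/2}"
  unfolding corner_integrand_def
proof (rule sin_quotient_integrable[where D = "real n"])
  show "continuous_on {0..pi/2} (\<lambda>k. 1 - lam k ^ n * cos (of_int m * k))"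
    by (intro continuous_intros lam_continuous)
  show "((\<lambda>k. 1 - lam k ^ n * cos (of_int m * k)) has_real_derivative real n) (at 0 within {0..pi/2})"
    by (rule derivative_eq_intros lam_deriv refl | simp)+
qed simp

lemma corner_kernel_even [simp]: "corner_kernel (- m) n = corner_kernel m n"
  by (simp add: corner_kernel_def corner_integrand_def[abs_def])

lemma corner_kernel_0_0 [simp]: "corner_kernel 0 0 = 0"
  by (simp add: corner_kernel_def corner_integrand_def[abs_def])

lemma corner_kernel_nonneg: "corner_kernel m n \<ge> 0"
  unfolding corner_kernel_def
proof (rule integral_nonneg[OF corner_integrand_integrable])
  fix k assume k: "k \<in> {0..pi/2}"
  have "lam k ^ n * cos (of_int m * k) \<le> lam k ^ n * 1"
    using lam_nonneg[OF k] by (intro mult_left_mono) auto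
  also have "\<dots> \<le> 1" using lam_nonneg[OF k] lam_le_1[OF k] by (simp add: power_le_one)
  finally show "0 \<le> corner_integrand m n k"
    using sin_cos_nonneg[OF k] by (simp add: corner_integrand_def)
qed

text \<open>Every identity between values of \<open>corner_kernel\<close> below comes from a pointwise trigonometric
  identity in which the factor \<open>sin k\<close> cancels the denominator of the integrand.\<close>
lemma corner_kernel_linear:
  assumes f: "\<And>k. k \<in> {0<..pi/2} \<Longrightarrow> (\<Sum>i\<in>I. c i * (1 - lam k ^ n i * cos (of_int (m i) * k))) = sin k * f k"
    and I: "finite I"
  shows "(f has_integral (\<Sum>i\<in>I. c i * corner_kernel (m i) (n i))) {0..pi/2}"
proof -
  have "((\<lambda>k. \<Sum>i\<in>I. c i * corner_integrand (m i) (n i) k) has_integral (\<Sum>i\<in>I. c i * corner_kernel (m i) (n i))) {0..pi/2}"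
    unfolding corner_kernel_def
    by (intro has_integral_sum I has_integral_mult_right integrable_integral corner_integrand_integrable)
  thus ?thesis
  proof (rule has_integral_spike[where S = "{0}", rotated 2])
    fix k assume "k \<in> {0..pi/2} - {0}"
    hence k: "k \<in> {0<..pi/2}" by auto
    hence "sin k > 0" by (intro sin_gt_zero) auto
    thus "f k = (\<Sum>i\<in>I. c i * corner_integrand (m i) (n i) k)"
      using f[OF k] by (simp add: corner_integrand_def sum_divide_distrib[symmetric] field_simps)
  qed auto
qed

lemma cos_step: "cos (of_int (m + 1) * k) + cos (of_int (m - 1) * k) = 2 * cos k * cos (of_int m * (k::real))"
  by (simp add: algebra_simps cos_add cos_diff)

lemma corner_kernel_harmonic:
  "corner_kernel (m + 1) (n + 2) + corner_kernel (m - 1) (n + 2) + corner_kernel (m + 1) n + corner_kernel (m - 1) n = 4 * corner_kernel m (n + 1)"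
proof -
  let ?m = "\<lambda>i::nat. [m + 1, m - 1, m + 1, m - 1, m] ! i"
  let ?n = "\<lambda>i::nat. [n + 2, n + 2, n, n, n + 1] ! i"
  let ?c = "\<lambda>i::nat. [1, 1, 1, 1, -4::real] ! i"
  have "((\<lambda>k. 0) has_integral (\<Sum>i<5. ?c i * corner_kernel (?m i) (?n i))) {0..pi/2}"
  proof (rule corner_kernel_linear)
    fix k :: real assume k: "k \<in> {0<..pi/2}"
    have "(\<Sum>i<5. ?c i * (1 - lam k ^ ?n i * cos (of_int (?m i) * k)))
        = 4 * lam k ^ (n+1) * cos (of_int m * k) - lam k ^ n * (1 + (lam k)\<^sup>2) * (cos (of_int (m + 1) * k) + cos (of_int (m - 1) * k))"
      by (simp add: eval_nat_numeral algebra_simps)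
    also have "\<dots> = 4 * lam k ^ (n+1) * cos (of_int m * k) - lam k ^ n * ((1 + (lam k)\<^sup>2) * cos k) * 2 * cos (of_int m * k)"
      unfolding cos_step by (simp add: algebra_simps)
    also have "\<dots> = 0" using k by (subst lam_quadratic) auto
    finally show "(\<Sum>i<5. ?c i * (1 - lam k ^ ?n i * cos (of_int (?m i) * k))) = sin k * 0" by simp
  qed auto
  hence "(\<Sum>i<5. ?c i * corner_kernel (?m i) (?n i)) = 0"
    using has_integral_unique has_integral_0 by blast
  thus ?thesis by (simp add: eval_nat_numeral)
qed

lemma integral_cos_even:
  "((\<lambda>k. cos (of_int (2 * l) * k)) has_integral (if l = 0 then pi / 2 else 0)) {0..pi/2}"
proof (cases "l = 0")
  case True
  thus ?thesis using has_integral_const_real[of "1::real" 0 "pi/2"] by (simp add: scaleR_conv_of_real)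
next
  case False
  have "((\<lambda>k. cos (of_int (2 * l) * k)) has_integral 
      sin (of_int (2 * l) * (pi/2)) / of_int (2 * l) - sin (of_int (2 * l) * 0) / of_int (2 * l)) {0..pi/2}"
    using False by (intro fundamental_theorem_of_calculus)
      (auto intro!: derivative_eq_intros simp flip: has_real_derivative_iff_has_vector_derivative)
  moreover have "sin (of_int (2 * l) * (pi/2)) = 0"
    by (simp add: sin_zero_iff_int2)
  ultimately show ?thesis using False by simp
qed

text \<open>On the axis \<open>n = 0\<close> the exponentials have a kink, and its contribution integrates to
  \<open>cos (2 l k)\<close>, which is orthogonal to constants unless \<open>l = 0\<close>. This is where the point mass arises, and
  why the two coordinates must have equal parity.\<close>
lemma corner_kernel_axis_laplacian:
  "corner_kernel (2 * l + 1) 1 + corner_kernel (2 * l - 1) 1 - 2 * corner_kernel (2 * l) 0 = (if l = 0 then pi else 0)"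
proof -
  let ?m = "\<lambda>i::nat. [2 * l + 1, 2 * l - 1, 2 * l] ! i"
  let ?n = "\<lambda>i::nat. [1, 1, 0::nat] ! i"
  let ?c = "\<lambda>i::nat. [1, 1, -2::real] ! i"
  have "((\<lambda>k. 2 * cos (of_int (2 * l) * k)) has_integral (\<Sum>i<3. ?c i * corner_kernel (?m i) (?n i))) {0..pi/2}"
  proof (rule corner_kernel_linear)
    fix k :: real assume k: "k \<in> {0<..pi/2}"
    have "(\<Sum>i<3. ?c i * (1 - lam k ^ ?n i * cos (of_int (?m i) * k)))
        = 2 * cos (of_int (2 * l) * k) - lam k * (cos (of_int (2 * l + 1) * k) + cos (of_int (2 * l - 1) * k))"
      by (simp add: eval_nat_numeral algebra_simps)
    also have "\<dots> = 2 * cos (of_int (2 * l) * k) - (lam k * cos k) * 2 * cos (of_int (2 * l) * k)"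
      unfolding cos_step by (simp add: algebra_simps)
    also have "\<dots> = sin k * (2 * cos (of_int (2 * l) * k))"
      using k by (subst lam_cos) (auto simp: algebra_simps)
    finally show "(\<Sum>i<3. ?c i * (1 - lam k ^ ?n i * cos (of_int (?m i) * k))) = sin k * (2 * cos (of_int (2 * l) * k))" .
  qed auto
  moreover have "((\<lambda>k. 2 * cos (of_int (2 * l) * k)) has_integral 2 * (if l = 0 then pi/2 else 0)) {0..pi/2}"
    by (intro has_integral_mult_right integral_cos_even)
  ultimately have "(\<Sum>i<3. ?c i * corner_kernel (?m i) (?n i)) = 2 * (if l = 0 then pi/2 else 0)"
    using has_integral_unique by blast
  thus ?thesis by (simp add: eval_nat_numeral split: if_splits)
qed

lemma corner_kernel_column_step: "corner_kernel 0 (2 * (j + 1)) - corner_kernel 0 (2 * j) = 2 / (2 * real j + 1)"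
proof -
  let ?n = "\<lambda>i::nat. [2 * (j+1), 2 * j] ! i"
  let ?c = "\<lambda>i::nat. [1, -1::real] ! i"
  have 1: "((\<lambda>k. lam k ^ (2 * j) * (1 + (lam k)\<^sup>2)) has_integral (\<Sum>i<2. ?c i * corner_kernel 0 (?n i))) {0..pi/2}"
  proof (rule corner_kernel_linear)
    fix k :: real assume k: "k \<in> {0<..pi/2}"
    have "(\<Sum>i<2. ?c i * (1 - lam k ^ ?n i * cos (of_int 0 * k))) = lam k ^ (2 * j) * (1 - (lam k)\<^sup>2)"
      by (simp add: eval_nat_numeral algebra_simps)
    also have "\<dots> = sin k * (lam k ^ (2 * j) * (1 + (lam k)\<^sup>2))"
      using k by (subst one_minus_lam2) auto
    finally show "(\<Sum>i<2. ?c i * (1 - lam k ^ ?n i * cos (of_int 0 * k))) = sin k * (lam k ^ (2 * j) * (1 + (lam k)\<^sup>2))" .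
  qed auto
  have "((\<lambda>k. lam k ^ (2 * j) * (1 + (lam k)\<^sup>2)) has_integral 
      (- 2 * lam (pi/2) ^ (2*j+1) / (2 * real j + 1)) - (- 2 * lam 0 ^ (2*j+1) / (2 * real j + 1))) {0..pi/2}"
  proof (intro fundamental_theorem_of_calculus)
    fix k assume k: "k \<in> {0..pi/2}"
    define r where "r = 2 * real j + 1"
    have r: "r > 0" by (simp add: r_def)
    have "((\<lambda>k. - 2 * lam k ^ (2*j+1) / r) has_real_derivative 
        - 2 * (of_nat (2*j+1) * lam k ^ (2 * j) * (- (1 + (lam k)\<^sup>2) / 2)) / r) (at k within {0..pi/2})"
      using DERIV_power[OF lam_deriv[OF k], of "2*j+1"] 
      by (intro DERIV_cdivide DERIV_cmult) (simp add: mult_ac)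
    also have "of_nat (2*j+1) = r" by (simp add: r_def)
    also have "- 2 * (r * lam k ^ (2 * j) * (- (1 + (lam k)\<^sup>2) / 2)) / r = lam k ^ (2 * j) * (1 + (lam k)\<^sup>2)"
      using r by (simp add: field_simps)
    finally show "((\<lambda>k. - 2 * lam k ^ (2*j+1) / (2 * real j + 1)) has_vector_derivative lam k ^ (2 * j) * (1 + (lam k)\<^sup>2)) (at k within {0..pi/2})"
      unfolding has_real_derivative_iff_has_vector_derivative[symmetric] r_def .
  qed auto
  hence "((\<lambda>k. lam k ^ (2 * j) * (1 + (lam k)\<^sup>2)) has_integral 2 / (2 * real j + 1)) {0..pi/2}"
    by (simp add: lam_def)
  with 1 have "(\<Sum>i<2. ?c i * corner_kernel 0 (?n i)) = 2 / (2 * real j + 1)"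
    using has_integral_unique by blast
  thus ?thesis by (simp add: eval_nat_numeral)
qed

lemma corner_kernel_row_step: 
  "((\<lambda>k. 2 * (lam k ^ n * sin (of_int (m + 1) * k))) has_integral corner_kernel (m + 2) n - corner_kernel m n) {0..pi/2}"
proof -
  let ?m = "\<lambda>i::nat. [m + 2, m] ! i"
  let ?c = "\<lambda>i::nat. [1, -1::real] ! i"
  have "((\<lambda>k. 2 * (lam k ^ n * sin (of_int (m + 1) * k))) has_integral (\<Sum>i<2. ?c i * corner_kernel (?m i) n)) {0..pi/2}"
  proof (rule corner_kernel_linear)
    fix k :: real assume k: "k \<in> {0<..pi/2}"
    have "(\<Sum>i<2. ?c i * (1 - lam k ^ n * cos (of_int (?m i) * k))) = lam k ^ n * (cos (of_int m * k) - cos (of_int (m + 2) * k))"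
      by (simp add: eval_nat_numeral algebra_simps)
    also have "cos (of_int m * k) - cos (of_int (m + 2) * k) = 2 * sin k * sin (of_int (m + 1) * k)"
    proof -
      have "of_int m * k = of_int (m + 1) * k - k" "of_int (m + 2) * k = of_int (m + 1) * k + k"
        by (simp_all add: algebra_simps)
      thus ?thesis by (simp only: cos_add cos_diff) simp
    qed
    finally show "(\<Sum>i<2. ?c i * (1 - lam k ^ n * cos (of_int (?m i) * k))) = sin k * (2 * (lam k ^ n * sin (of_int (m + 1) * k)))"
      by simp
  qed auto
  thus ?thesis by (simp add: eval_nat_numeral)
qed

lemma corner_kernel_row_0_step: "corner_kernel (2 * int (j + 1)) 0 - corner_kernel (2 * int j) 0 = 2 / (2 * real j + 1)"
proof -
  have "((\<lambda>k. 2 * (lam k ^ 0 * sin (of_int (2 * int j + 1) * k))) has_integral 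
     (- 2 * cos (of_int (2 * int j + 1) * (pi/2)) / (2 * real j + 1)) - (- 2 * cos (of_int (2 * int j + 1) * 0) / (2 * real j + 1))) {0..pi/2}"
  proof (intro fundamental_theorem_of_calculus)
    fix k :: real
    define r where "r = 2 * real j + 1"
    have r: "r > 0" "of_int (2 * int j + 1) = r" by (simp_all add: r_def)
    have "((\<lambda>k. - 2 * cos (r * k) / r) has_real_derivative 2 * (lam k ^ 0 * sin (r * k))) (at k within {0..pi/2})"
      using r by (auto intro!: derivative_eq_intros)
    thus "((\<lambda>k. - 2 * cos (of_int (2 * int j + 1) * k) / (2 * real j + 1)) has_vector_derivative 
        2 * (lam k ^ 0 * sin (of_int (2 * int j + 1) * k))) (at k within {0..pi/2})"
      unfolding has_real_derivative_iff_has_vector_derivative[symmetric] r using r_def by simp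
  qed auto
  moreover have "cos (of_int (2 * int j + 1) * (pi/2)) = 0"
    unfolding cos_zero_iff_int by (rule exI[of _ "2 * int j + 1"]) auto
  ultimately have "((\<lambda>k. 2 * (lam k ^ 0 * sin (of_int (2 * int j + 1) * k))) has_integral 2 / (2 * real j + 1)) {0..pi/2}"
    by (simp add: diff_divide_distrib)
  from has_integral_unique[OF this corner_kernel_row_step[of 0 "2 * int j"]] show ?thesis
    by (simp add: algebra_simps)
qed

lemma corner_kernel_axes: "corner_kernel (2 * int j) 0 = corner_kernel 0 (2 * j)"
proof (induction j)
  case (Suc j)
  thus ?case using corner_kernel_row_0_step[of j] corner_kernel_column_step[of j] by simp
qed simp

section \<open>Symmetry of the corner integrals\<close>

text \<open>The definition treats the two coordinates very differently. Both axes carry the same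
  values, however, and harmonicity together with evenness propagates values from the axes to the
  whole quadrant, one antidiagonal at a time. The symmetry restricts the asymptotic analysis to
  \<open>m \<le> n\<close>, where \<open>lam k ^ n\<close> decays and nothing oscillates.\<close>
lemma corner_kernel_symmetric_aux: "m + n = 2 * t \<Longrightarrow> corner_kernel (int m) n = corner_kernel (int n) m"
proof (induction t arbitrary: m n rule: less_induct)
  case (less t)
  consider "m = 0" | "n = 0" | "m = 1" "n = 1" | "n = 1" "m \<ge> 2" | "m = 1" "n \<ge> 2" | "m \<ge> 2" "n \<ge> 2" by linarith
  thus ?case
  proof cases
    case 1 thus ?thesis using corner_kernel_axes[of t] less.prems by simp
  next
    case 2 thus ?thesis using corner_kernel_axes[of t] less.prems by simp
  next
    case 3 thus ?thesis by simp
  next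
    have *: "corner_kernel (int m) 1 = corner_kernel 1 m" if m: "m + 1 = 2 * t" "m \<ge> 2" for m
    proof -
      obtain l where l: "m = 2 * l + 1" "l \<ge> 1" "t = l + 1"
        using m by (intro that[of "t - 1"]) auto
      have e: "corner_kernel (int (2 * l - 1)) 1 = corner_kernel (int 1) (2 * l - 1)"
        using l by (intro less.IH[of l]) auto
      have "corner_kernel (2 * int l + 1) 1 + corner_kernel (2 * int l - 1) 1 = 2 * corner_kernel (2 * int l) 0"
        using corner_kernel_axis_laplacian[of "int l"] l by simp
      moreover have "corner_kernel 1 (2 * l + 1) + corner_kernel 1 (2 * l - 1) = 2 * corner_kernel 0 (2 * l)"
        using corner_kernel_harmonic[of 0 "2 * l - 1"] l by (simp add: algebra_simps numeral_2_eq_2)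
      moreover have "int (2 * l - 1) = 2 * int l - 1" using l by auto
      ultimately show ?thesis using e corner_kernel_axes[of l] l by (simp add: algebra_simps)
    qed
    {
      case 4 thus ?thesis using *[of m] less.prems by simp
    next
      case 5 thus ?thesis using *[of n] less.prems by simp
    }
  next
    case 6
    obtain a b where ab: "m = a + 2" "n = b + 2" using 6 by (metis add.commute le_Suc_ex)
    obtain s where s: "t = s + 2" using ab less.prems by (intro that[of "t - 2"]) auto
    have abs: "a + b = 2 * s" using ab s less.prems by simp
    have h1: "corner_kernel (int a + 2) (b+2) + corner_kernel (int a) (b+2) + corner_kernel (int a + 2) b + corner_kernel (int a) b = 4 * corner_kernel (int a + 1) (b+1)"
      using corner_kernel_harmonic[of "int a + 1" b] by (simp add: algebra_simps)
    have h2: "corner_kernel (int b + 2) (a+2) + corner_kernel (int b) (a+2) + corner_kernel (int b + 2) a + corner_kernel (int b) a = 4 * corner_kernel (int b + 1) (a+1)"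
      using corner_kernel_harmonic[of "int b + 1" a] by (simp add: algebra_simps)
    have i1: "corner_kernel (int a) b = corner_kernel (int b) a" using abs s by (intro less.IH[of s]) auto
    have i2: "corner_kernel (int (a + 2)) b = corner_kernel (int b) (a+2)" using abs s by (intro less.IH[of "s+1"]) auto
    have i3: "corner_kernel (int a) (b+2) = corner_kernel (int (b + 2)) a" using abs s by (intro less.IH[of "s+1"]) auto
    have i4: "corner_kernel (int (a + 1)) (b+1) = corner_kernel (int (b+1)) (a+1)" using abs s by (intro less.IH[of "s+1"]) auto
    show ?thesis using h1 h2 i1 i2 i3 i4 by (simp add: ab algebra_simps)
  qed
qed

section \<open>Asymptotics of the corner integrals\<close>

lemma lam_le_exp: assumes "k \<in> {0..pi/2}" shows "lam k \<le> exp (- k)"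
proof -
  have "lam k * exp k \<le> lam 0 * exp 0"
  proof (rule DERIV_nonpos_imp_nonincreasing[of 0 k "\<lambda>k. lam k * exp k"])
    fix x assume x: "0 \<le> x" "x \<le> k"
    have "((\<lambda>k. lam k * exp k) has_real_derivative - (1 + (lam x)\<^sup>2) / 2 * exp x + exp x * lam x) (at x)"
      using x assms by (intro DERIV_mult lam_deriv DERIV_exp) auto
    moreover have "- (1 + (lam x)\<^sup>2) / 2 * exp x + exp x * lam x = - ((1 - lam x)\<^sup>2 / 2 * exp x)"
      by (simp add: power2_eq_square algebra_simps add_divide_distrib diff_divide_distrib)
    ultimately show "\<exists>y. ((\<lambda>k. lam k * exp k) has_real_derivative y) (at x) \<and> y \<le> 0"
      by (intro exI[of _ "- ((1 - lam x)\<^sup>2 / 2 * exp x)"]) auto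
  qed (use assms in auto)
  thus ?thesis by (simp add: exp_minus field_simps)
qed

lemma lam_power_integrable: "(\<lambda>k. lam k ^ n) integrable_on {0..pi/2}"
  by (intro integrable_continuous_interval continuous_intros lam_continuous)

text \<open>Since \<open>lam \<le> 1\<close>, the integrand dominates \<open>lam k ^ n * (1 + (lam k)\<^sup>2) / 2\<close>, an exact
  derivative. Together with the upper bound \<open>1 / n\<close> by the exponential integral, this shows that
  \<open>lam k ^ n\<close> and \<open>exp (- n k)\<close> differ only by \<open>O(1 / n\<^sup>2)\<close> in the mean.\<close>
lemma lam_power_integral_ge: "1 / (real n + 1) \<le> integral {0..pi/2} (\<lambda>k. lam k ^ n)"
proof -
  have "((\<lambda>k. lam k ^ n * ((1 + (lam k)\<^sup>2) / 2)) has_integral - (lam (pi/2) ^ (n+1) / (real n + 1)) - (- (lam 0 ^ (n+1) / (real n + 1)))) {0..pi/2}"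
  proof (intro fundamental_theorem_of_calculus)
    fix k assume k: "k \<in> {0..pi/2}"
    define r where "r = real n + 1"
    have r: "r > 0" "of_nat (n+1) = r" by (simp_all add: r_def)
    have "((\<lambda>k. - (lam k ^ (n+1) / r)) has_real_derivative 
        - (of_nat (n+1) * lam k ^ n * (- (1 + (lam k)\<^sup>2) / 2) / r)) (at k within {0..pi/2})"
      using DERIV_power[OF lam_deriv[OF k], of "n+1"] 
      by (intro DERIV_cdivide DERIV_minus) (simp add: mult_ac)
    also have "- (of_nat (n+1) * lam k ^ n * (- (1 + (lam k)\<^sup>2) / 2) / r) = lam k ^ n * ((1 + (lam k)\<^sup>2) / 2)"
      unfolding r(2) using r(1) by (simp add: field_simps)
    finally show "((\<lambda>k. - (lam k ^ (n+1) / (real n + 1))) has_vector_derivative lam k ^ n * ((1 + (lam k)\<^sup>2) / 2)) (at k within {0..pi/2})"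
      unfolding has_real_derivative_iff_has_vector_derivative[symmetric] r_def .
  qed auto
  hence "((\<lambda>k. lam k ^ n * ((1 + (lam k)\<^sup>2) / 2)) has_integral 1 / (real n + 1)) {0..pi/2}"
    by (simp add: lam_def)
  thus ?thesis
  proof (rule has_integral_le[OF _ integrable_integral[OF lam_power_integrable]])
    fix k assume k: "k \<in> {0..pi/2}"
    have "(lam k)\<^sup>2 \<le> 1" using lam_nonneg[OF k] lam_le_1[OF k] by (simp add: power_le_one)
    hence "lam k ^ n * ((1 + (lam k)\<^sup>2) / 2) \<le> lam k ^ n * 1"
      using lam_nonneg[OF k] by (intro mult_left_mono) auto
    thus "lam k ^ n * ((1 + (lam k)\<^sup>2) / 2) \<le> lam k ^ n" by simp
  qed
qed

lemma exp_integral: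
  assumes "n \<ge> 1"
  shows "((\<lambda>k. exp (- real n * k)) has_integral (1 - exp (- real n * (pi/2))) / real n) {0..pi/2}"
proof -
  have "((\<lambda>k. exp (- real n * k)) has_integral - exp (- real n * (pi/2)) / real n - - exp (- real n * 0) / real n) {0..pi/2}"
    using assms
    by (intro fundamental_theorem_of_calculus; (unfold has_real_derivative_iff_has_vector_derivative[symmetric])?)
      (auto intro!: derivative_eq_intros)
  thus ?thesis by (simp add: diff_divide_distrib)
qed

lemma lam_power_le: "k \<in> {0..pi/2} \<Longrightarrow> lam k ^ n \<le> exp (- real n * k)"
  using power_mono[OF lam_le_exp[of k] lam_nonneg[of k], of n]
  by (simp flip: exp_of_nat_mult)

lemma lam_power_integral_le:
  assumes "n \<ge> 1"
  shows "integral {0..pi/2} (\<lambda>k. lam k ^ n) \<le> 1 / real n"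
proof -
  have "integral {0..pi/2} (\<lambda>k. lam k ^ n) \<le> (1 - exp (- real n * (pi/2))) / real n"
    by (rule has_integral_le[OF integrable_integral[OF lam_power_integrable] exp_integral[OF assms]])
      (rule lam_power_le)
  also have "\<dots> \<le> 1 / real n" by (intro divide_right_mono) auto
  finally show ?thesis .
qed

lemma exp_sin_integral:
  assumes "n \<ge> 1"
  shows "((\<lambda>k. exp (- real n * k) * sin (p * k)) has_integral
     (p - exp (- real n * (pi/2)) * (real n * sin (p * (pi/2)) + p * cos (p * (pi/2)))) / ((real n)\<^sup>2 + p\<^sup>2)) {0..pi/2}"
proof -
  define q where "q = (real n)\<^sup>2 + p\<^sup>2"
  have q: "q > 0" using assms by (auto simp: q_def intro: add_pos_nonneg)
  let ?F = "\<lambda>k. - (exp (- real n * k) * (real n * sin (p * k) + p * cos (p * k)) / q)"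
  have "((\<lambda>k. exp (- real n * k) * sin (p * k)) has_integral ?F (pi/2) - ?F 0) {0..pi/2}"
  proof (intro fundamental_theorem_of_calculus)
    fix k :: real
    have "((\<lambda>k. - (exp (- real n * k) * (real n * sin (p * k) + p * cos (p * k)) / q)) has_real_derivative
      - ((exp (- real n * k) * (- real n) * (real n * sin (p * k) + p * cos (p * k)) 
       + exp (- real n * k) * (real n * (cos (p * k) * p) + p * (- sin (p * k) * p))) / q)) (at k within {0..pi/2})"
      by (intro DERIV_minus DERIV_cdivide) (auto intro!: derivative_eq_intros)
    also have "- ((exp (- real n * k) * (- real n) * (real n * sin (p * k) + p * cos (p * k)) 
       + exp (- real n * k) * (real n * (cos (p * k) * p) + p * (- sin (p * k) * p))) / q) = exp (- real n * k) * sin (p * k) * (q / q)"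
      by (simp add: q_def field_simps power2_eq_square)
    finally show "(?F has_vector_derivative exp (- real n * k) * sin (p * k)) (at k within {0..pi/2})"
      unfolding has_real_derivative_iff_has_vector_derivative[symmetric] using q by simp
  qed auto
  thus ?thesis unfolding q_def[symmetric] by (simp add: diff_divide_distrib add_divide_distrib)
qed

text \<open>Replacing \<open>lam k ^ n\<close> by \<open>exp (- n k)\<close> costs \<open>2 / n\<^sup>2\<close>. The resulting integral
  of \<open>exp (- n k) * sin (p * k)\<close> is explicit; cutting it off at \<open>pi/2\<close> costs another \<open>6 / n\<^sup>2\<close>.\<close>
lemma corner_kernel_row_step_asymp:
  assumes "n \<ge> 1" "m \<le> n"
  shows "\<bar>corner_kernel (int m + 2) n - corner_kernel (int m) n - 2 * (real m + 1) / ((real n)\<^sup>2 + (real m + 1)\<^sup>2)\<bar> \<le> 8 / (real n)\<^sup>2"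
proof -
  define p where "p = real m + 1"
  have p: "p \<ge> 1" "p \<le> 2 * real n" using assms by (simp_all add: p_def)
  define q where "q = (real n)\<^sup>2 + p\<^sup>2"
  have q: "q \<ge> (real n)\<^sup>2" "q > 0" using assms by (auto simp: q_def intro: add_pos_nonneg)
  define R where "R = exp (- real n * (pi/2)) * (real n * sin (p * (pi/2)) + p * cos (p * (pi/2)))"
  have 1: "((\<lambda>k. 2 * (lam k ^ n * sin (p * k))) has_integral corner_kernel (int m + 2) n - corner_kernel (int m) n) {0..pi/2}"
    using corner_kernel_row_step[of n "int m"] by (simp add: p_def algebra_simps)
  have 2: "((\<lambda>k. 2 * (exp (- real n * k) * sin (p * k))) has_integral 2 * ((p - R) / q)) {0..pi/2}"
    unfolding R_def q_def by (intro has_integral_mult_right exp_sin_integral assms)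
  have 3: "((\<lambda>k. 2 * (exp (- real n * k) - lam k ^ n)) has_integral 
      2 * ((1 - exp (- real n * (pi/2))) / real n - integral {0..pi/2} (\<lambda>k. lam k ^ n))) {0..pi/2}"
    by (intro has_integral_mult_right has_integral_diff exp_integral assms integrable_integral lam_power_integrable)
  note 4 = has_integral_diff[OF 1 2]
  have "norm ((corner_kernel (int m + 2) n - corner_kernel (int m) n) - 2 * ((p - R) / q)) \<le> 
      2 * ((1 - exp (- real n * (pi/2))) / real n - integral {0..pi/2} (\<lambda>k. lam k ^ n))"
    unfolding integral_unique[OF 3, symmetric] integral_unique[OF 4, symmetric]
  proof (rule integral_norm_bound_integral[OF has_integral_integrable[OF 4] has_integral_integrable[OF 3]])
    fix k assume k: "k \<in> {0..pi/2}"
    have "norm (2 * (lam k ^ n * sin (p * k)) - 2 * (exp (- real n * k) * sin (p * k))) = 2 * ((exp (- real n * k) - lam k ^ n) * \<bar>sin (p * k)\<bar>)"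
    proof -
      have "2 * (lam k ^ n * sin (p * k)) - 2 * (exp (- real n * k) * sin (p * k)) = 2 * ((lam k ^ n - exp (- real n * k)) * sin (p * k))"
        by (simp add: algebra_simps)
      thus ?thesis using lam_power_le[OF k, of n] by (simp add: abs_mult)
    qed
    also have "\<dots> \<le> 2 * ((exp (- real n * k) - lam k ^ n) * 1)"
      using lam_power_le[OF k, of n] by (intro mult_left_mono) auto
    finally show "norm (2 * (lam k ^ n * sin (p * k)) - 2 * (exp (- real n * k) * sin (p * k))) \<le> 2 * (exp (- real n * k) - lam k ^ n)"
      by simp
  qed
  also have "\<dots> \<le> 2 * (1 / real n - 1 / (real n + 1))"
    using lam_power_integral_ge[of n] by (intro mult_left_mono diff_mono divide_right_mono) auto
  also have "\<dots> \<le> 2 * (1 / (real n)\<^sup>2)"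
  proof -
    have "1 / real n - 1 / (real n + 1) = 1 / (real n * (real n + 1))" using assms by (simp add: field_simps)
    also have "\<dots> \<le> 1 / (real n)\<^sup>2"
      unfolding power2_eq_square using assms by (intro divide_left_mono mult_left_mono mult_pos_pos) auto
    finally show ?thesis by simp
  qed
  finally have a: "\<bar>(corner_kernel (int m + 2) n - corner_kernel (int m) n) - 2 * ((p - R) / q)\<bar> \<le> 2 / (real n)\<^sup>2" by simp
  have "\<bar>R\<bar> \<le> exp (- real n) * (real n + p)"
    unfolding R_def abs_mult
  proof (intro mult_mono)
    show "\<bar>exp (- real n * (pi / 2))\<bar> \<le> exp (- real n)"
      using pi_ge_two assms by (auto simp: field_simps)
    have "\<bar>real n * sin (p * (pi / 2)) + p * cos (p * (pi / 2))\<bar> \<le> \<bar>real n * sin (p * (pi / 2))\<bar> + \<bar>p * cos (p * (pi / 2))\<bar>" by simp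
    also have "\<dots> \<le> real n * 1 + p * 1"
      using p unfolding abs_mult by (intro add_mono mult_mono) auto
    finally show "\<bar>real n * sin (p * (pi / 2)) + p * cos (p * (pi / 2))\<bar> \<le> real n + p" by simp
  qed auto
  also have "\<dots> \<le> exp (- real n) * (3 * real n)" using p by (intro mult_left_mono) auto
  also have "\<dots> \<le> 3"
  proof -
    have "real n \<le> exp (real n)" using exp_ge_add_one_self[of "real n"] by linarith
    hence "real n * exp (- real n) \<le> exp (real n) * exp (- real n)" by (intro mult_right_mono) auto
    thus ?thesis by (simp add: exp_minus_inverse algebra_simps)
  qed
  finally have R: "\<bar>R\<bar> \<le> 3" .
  have "\<bar>R / q\<bar> \<le> 3 / (real n)\<^sup>2"
    unfolding abs_divide using R q assms by (intro frac_le) auto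
  moreover have "2 * (p - R) / q - 2 * p / q = - 2 * (R / q)" by (simp add: diff_divide_distrib algebra_simps)
  moreover have "3 / (real n)\<^sup>2 * 2 = 6 / (real n)\<^sup>2" by simp
  ultimately have "\<bar>2 * (p - R) / q - 2 * p / q\<bar> \<le> 6 / (real n)\<^sup>2" by linarith
  with a have "\<bar>corner_kernel (int m + 2) n - corner_kernel (int m) n - 2 * p / q\<bar> \<le> 8 / (real n)\<^sup>2"
  proof -
    have "2 / (real n)\<^sup>2 + 6 / (real n)\<^sup>2 = 8 / (real n)\<^sup>2" by (simp flip: add_divide_distrib)
    moreover have "2 * ((p - R) / q) = 2 * (p - R) / q" by simp
    ultimately show ?thesis using a \<open>\<bar>2 * (p - R) / q - 2 * p / q\<bar> \<le> 6 / (real n)\<^sup>2\<close> by linarith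
  qed
  thus ?thesis by (simp add: p_def q_def)
qed

text \<open>The mean value theorem, with the intermediate point moved to the midpoint: the derivative
  \<open>t / (t\<^sup>2 + n\<^sup>2)\<close> has Lipschitz constant at most \<open>1 / n\<^sup>2\<close>.\<close>
lemma ln_row_step:
  assumes "n \<ge> 1"
  shows "\<bar>ln ((real m + 2)\<^sup>2 + (real n)\<^sup>2) / 2 - ln ((real m)\<^sup>2 + (real n)\<^sup>2) / 2 
     - 2 * (real m + 1) / ((real n)\<^sup>2 + (real m + 1)\<^sup>2)\<bar> \<le> 2 / (real n)\<^sup>2"
proof -
  define p where "p = real m + 1"
  define N where "N = (real n)\<^sup>2"
  have N: "N > 0" using assms by (simp add: N_def)
  have pos: "t\<^sup>2 + N > 0" for t using N by (intro add_nonneg_pos) auto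
  have "\<exists>z>real m. z < real m + 2 \<and> ln ((real m + 2)\<^sup>2 + N) / 2 - ln ((real m)\<^sup>2 + N) / 2 = (real m + 2 - real m) * (z / (z\<^sup>2 + N))"
  proof (intro MVT2)
    fix x
    have "((\<lambda>x. x\<^sup>2 + N) has_real_derivative 2 * x) (at x)"
      by (auto intro!: derivative_eq_intros)
    hence "((\<lambda>x. ln (x\<^sup>2 + N) / 2) has_real_derivative 1 / (x\<^sup>2 + N) * (2 * x) / 2) (at x)"
      by (intro DERIV_cdivide DERIV_chain2[where f = ln and x = x and g = "\<lambda>x. x\<^sup>2 + N", OF DERIV_ln_divide[OF pos[of x]]])
    moreover have "1 / q * (2 * x) / 2 = x / q" for q :: real by simp
    ultimately show "((\<lambda>x. ln (x\<^sup>2 + N) / 2) has_real_derivative x / (x\<^sup>2 + N)) (at x)" by metis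
  qed auto
  then obtain z where z: "z > real m" "z < real m + 2"
    "ln ((real m + 2)\<^sup>2 + N) / 2 - ln ((real m)\<^sup>2 + N) / 2 = 2 * (z / (z\<^sup>2 + N))" by auto
  have zp: "z > 0" "p > 0" "\<bar>z - p\<bar> \<le> 1" using z by (auto simp: p_def)
  have "z / (z\<^sup>2 + N) - p / (p\<^sup>2 + N) = (z - p) * (N - z * p) / ((z\<^sup>2 + N) * (p\<^sup>2 + N))"
    using pos[of z] pos[of p] by (simp add: divide_simps) (simp add: algebra_simps power2_eq_square)
  also have "\<bar>\<dots>\<bar> = \<bar>z - p\<bar> * (\<bar>N - z * p\<bar> / ((z\<^sup>2 + N) * (p\<^sup>2 + N)))"
    using pos[of z] pos[of p] by (simp add: abs_mult)
  also have "\<bar>N - z * p\<bar> / ((z\<^sup>2 + N) * (p\<^sup>2 + N)) \<le> 1 / N"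
  proof -
    have "\<bar>N - z * p\<bar> \<le> N + z * p" using zp N by (auto simp: abs_if)
    hence "\<bar>N - z * p\<bar> * N \<le> (N + z * p) * (N + z * p)"
      using zp N by (intro mult_mono) auto
    also have "\<dots> = (z\<^sup>2 + N) * (p\<^sup>2 + N) - N * (z - p)\<^sup>2"
      by (simp add: power2_eq_square algebra_simps)
    also have "\<dots> \<le> (z\<^sup>2 + N) * (p\<^sup>2 + N)" using N by simp
    finally have "\<bar>N - z * p\<bar> * N \<le> (z\<^sup>2 + N) * (p\<^sup>2 + N)" .
    hence "\<bar>N - z * p\<bar> \<le> (z\<^sup>2 + N) * (p\<^sup>2 + N) / N" using N by (simp add: pos_le_divide_eq)
    moreover have "0 < (z\<^sup>2 + N) * (p\<^sup>2 + N)" by (intro mult_pos_pos pos)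
    ultimately show ?thesis by (simp add: pos_divide_le_eq)
  qed
  hence "\<bar>z - p\<bar> * (\<bar>N - z * p\<bar> / ((z\<^sup>2 + N) * (p\<^sup>2 + N))) \<le> 1 * (1 / N)"
    using zp N by (intro mult_mono) (auto intro!: divide_nonneg_pos mult_pos_pos pos)
  finally have "\<bar>z / (z\<^sup>2 + N) - p / (p\<^sup>2 + N)\<bar> \<le> 1 / N" by simp
  hence "\<bar>2 * (z / (z\<^sup>2 + N)) - 2 * p / (p\<^sup>2 + N)\<bar> \<le> 2 / N"
    unfolding times_divide_eq_right[symmetric] right_diff_distrib[symmetric] abs_mult by simp
  thus ?thesis unfolding z(3)[symmetric] by (simp add: p_def N_def add.commute)
qed

text \<open>At most \<open>n / 2\<close> steps lead from the column to a point with \<open>m \<le> n\<close>, so errors of size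
  \<open>O(1 / n\<^sup>2)\<close> per step add up to \<open>O(1 / n)\<close>.\<close>
lemma corner_kernel_row_asymp:
  assumes "n \<ge> 1" "m + 2 * j \<le> n"
  shows "\<bar>(corner_kernel (int (m + 2 * j)) n - ln ((real (m + 2 * j))\<^sup>2 + (real n)\<^sup>2) / 2) - (corner_kernel (int m) n - ln ((real m)\<^sup>2 + (real n)\<^sup>2) / 2)\<bar> \<le> 10 * real j / (real n)\<^sup>2"
  using assms(2)
proof (induction j)
  case (Suc j)
  have 1: "\<bar>(corner_kernel (int (m + 2 * j)) n - ln ((real (m + 2 * j))\<^sup>2 + (real n)\<^sup>2) / 2) - (corner_kernel (int m) n - ln ((real m)\<^sup>2 + (real n)\<^sup>2) / 2)\<bar> \<le> 10 * real j / (real n)\<^sup>2"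
    using Suc by simp
  let ?k = "m + 2 * j"
  have k: "int (m + 2 * Suc j) = int ?k + 2" "real (m + 2 * Suc j) = real ?k + 2" by simp_all
  have 2: "\<bar>corner_kernel (int ?k + 2) n - corner_kernel (int ?k) n - 2 * (real ?k + 1) / ((real n)\<^sup>2 + (real ?k + 1)\<^sup>2)\<bar> \<le> 8 / (real n)\<^sup>2"
    using assms Suc.prems by (intro corner_kernel_row_step_asymp) auto
  note 3 = ln_row_step[OF assms(1), of ?k]
  have "10 * real (Suc j) / (real n)\<^sup>2 = 10 * real j / (real n)\<^sup>2 + (8 / (real n)\<^sup>2 + 2 / (real n)\<^sup>2)"
    by (simp add: add_divide_distrib)
  thus ?case unfolding k using 1 2 3 by linarith
qed simp

lemma harm_asymp:
  assumes "n \<ge> 1"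
  shows "\<bar>harm n - ln (real n) - euler_mascheroni\<bar> \<le> 1 / real n"
proof -
  obtain l where l: "n = Suc l" using assms by (cases n) auto
  have "ln (real (l + 2)) - ln (real (l + 1)) \<le> 1 / real (l + 1)"
  proof -
    have "real (l + 2) = real (l + 1) * (1 + 1 / real (l + 1))" by (simp add: field_simps)
    hence "ln (real (l + 2)) = ln (real (l + 1)) + ln (1 + 1 / real (l + 1))" by (simp only:, subst ln_mult) (auto intro: add_pos_nonneg)
    thus ?thesis using ln_add_one_self_le_self[of "1 / real (l+1)"] by simp
  qed
  moreover have "ln (real (l + 2)) - ln (real (l + 1)) \<ge> 0" by simp
  moreover have "1 / real (2 * (l + 2)) \<ge> 0" "1 / real (2 * (l + 1)) \<le> 1 / real (l + 1)" "1 / real (2 * (l + 2)) \<le> 1 / real (l + 1)"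
    by (auto intro!: divide_left_mono)
  moreover note euler_mascheroni_lower[of l] euler_mascheroni_upper[of l]
  moreover have "real n = real (l + 1)" by (simp add: l)
  ultimately show ?thesis unfolding l abs_le_iff by (simp only: Suc_eq_plus1) linarith
qed

text \<open>The increments \<open>2 / (2 j + 1)\<close> are twice the odd terms of the harmonic series.\<close>
lemma corner_kernel_column_harm: "corner_kernel 0 (2 * l) = 2 * harm (2 * l) - harm l"
proof (induction l)
  case (Suc l)
  have "2 * Suc l = Suc (Suc (2 * l))" by simp
  hence "(harm (2 * Suc l) :: real) = harm (2 * l) + 1 / (2 * real l + 1) + 1 / (2 * real l + 2)"
    by (simp only: harm_Suc) (simp add: inverse_eq_divide add_ac)
  moreover have "inverse (real l + 1) = 2 / (2 * real l + 2)"
    by (simp add: divide_simps)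
  hence "(harm (Suc l) :: real) = harm l + 2 / (2 * real l + 2)"
    by (simp add: harm_Suc add_ac)
  moreover have "2 / (2 * real l + 1) = 2 * (1 / (2 * real l + 1))" "2 / (2 * real l + 2) = 2 * (1 / (2 * real l + 2))" by simp_all
  moreover have "corner_kernel 0 (2 * Suc l) = corner_kernel 0 (2 * l) + 2 / (2 * real l + 1)"
    using corner_kernel_column_step[of l] by simp
  ultimately show ?case unfolding Suc by linarith
qed (simp add: harm_def)

lemma corner_kernel_column_asymp:
  assumes "l \<ge> 1"
  shows "\<bar>corner_kernel 0 (2 * l) - ln (real (2 * l)) - (euler_mascheroni + ln 2)\<bar> \<le> 2 / real l"
proof -
  have "\<bar>harm (2 * l) - ln (real (2 * l)) - euler_mascheroni\<bar> \<le> 1 / real (2 * l)" "\<bar>harm l - ln (real l) - euler_mascheroni\<bar> \<le> 1 / real l"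
    by (rule harm_asymp, use assms in simp)+
  moreover have "ln (real (2 * l)) = ln 2 + ln (real l)" using assms by (simp add: ln_mult)
  moreover have "2 / real l = 1 / real l + 2 * (1 / real (2 * l))" using assms by (simp add: field_simps)
  ultimately show ?thesis unfolding corner_kernel_column_harm by linarith
qed

lemma corner_kernel_1_step: "corner_kernel 1 (n + 1) - corner_kernel 0 n = integral {0..pi/2} (\<lambda>k. lam k ^ n)"
proof -
  let ?m = "\<lambda>i::nat. [1, 0::int] ! i"
  let ?n = "\<lambda>i::nat. [n + 1, n] ! i"
  let ?c = "\<lambda>i::nat. [1, -1::real] ! i"
  have "((\<lambda>k. lam k ^ n) has_integral (\<Sum>i<2. ?c i * corner_kernel (?m i) (?n i))) {0..pi/2}"
  proof (rule corner_kernel_linear)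
    fix k :: real assume k: "k \<in> {0<..pi/2}"
    have "(\<Sum>i<2. ?c i * (1 - lam k ^ ?n i * cos (of_int (?m i) * k))) = lam k ^ n * (1 - lam k * cos k)"
      by (simp add: eval_nat_numeral algebra_simps)
    also have "\<dots> = sin k * lam k ^ n"
      using k by (subst lam_cos) auto
    finally show "(\<Sum>i<2. ?c i * (1 - lam k ^ ?n i * cos (of_int (?m i) * k))) = sin k * lam k ^ n" .
  qed auto
  thus ?thesis by (simp add: eval_nat_numeral integral_unique)
qed

lemma corner_kernel_column_1_asymp:
  assumes "l \<ge> 1"
  shows "\<bar>corner_kernel 1 (2 * l + 1) - ln (1 + (real (2 * l + 1))\<^sup>2) / 2 - (euler_mascheroni + ln 2)\<bar> \<le> 4 / real l"
proof -
  have "0 \<le> integral {0..pi/2} (\<lambda>k. lam k ^ (2 * l))"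
    using lam_power_integral_ge[of "2 * l"] by (rule order_trans[rotated]) auto
  moreover have "integral {0..pi/2} (\<lambda>k. lam k ^ (2 * l)) \<le> 1 / real (2 * l)"
    using assms by (intro lam_power_integral_le) auto
  moreover have "1 / real (2 * l) \<le> 1 / real l" using assms by (simp add: field_simps)
  moreover have "ln (1 + (real (2 * l + 1))\<^sup>2) / 2 - ln (real (2 * l)) \<ge> 0"
  proof -
    have "ln (real (2 * l)) = ln ((real (2 * l))\<^sup>2) / 2" using assms by (subst ln_realpow) auto
    also have "\<dots> \<le> ln (1 + (real (2 * l + 1))\<^sup>2) / 2"
      using assms by (intro divide_right_mono ln_mono add_increasing power_mono) auto
    finally show ?thesis by simp
  qed
  moreover have "ln (1 + (real (2 * l + 1))\<^sup>2) / 2 - ln (real (2 * l)) \<le> 1 / real l"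
  proof -
    have "ln (1 + (real (2 * l + 1))\<^sup>2) / 2 \<le> ln ((real (2 * l) + 2)\<^sup>2) / 2"
      by (intro divide_right_mono ln_mono) (auto simp: power2_eq_square algebra_simps add_pos_nonneg)
    also have "\<dots> = ln (real (2 * l) + 2)" by (subst ln_realpow) auto
    also have "real (2 * l) + 2 = real (2 * l) * (1 + 1 / real l)" using assms by (simp add: field_simps)
    also have "ln \<dots> = ln (real (2 * l)) + ln (1 + 1 / real l)"
      using assms by (intro ln_mult_pos) (auto simp: add_pos_pos)
    also have "\<dots> \<le> ln (real (2 * l)) + 1 / real l" by (intro add_left_mono ln_add_one_self_le_self) auto
    finally show ?thesis by simp
  qed
  moreover have "4 / real l = 1 / real l + 1 / real l + 2 / real l" by (simp add: field_simps)
  ultimately show ?thesis using corner_kernel_column_asymp[OF assms] corner_kernel_1_step[of "2 * l"] by (simp only: abs_le_iff) linarith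
qed

lemma corner_kernel_asymp:
  obtains C where "C > 0" "\<And>m n. \<lbrakk>n \<ge> 1; m \<le> n; even (m + n)\<rbrakk> \<Longrightarrow>
     \<bar>corner_kernel (int m) n - ln ((real m)\<^sup>2 + (real n)\<^sup>2) / 2 - (euler_mascheroni + ln 2)\<bar> \<le> C / real n"
proof -
  \<comment> \<open>The column estimate for odd heights starts at height three; this accounts for height one.\<close>
  define D where "D = \<bar>corner_kernel 1 1 - ln 2 / 2 - (euler_mascheroni + ln 2)\<bar>"
  show ?thesis
  proof (rule that[of "22 + D"])
    fix m n :: nat assume n: "n \<ge> 1" "m \<le> n" "even (m + n)"
    have "\<exists>m0 j. m = m0 + 2 * j \<and> (m0 = 0 \<or> m0 = 1)"
      by (rule exI[of _ "m mod 2"], rule exI[of _ "m div 2"]) auto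
    then obtain m0 j where j: "m = m0 + 2 * j" "m0 = 0 \<or> m0 = 1" by blast
    have base: "\<bar>corner_kernel (int m0) n - ln ((real m0)\<^sup>2 + (real n)\<^sup>2) / 2 - (euler_mascheroni + ln 2)\<bar> \<le> (12 + D) / real n"
      using j(2)
    proof
      assume m0: "m0 = 0"
      with n j have "even n" by auto
      then obtain l where l: "n = 2 * l" by blast
      have "l \<ge> 1" using l n by auto
      have "\<bar>corner_kernel 0 n - ln (real n) - (euler_mascheroni + ln 2)\<bar> \<le> 2 / real l"
        using corner_kernel_column_asymp[OF \<open>l \<ge> 1\<close>] unfolding l .
      also have "\<dots> = 4 / real n" using \<open>l \<ge> 1\<close> by (simp add: l)
      also have "\<dots> \<le> (12 + D) / real n" by (intro divide_right_mono) (auto simp: D_def)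
      finally show ?thesis using n by (simp add: m0 ln_realpow)
    next
      assume m0: "m0 = 1"
      with n j have "odd n" by auto
      then obtain l where l: "n = 2 * l + 1" by (elim oddE)
      show ?thesis
      proof (cases "l = 0")
        case True
        thus ?thesis by (simp add: m0 l D_def)
      next
        case False
        hence l1: "l \<ge> 1" by simp
        have "\<bar>corner_kernel 1 n - ln (1 + (real n)\<^sup>2) / 2 - (euler_mascheroni + ln 2)\<bar> \<le> 4 / real l"
          using corner_kernel_column_1_asymp[OF l1] unfolding l .
        also have "\<dots> \<le> 12 / real n" using l1 by (simp add: l field_simps)
        also have "\<dots> \<le> (12 + D) / real n" by (intro divide_right_mono) (auto simp: D_def)
        finally show ?thesis by (simp add: m0)
      qed
    qed
    have "\<bar>(corner_kernel (int m) n - ln ((real m)\<^sup>2 + (real n)\<^sup>2) / 2) - (corner_kernel (int m0) n - ln ((real m0)\<^sup>2 + (real n)\<^sup>2) / 2)\<bar> \<le> 10 * real j / (real n)\<^sup>2"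
      unfolding j(1) using n j by (intro corner_kernel_row_asymp) auto
    also have "\<dots> \<le> 10 * real n / (real n)\<^sup>2" using n j by (intro divide_right_mono) auto
    also have "\<dots> = 10 / real n" using n by (simp add: power2_eq_square)
    finally show "\<bar>corner_kernel (int m) n - ln ((real m)\<^sup>2 + (real n)\<^sup>2) / 2 - (euler_mascheroni + ln 2)\<bar> \<le> (22 + D) / real n"
      using base by (simp add: add_divide_distrib)
  qed (auto simp: D_def)
qed

section \<open>The potential kernel of the lattice\<close>

definition kernel :: "int \<times> int \<Rightarrow> real" where
  "kernel x = corner_kernel (fst x + snd x) (nat \<bar>fst x - snd x\<bar>) / (2 * pi)"

lemma kernel_nonneg: "kernel x \<ge> 0"
  using corner_kernel_nonneg by (simp add: kernel_def)

lemma kernel_0 [simp]: "kernel 0 = 0" "kernel (0, 0) = 0"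
  by (simp_all add: kernel_def)

lemma kernel_laplacian: "discrete_laplacian kernel x = indicator {0} x"
proof -
  obtain a b where x: "x = (a, b)" by (cases x)
  define m n where "m = a + b" and "n = a - b"
  have L: "discrete_laplacian kernel x = (corner_kernel (m + 1) (nat \<bar>n + 1\<bar>) + corner_kernel (m - 1) (nat \<bar>n - 1\<bar>) + corner_kernel (m + 1) (nat \<bar>n - 1\<bar>) + corner_kernel (m - 1) (nat \<bar>n + 1\<bar>)
     - 4 * corner_kernel m (nat \<bar>n\<bar>)) / (2 * pi)"
    unfolding x discrete_laplacian_eq kernel_def m_def n_def
    by (simp add: algebra_simps add_divide_distrib diff_divide_distrib)
  consider "n \<ge> 1" | "n \<le> -1" | "n = 0" by linarith
  thus ?thesis
  proof cases
    case 1
    then obtain k where k: "n = int k + 1" by (metis add.commute zle_iff_zadd)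
    hence "nat \<bar>n + 1\<bar> = k + 2" "nat \<bar>n - 1\<bar> = k" "nat \<bar>n\<bar> = k + 1" by auto
    moreover have "x \<noteq> 0" using 1 by (auto simp: x n_def zero_prod_def)
    ultimately show ?thesis using corner_kernel_harmonic[of m k] unfolding L by simp
  next
    case 2
    then obtain k where k: "- n = int k + 1" by (metis add.commute zle_iff_zadd le_minus_iff)
    hence "nat \<bar>n + 1\<bar> = k" "nat \<bar>n - 1\<bar> = k + 2" "nat \<bar>n\<bar> = k + 1" by auto
    moreover have "x \<noteq> 0" using 2 by (auto simp: x n_def zero_prod_def)
    ultimately show ?thesis using corner_kernel_harmonic[of m k] unfolding L by simp
  next
    case 3
    hence m: "m = 2 * a" and ab: "a = b" by (simp_all add: m_def n_def)
    have "discrete_laplacian kernel x = 2 * (corner_kernel (2 * a + 1) 1 + corner_kernel (2 * a - 1) 1 - 2 * corner_kernel (2 * a) 0) / (2 * pi)"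
      unfolding L by (simp add: 3 m)
    also have "\<dots> = indicator {0} x" unfolding corner_kernel_axis_laplacian
      using ab by (auto simp: x zero_prod_def)
    finally show ?thesis .
  qed
qed

lemma lattice_norm_nonneg [simp]: "lattice_norm x \<ge> 0"
  by (simp add: lattice_norm_def)

lemma lattice_norm_triangle: "lattice_norm (x + y) \<le> lattice_norm x + lattice_norm y"
  unfolding lattice_norm_def using norm_triangle_ineq[of "(real_of_int (fst x), real_of_int (snd x))" "(real_of_int (fst y), real_of_int (snd y))"]
  by simp

lemma lattice_norm_minus [simp]: "lattice_norm (- x) = lattice_norm x"
  by (simp add: lattice_norm_def norm_Pair)

lemma lattice_norm_diff: "lattice_norm (x - y) \<le> lattice_norm x + lattice_norm y"
  using lattice_norm_triangle[of x "- y"] by simp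

lemma lattice_norm_0 [simp]: "lattice_norm 0 = 0"
  by (simp add: lattice_norm_def norm_Pair)

lemma lattice_norm_power2: "(lattice_norm x)\<^sup>2 = (real_of_int (fst x))\<^sup>2 + (real_of_int (snd x))\<^sup>2"
  by (simp add: lattice_norm_def norm_Pair)

lemma abs_le_lattice_norm:
  "\<bar>real_of_int (fst x)\<bar> \<le> lattice_norm x" "\<bar>real_of_int (snd x)\<bar> \<le> lattice_norm x"
  using real_sqrt_ge_abs1 real_sqrt_ge_abs2 by (cases x, simp add: lattice_norm_eq)+

lemma lattice_norm_ge_1: "x \<noteq> 0 \<Longrightarrow> lattice_norm x \<ge> 1"
proof -
  assume "x \<noteq> 0"
  hence "fst x \<noteq> 0 \<or> snd x \<noteq> 0" by (auto simp: prod_eq_iff)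
  hence "0 < (fst x)\<^sup>2 + (snd x)\<^sup>2" by (simp add: sum_power2_gt_zero_iff)
  hence "1 \<le> (fst x)\<^sup>2 + (snd x)\<^sup>2" by linarith
  hence "real_of_int 1 \<le> real_of_int ((fst x)\<^sup>2 + (snd x)\<^sup>2)" by (simp only: of_int_le_iff)
  hence "1\<^sup>2 \<le> (lattice_norm x)\<^sup>2" by (simp add: lattice_norm_power2)
  thus ?thesis by (rule power2_le_imp_le) simp
qed

definition c_kernel :: real where
  "c_kernel = (euler_mascheroni + 3 / 2 * ln 2) / (2 * pi)"

text \<open>The exact constant term of the kernel has \<open>3/2 * ln 2\<close> where \<open>gamma0\<close> has \<open>1/2 * ln 2\<close>. So
  an upper bound with the exact constant implies one with \<open>gamma0\<close>.\<close>
lemma gamma0_le_c_kernel: "gamma0 / 2 \<le> c_kernel"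
proof -
  have "gamma0 / 2 = (euler_mascheroni + 1 / 2 * ln 2) / (2 * pi)"
    by (simp add: gamma0_def)
  also have "\<dots> \<le> c_kernel" unfolding c_kernel_def
    by (intro divide_right_mono add_left_mono mult_right_mono) auto
  finally show ?thesis .
qed

text \<open>In rotated coordinates \<open>p\<^sup>2 + q\<^sup>2 = 2 |x|\<^sup>2\<close>, which accounts for an additional
  \<open>ln 2 / 2\<close>, and the larger of \<open>p\<close>, \<open>q\<close> is at least \<open>|x|\<close>.\<close>
lemma kernel_asymp:
  obtains C where "C > 0" "\<And>x. x \<noteq> 0 \<Longrightarrow> \<bar>kernel x - ln (lattice_norm x) / (2 * pi) - c_kernel\<bar> \<le> C / lattice_norm x"
proof -
  obtain C where C: "C > 0" "\<And>m n. \<lbrakk>n \<ge> 1; m \<le> n; even (m + n)\<rbrakk> \<Longrightarrow>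
     \<bar>corner_kernel (int m) n - ln ((real m)\<^sup>2 + (real n)\<^sup>2) / 2 - (euler_mascheroni + ln 2)\<bar> \<le> C / real n"
    by (rule corner_kernel_asymp) blast
  show ?thesis
  proof (rule that[of "C / (2 * pi)"])
    fix x :: "int \<times> int" assume x: "x \<noteq> 0"
    obtain a b where ab: "x = (a, b)" by (cases x)
    define p q where "p = nat \<bar>a + b\<bar>" and "q = nat \<bar>a - b\<bar>"
    define r where "r = lattice_norm x"
    have r: "r \<ge> 1" using lattice_norm_ge_1[OF x] by (simp add: r_def)
    have par: "even (p + q)" "even (q + p)" unfolding p_def q_def by (auto simp: even_nat_iff)
    have "(real p)\<^sup>2 + (real q)\<^sup>2 = (real_of_int (a + b))\<^sup>2 + (real_of_int (a - b))\<^sup>2"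
      by (simp add: p_def q_def)
    also have "\<dots> = 2 * ((real_of_int a)\<^sup>2 + (real_of_int b)\<^sup>2)"
      by (simp add: power2_eq_square algebra_simps)
    finally have pq: "(real p)\<^sup>2 + (real q)\<^sup>2 = 2 * r\<^sup>2"
      by (simp add: r_def lattice_norm_power2 ab)
    have "kernel x = corner_kernel (a + b) q / (2 * pi)" by (simp add: kernel_def ab q_def)
    also have "corner_kernel (a + b) q = corner_kernel (int p) q" by (cases "a + b \<ge> 0") (simp_all add: p_def corner_kernel_even[of "a + b", symmetric] del: corner_kernel_even)
    finally have Ax: "kernel x = corner_kernel (int p) q / (2 * pi)" .
    have sym: "corner_kernel (int p) q = corner_kernel (int q) p" using par by (metis corner_kernel_symmetric_aux evenE)
    define M where "M = max p q"
    have M: "\<bar>corner_kernel (int p) q - ln (2 * r\<^sup>2) / 2 - (euler_mascheroni + ln 2)\<bar> \<le> C / real M"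
    proof (cases "p \<le> q")
      case True
      have "q \<ge> 1" using True pq r by (cases "q = 0") auto
      from C(2)[OF this True par(1)] True show ?thesis by (simp add: pq M_def)
    next
      case False
      have "p \<ge> 1" using False by auto
      from C(2)[OF this _ par(2)] False show ?thesis by (simp add: pq M_def sym add.commute)
    qed
    have "2 * r\<^sup>2 \<le> (real M)\<^sup>2 + (real M)\<^sup>2"
      unfolding pq[symmetric] M_def by (intro add_mono power_mono) auto
    hence "r\<^sup>2 \<le> (real M)\<^sup>2" by simp
    hence "r \<le> real M" by (rule power2_le_imp_le) simp
    hence "C / real M \<le> C / r" using r C(1) by (intro divide_left_mono mult_pos_pos) auto
    moreover have "ln (2 * r\<^sup>2) / 2 = ln 2 / 2 + ln r" using r by (simp add: ln_mult ln_realpow add_divide_distrib)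
    ultimately have a: "\<bar>corner_kernel (int p) q - ln r - (euler_mascheroni + 3 / 2 * ln 2)\<bar> \<le> C / r" using M by linarith
    have "kernel x - ln r / (2 * pi) - c_kernel = (corner_kernel (int p) q - ln r - (euler_mascheroni + 3 / 2 * ln 2)) / (2 * pi)"
      unfolding Ax c_kernel_def by (simp add: diff_divide_distrib)
    also have "\<bar>\<dots>\<bar> \<le> C / r / (2 * pi)"
      using divide_right_mono[OF a, of "2 * pi"] by (simp add: abs_divide)
    also have "C / r / (2 * pi) = C / (2 * pi) / r" by (simp only: divide_divide_eq_left mult.commute)
    finally show "\<bar>kernel x - ln (lattice_norm x) / (2 * pi) - c_kernel\<bar> \<le> C / (2 * pi) / lattice_norm x"
      by (simp only: r_def)
  qed (use C in auto)
qed

text \<open>A substitute for \<open>|x|\<close> that is at least \<open>1\<close>, so that negative powers and logarithms behave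
  well at the origin.\<close>
definition bracket :: "int \<times> int \<Rightarrow> real" where "bracket x = 1 + lattice_norm x"

lemma bracket_ge_1: "bracket x \<ge> 1" by (simp add: bracket_def)
lemma bracket_pos: "bracket x > 0" using bracket_ge_1[of x] by linarith

lemma bracket_le: "x \<noteq> 0 \<Longrightarrow> bracket x \<le> 2 * lattice_norm x"
  using lattice_norm_ge_1[of x] by (simp add: bracket_def)

lemma bracket_powr_le_1: "\<theta> \<ge> 0 \<Longrightarrow> bracket x powr (- \<theta>) \<le> 1"
  using powr_mono[of "- \<theta>" 0 "bracket x"] bracket_ge_1[of x] bracket_pos[of x] by simp

lemma kernel_log_bound:
  obtains C where "C > 0" "\<And>x. \<bar>kernel x - ln (bracket x) / (2 * pi)\<bar> \<le> C"
proof -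
  obtain C where C: "C > 0" "\<And>x. x \<noteq> 0 \<Longrightarrow> \<bar>kernel x - ln (lattice_norm x) / (2 * pi) - c_kernel\<bar> \<le> C / lattice_norm x"
    by (rule kernel_asymp) blast
  have "\<bar>kernel x - ln (bracket x) / (2 * pi)\<bar> \<le> C + \<bar>c_kernel\<bar> + ln 2 / (2 * pi)" for x
  proof (cases "x = 0")
    case True
    thus ?thesis using C(1) by (simp add: bracket_def)
  next
    case False
    note r = lattice_norm_ge_1[OF False]
    have "C / lattice_norm x \<le> C" using r C(1) by (simp add: divide_le_eq)
    moreover have "ln (bracket x) \<le> ln (2 * lattice_norm x)" using bracket_le[OF False] bracket_pos by (subst ln_le_cancel_iff) (use r in auto)
    hence "ln (bracket x) / (2 * pi) \<le> ln 2 / (2 * pi) + ln (lattice_norm x) / (2 * pi)" 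
      using r by (simp add: ln_mult add_divide_distrib[symmetric] divide_right_mono)
    moreover have "ln (lattice_norm x) / (2 * pi) \<le> ln (bracket x) / (2 * pi)"
      using r by (intro divide_right_mono) (auto simp: bracket_def)
    ultimately show ?thesis using C(2)[OF False] by linarith
  qed
  thus ?thesis using C(1) by (intro that[of "C + \<bar>c_kernel\<bar> + ln 2 / (2 * pi)"]) (auto intro!: add_pos_nonneg)
qed

lemma finite_lattice_ball: "finite {x. lattice_norm x \<le> r}"
proof (rule finite_subset)
  show "{x. lattice_norm x \<le> r} \<subseteq> {-\<lceil>r\<rceil>..\<lceil>r\<rceil>} \<times> {-\<lceil>r\<rceil>..\<lceil>r\<rceil>}"
  proof
    fix x assume "x \<in> {x. lattice_norm x \<le> r}"
    hence x: "lattice_norm x \<le> r" by simp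
    note abs_le_lattice_norm[of x]
    hence "\<bar>real_of_int (fst x)\<bar> \<le> of_int \<lceil>r\<rceil>" "\<bar>real_of_int (snd x)\<bar> \<le> of_int \<lceil>r\<rceil>"
      using x le_of_int_ceiling[of r] by linarith+
    hence "\<bar>fst x\<bar> \<le> \<lceil>r\<rceil>" "\<bar>snd x\<bar> \<le> \<lceil>r\<rceil>" by linarith+
    thus "x \<in> {-\<lceil>r\<rceil>..\<lceil>r\<rceil>} \<times> {-\<lceil>r\<rceil>..\<lceil>r\<rceil>}" by (cases x) auto
  qed
qed auto

lemma finite_kernel_sublevel: "finite {x. kernel x \<le> M}"
proof -
  obtain C where C: "C > 0" "\<And>x. \<bar>kernel x - ln (bracket x) / (2 * pi)\<bar> \<le> C" by (rule kernel_log_bound) blast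
  have "{x. kernel x \<le> M} \<subseteq> {x. lattice_norm x \<le> exp (2 * pi * (M + C))}"
  proof safe
    fix a b assume "kernel (a, b) \<le> M"
    hence "ln (bracket (a, b)) / (2 * pi) \<le> M + C" using C(2)[of "(a, b)"] by linarith
    hence "ln (bracket (a, b)) \<le> 2 * pi * (M + C)" by (simp add: field_simps)
    hence "bracket (a, b) \<le> exp (2 * pi * (M + C))" using bracket_pos[of "(a, b)"] by (metis exp_le_cancel_iff exp_ln)
    thus "lattice_norm (a, b) \<le> exp (2 * pi * (M + C))" by (simp add: bracket_def)
  qed
  thus ?thesis using finite_lattice_ball finite_subset by blast
qed

text \<open>For \<open>2 |y| \<le> |x|\<close> the increment is \<open>O(|y| / |x|)\<close> by the asymptotics. Otherwise it is
  \<open>O(1 + ln (bracket y))\<close>, and the gap between the two exponents absorbs the logarithm. A single product bound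
  for both regimes means that no sum has to be split later.\<close>
lemma kernel_increment_bound:
  fixes \<theta> \<theta>' :: real
  assumes "0 < \<theta>" "\<theta> < \<theta>'" "\<theta>' \<le> 1"
  obtains C where "C > 0" "\<And>x y. \<bar>kernel (x - y) - kernel x\<bar> \<le> C * bracket y powr \<theta>' * bracket x powr (- \<theta>)"
proof -
  obtain C where C: "C > 0" "\<And>x. x \<noteq> 0 \<Longrightarrow> \<bar>kernel x - ln (lattice_norm x) / (2 * pi) - c_kernel\<bar> \<le> C / lattice_norm x"
    by (rule kernel_asymp) blast
  obtain D where D: "D > 0" "\<And>x. \<bar>kernel x - ln (bracket x) / (2 * pi)\<bar> \<le> D" by (rule kernel_log_bound) blast
  define e where "e = \<theta>' - \<theta>"
  have e: "e > 0" using assms by (simp add: e_def)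
  \<comment> \<open>K1 serves the region where y is small compared with x, K2 its complement.\<close>
  define K1 where "K1 = 2 * (2 / (2 * pi) + 3 * C)"
  define K2 where "K2 = (2 * D + ln 3 / (2 * pi) + ln 2 / (2 * pi) + 2 * (1 / e)) * 2 powr \<theta>"
  have K: "K1 > 0" "K2 \<ge> 0" using C D e by (auto simp: K1_def K2_def intro!: add_pos_pos add_nonneg_nonneg mult_nonneg_nonneg)
  have main: "\<bar>kernel (x - y) - kernel x\<bar> \<le> (K1 + K2) * (bracket y powr \<theta>' * bracket x powr (- \<theta>))" for x y
  proof (cases "2 * lattice_norm y \<le> lattice_norm x \<and> x \<noteq> 0")
    case True
    define r s t where "r = lattice_norm x" and "s = lattice_norm y" and "t = lattice_norm (x - y)"
    have r: "r \<ge> 1" using True lattice_norm_ge_1[of x] by (simp add: r_def)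
    have s: "0 \<le> s" "2 * s \<le> r" using True by (auto simp: r_def s_def)
    have t: "t \<le> r + s" "r \<le> t + s" using lattice_norm_diff[of x y] lattice_norm_triangle[of "x - y" y] by (auto simp: r_def s_def t_def)
    have t2: "t \<ge> r / 2" "t > 0" using t s r by auto
    have xy: "x - y \<noteq> 0" using t2 lattice_norm_0 by (metis t_def less_irrefl)
    have l: "\<bar>ln t - ln r\<bar> \<le> 2 * s / r"
    proof (cases "t \<ge> r")
      case True
      have "ln t - ln r = ln (t / r)" using r t2 by (simp add: ln_div)
      also have "\<dots> \<le> t / r - 1" using r t2 by (intro ln_le_minus_one) auto
      also have "\<dots> = (t - r) / r" using r by (simp add: diff_divide_distrib)
      also have "\<dots> \<le> s / r" using t r by (intro divide_right_mono) auto
      also have "\<dots> \<le> 2 * s / r" using s r by (intro divide_right_mono) auto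
      finally show ?thesis using True r t2 by simp
    next
      case False
      have "ln r - ln t = ln (r / t)" using r t2 by (simp add: ln_div)
      also have "\<dots> \<le> r / t - 1" using r t2 by (intro ln_le_minus_one) auto
      also have "\<dots> = (r - t) / t" using t2 by (simp add: field_simps)
      also have "\<dots> \<le> s / (r / 2)" using t s r t2 by (intro frac_le) auto
      finally show ?thesis using False r t2 by (simp add: mult.commute)
    qed
    have 1: "\<bar>kernel x - ln r / (2 * pi) - c_kernel\<bar> \<le> C / r" using C(2)[of x] True by (simp add: r_def)
    have 2: "\<bar>kernel (x - y) - ln t / (2 * pi) - c_kernel\<bar> \<le> C / t" using C(2)[OF xy] by (simp add: t_def)
    have "C / t \<le> C / (r / 2)" using C(1) r t2 by (intro divide_left_mono) auto
    hence 3: "C / t \<le> 2 * C / r" by (simp add: mult.commute)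
    have 4: "\<bar>ln t / (2 * pi) - ln r / (2 * pi)\<bar> \<le> 2 * s / r / (2 * pi)"
      using divide_right_mono[OF l, of "2 * pi"] by (simp only: diff_divide_distrib[symmetric] abs_divide) simp
    have "\<bar>kernel (x - y) - kernel x\<bar> \<le> 2 * s / r / (2 * pi) + 3 * C / r"
      using 1 2 3 4 add_divide_distrib[of C "2 * C" r] by (simp only: abs_le_iff) linarith
    also have "\<dots> = (2 * s / (2 * pi) + 3 * C) / r" by (simp add: add_divide_distrib)
    also have "\<dots> \<le> (2 * (1 + s) / (2 * pi) + 3 * C * (1 + s)) / r"
      using s C r by (intro divide_right_mono add_mono) auto
    also have "\<dots> = (2 / (2 * pi) + 3 * C) * (1 + s) / r" by (simp add: algebra_simps add_divide_distrib)
    also have "\<dots> \<le> (2 / (2 * pi) + 3 * C) * (1 + s) / ((1 + r) / 2)"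
      using r s C by (intro divide_left_mono mult_nonneg_nonneg) auto
    also have "\<dots> = K1 * (bracket y / bracket x)" by (simp add: K1_def bracket_def r_def s_def)
    also have "bracket y / bracket x \<le> (bracket y / bracket x) powr \<theta>'"
    proof -
      have "bracket y / bracket x \<le> 1" "bracket y / bracket x > 0" using s r bracket_pos[of x] bracket_pos[of y] by (auto simp: bracket_def r_def s_def)
      hence "(bracket y / bracket x) powr 1 \<le> (bracket y / bracket x) powr \<theta>'" using assms by (intro powr_mono') auto
      thus ?thesis using \<open>bracket y / bracket x > 0\<close> by (simp only: powr_one_gt_zero_iff[THEN iffD2])
    qed
    also have "(bracket y / bracket x) powr \<theta>' = bracket y powr \<theta>' * bracket x powr (- \<theta>')"
      using bracket_pos[of x] bracket_pos[of y] by (simp add: powr_divide powr_minus_divide)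
    also have "bracket x powr (- \<theta>') \<le> bracket x powr (- \<theta>)" using assms bracket_ge_1[of x] by (intro powr_mono) auto
    finally have "\<bar>kernel (x - y) - kernel x\<bar> \<le> K1 * (bracket y powr \<theta>' * bracket x powr (- \<theta>))" using K by (simp add: mult_left_mono)
    also have "\<dots> \<le> (K1 + K2) * (bracket y powr \<theta>' * bracket x powr (- \<theta>))" using K by (intro mult_right_mono) auto
    finally show ?thesis .
  next
    case False
    hence *: "lattice_norm x \<le> 2 * lattice_norm y" by (cases "x = 0") auto
    have x: "bracket x \<le> 2 * bracket y" using * by (simp add: bracket_def)
    have xy: "bracket (x - y) \<le> 3 * bracket y" using * lattice_norm_diff[of x y] by (simp add: bracket_def)
    have lx: "ln (bracket x) / (2 * pi) \<le> (ln 2 + ln (bracket y)) / (2 * pi)"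
      using x bracket_pos[of x] bracket_pos[of y] by (intro divide_right_mono) (auto simp flip: ln_mult_pos)
    have lxy: "ln (bracket (x - y)) / (2 * pi) \<le> (ln 3 + ln (bracket y)) / (2 * pi)"
      using xy bracket_pos[of "x - y"] bracket_pos[of y] by (intro divide_right_mono) (auto simp flip: ln_mult_pos)
    have y1: "bracket y powr e \<ge> 1" using bracket_ge_1[of y] e by (simp add: ge_one_powr_ge_zero)
    have "ln (bracket y) / (2 * pi) \<le> ln (bracket y) / 1" using bracket_ge_1[of y] pi_ge_two by (intro divide_left_mono) auto
    also have "\<dots> \<le> bracket y powr e / e" using ln_powr_bound[OF bracket_ge_1 e, of y] by simp
    finally have ly: "ln (bracket y) / (2 * pi) \<le> 1 / e * bracket y powr e" by simp
    have "\<bar>kernel (x - y) - kernel x\<bar> \<le> kernel (x - y) + kernel x" using kernel_nonneg[of x] kernel_nonneg[of "x - y"] by linarith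
    also have "\<dots> \<le> (2 * D + ln 3 / (2 * pi) + ln 2 / (2 * pi)) * 1 + 2 * (1 / e) * bracket y powr e"
    proof -
      define P L where "P = 1 / e * bracket y powr e" and "L = ln (bracket y) / (2 * pi)"
      have "kernel x \<le> D + ln 2 / (2 * pi) + L" "kernel (x - y) \<le> D + ln 3 / (2 * pi) + L"
        using D(2)[of x] D(2)[of "x - y"] lx lxy unfolding add_divide_distrib L_def by linarith+
      moreover have "L \<le> P" using ly by (simp only: P_def L_def)
      ultimately have "kernel (x - y) + kernel x \<le> 2 * D + ln 3 / (2 * pi) + ln 2 / (2 * pi) + 2 * P" by linarith
      thus ?thesis by (simp only: P_def mult_1_right mult.assoc)
    qed
    also have "\<dots> \<le> (2 * D + ln 3 / (2 * pi) + ln 2 / (2 * pi)) * bracket y powr e + 2 * (1 / e) * bracket y powr e"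
      using D y1 by (intro add_right_mono mult_left_mono add_nonneg_nonneg) auto
    also have "\<dots> = (2 * D + ln 3 / (2 * pi) + ln 2 / (2 * pi) + 2 * (1 / e)) * bracket y powr e" by (simp add: algebra_simps)
    also have "bracket y powr e = bracket y powr \<theta>' * bracket y powr (- \<theta>)" by (simp add: e_def flip: powr_add)
    also have "bracket y powr (- \<theta>) \<le> (bracket x / 2) powr (- \<theta>)"
      using x assms bracket_pos[of x] bracket_pos[of y] by (intro powr_mono2') auto
    also have "(bracket x / 2) powr (- \<theta>) = 2 powr \<theta> * bracket x powr (- \<theta>)"
      using bracket_pos[of x] by (simp add: powr_divide powr_minus_divide)
    finally have "\<bar>kernel (x - y) - kernel x\<bar> \<le> (2 * D + ln 3 / (2 * pi) + ln 2 / (2 * pi) + 2 * (1 / e)) * (bracket y powr \<theta>' * (2 powr \<theta> * bracket x powr (- \<theta>)))"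
      using D e by (simp add: mult_left_mono)
    also have "\<dots> = K2 * (bracket y powr \<theta>' * bracket x powr (- \<theta>))" by (simp add: K2_def)
    also have "\<dots> \<le> (K1 + K2) * (bracket y powr \<theta>' * bracket x powr (- \<theta>))" using K by (intro mult_right_mono) auto
    finally show ?thesis .
  qed
  show ?thesis
    by (rule that[of "K1 + K2"]) (use K main in \<open>auto simp: mult.assoc intro: add_pos_nonneg\<close>)
qed

text \<open>The bracket dominates \<open>1 + |a|\<close> and \<open>1 + |b|\<close>, so the sum is dominated by a product of two
  convergent one-dimensional series with exponent \<open>q / 2 > 1\<close>.\<close>
lemma bracket_powr_summable:
  assumes "q > 2"
  shows "(\<lambda>x. bracket x powr (- q)) summable_on UNIV"
proof -
  define s where "s = q / 2"
  have s: "s > 1" using assms by (simp add: s_def)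
  define h where "h = (\<lambda>n::int. (1 + \<bar>real_of_int n\<bar>) powr (- s))"
  have nat: "(\<lambda>n::nat. (1 + real n) powr (- s)) summable_on UNIV"
  proof -
    have "summable (\<lambda>n. real (Suc n) powr (- s))"
      using s summable_real_powr_iff[of "- s"] summable_Suc_iff[of "\<lambda>n. real n powr (- s)"] by simp
    thus ?thesis by (subst summable_on_UNIV_nonneg_real_iff) (auto simp: add.commute)
  qed
  have "h summable_on (range int \<union> range (\<lambda>n. - int n))"
  proof (intro summable_on_union)
    show "h summable_on range int" using nat
      by (subst summable_on_reindex) (auto simp: h_def o_def)
    show "h summable_on range (\<lambda>n. - int n)" using nat
      by (subst summable_on_reindex) (auto simp: h_def o_def inj_on_def)
  qed
  moreover have "range int \<union> range (\<lambda>n. - int n) = UNIV"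
  proof -
    have "n \<in> range int \<union> range (\<lambda>n. - int n)" for n by (cases n rule: int_cases2) auto
    thus ?thesis by blast
  qed
  ultimately have h: "h summable_on UNIV" by simp
  have hn: "h n \<ge> 0" for n by (simp add: h_def)
  have "(\<lambda>p. norm (case p of (a, b) \<Rightarrow> h a * h b)) summable_on UNIV \<times> UNIV"
    unfolding Infinite_Sum.abs_summable_on_Sigma_iff
  proof (intro conjI ballI)
    fix a :: int
    show "(\<lambda>b. norm (case (a, b) of (a, b) \<Rightarrow> h a * h b)) summable_on UNIV"
      using summable_on_cmult_right[OF h, of "h a"] hn by (simp add: abs_mult)
  next
    have "(\<Sum>\<^sub>\<infinity>b. norm (case (a, b) of (a, b) \<Rightarrow> h a * h b)) = h a * infsum h UNIV" for a
      using hn by (simp add: abs_mult infsum_cmult_right h)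
    thus "(\<lambda>a. norm (\<Sum>\<^sub>\<infinity>b. norm (case (a, b) of (a, b) \<Rightarrow> h a * h b))) summable_on UNIV"
      using summable_on_cmult_left[OF h, of "infsum h UNIV"] hn by (simp add: abs_mult infsum_nonneg)
  qed
  hence "(\<lambda>x. h (fst x) * h (snd x)) summable_on UNIV"
    using abs_summable_summable[of "\<lambda>p. case p of (a, b) \<Rightarrow> h a * h b" UNIV] by (simp add: case_prod_beta')
  thus ?thesis
  proof (rule summable_on_comparison_test)
    fix x :: "int \<times> int"
    have 1: "1 + \<bar>real_of_int (fst x)\<bar> \<le> bracket x" "1 + \<bar>real_of_int (snd x)\<bar> \<le> bracket x"
      using abs_le_lattice_norm[of x] by (simp_all add: bracket_def)
    have "bracket x powr (- q) = bracket x powr (- s) * bracket x powr (- s)" by (simp add: s_def flip: powr_add)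
    also have "\<dots> \<le> h (fst x) * h (snd x)"
    proof -
      have "bracket x powr (- s) \<le> h (fst x)" "bracket x powr (- s) \<le> h (snd x)"
        unfolding h_def using 1 s by (auto intro: powr_mono2')
      thus ?thesis using hn by (intro mult_mono) auto
    qed
    finally show "bracket x powr (- q) \<le> h (fst x) * h (snd x)" .
  qed auto
qed

section \<open>Maximum principles\<close>

lemma discrete_laplacian_linear:
  "discrete_laplacian (\<lambda>x. r * u x + s * v x + t) x = r * discrete_laplacian u x + s * discrete_laplacian v x"
  by (cases x) (simp only: discrete_laplacian_eq, simp add: algebra_simps)

lemma discrete_laplacian_max:
  assumes "\<And>y. g y \<le> g x"
  shows "discrete_laplacian g x \<le> 0"
  unfolding discrete_laplacian_def using assms by (intro sum_nonpos) auto

lemma discrete_laplacian_translate: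
  "discrete_laplacian (\<lambda>y. u (y + z)) x = discrete_laplacian u (x + z)"
  by (cases x; cases z) (simp only: discrete_laplacian_eq add_Pair, simp add: algebra_simps)

text \<open>A function that tends to \<open>- \<infinity>\<close> has a nonempty finite set of maximum points. Choosing the
  rightmost one gives a neighbour where the function is strictly smaller, which turns the weak
  inequality \<open>\<Delta> \<ge> 0\<close> into a contradiction.\<close>
lemma attains_rightmost_max:
  assumes "\<And>x. g x \<le> C - \<delta> * kernel x" "\<delta> > 0"
  obtains z where "\<And>y. g y \<le> g z" "\<And>y. g y = g z \<Longrightarrow> fst y \<le> fst z"
proof -
  define S where "S = {y. g 0 \<le> g y}"
  have "S \<subseteq> {y. kernel y \<le> (C - g 0) / \<delta>}"
  proof
    fix y assume "y \<in> S"
    hence "\<delta> * kernel y \<le> C - g 0" using assms(1)[of y] by (simp add: S_def)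
    thus "y \<in> {y. kernel y \<le> (C - g 0) / \<delta>}" using \<open>\<delta> > 0\<close> by (simp add: field_simps)
  qed
  hence fin: "finite S" using finite_kernel_sublevel finite_subset by blast
  have ne: "0 \<in> S" by (simp add: S_def)
  define M where "M = Max (g ` S)"
  define S' where "S' = {y \<in> S. g y = M}"
  have "M \<in> g ` S" unfolding M_def using fin ne by (intro Max_in) auto
  hence S': "finite S'" "S' \<noteq> {}" using fin by (auto simp: S'_def)
  have "Max (fst ` S') \<in> fst ` S'" using S' by (intro Max_in) auto
  then obtain z where z: "z \<in> S'" "fst z = Max (fst ` S')" by (metis imageE)
  have gz: "g z = M" "z \<in> S" using z by (auto simp: S'_def)
  have max: "g y \<le> g z" for y
  proof (cases "y \<in> S")
    case True
    thus ?thesis unfolding gz M_def using fin by (intro Max_ge) auto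
  next
    case False
    thus ?thesis using gz(2) by (simp add: S_def)
  qed
  show ?thesis
  proof (rule that[of z])
    fix y assume "g y = g z"
    hence "y \<in> S'" using gz by (auto simp: S'_def S_def)
    thus "fst y \<le> fst z" unfolding z(2) using S' by (intro Max_ge) auto
  qed (rule max)
qed

lemma le_of_le_eps:
  fixes a b c :: real
  assumes "\<And>e. e > 0 \<Longrightarrow> a \<le> b + e * c" "c \<ge> 0"
  shows "a \<le> b"
proof (rule field_le_epsilon)
  fix e :: real assume e: "e > 0"
  have "a \<le> b + e / (c + 1) * c" using e assms by (intro assms(1)) auto
  also have "e / (c + 1) * c \<le> e" using e assms(2) by (simp add: field_simps)
  finally show "a \<le> b + e" by simp
qed

text \<open>Subtracting \<open>e * kernel\<close> forces the maximum to be attained, and the rightmost maximum point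
  can only be the origin, the one place where the kernel is not harmonic. Then let \<open>e \<rightarrow> 0\<close>.\<close>
lemma bounded_subharmonic_le_0:
  assumes "\<And>x. discrete_laplacian h x \<ge> 0" "\<And>x. h x \<le> C"
  shows "h x \<le> h 0"
proof (rule le_of_le_eps[OF _ kernel_nonneg])
  fix e :: real assume e: "e > 0"
  define g where "g = (\<lambda>x. h x + (- e) * kernel x)"
  have "g x \<le> C - e * kernel x" for x using assms(2)[of x] by (simp add: g_def)
  then obtain z where z: "\<And>y. g y \<le> g z" "\<And>y. g y = g z \<Longrightarrow> fst y \<le> fst z"
    using attains_rightmost_max[of g C e] e by blast
  have L: "discrete_laplacian g z = discrete_laplacian h z - e * indicator {0} z"
    using discrete_laplacian_linear[of 1 h "- e" kernel 0 z] by (simp add: g_def kernel_laplacian)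
  have "z = 0"
  proof (rule ccontr)
    assume "z \<noteq> 0"
    hence "discrete_laplacian g z \<ge> 0" unfolding L using assms(1) by simp
    moreover obtain a b where ab: "z = (a, b)" by (cases z)
    have "g (a + 1, b) < g z" using z(1)[of "(a + 1, b)"] z(2)[of "(a + 1, b)"] ab by fastforce
    ultimately show False using z(1)[of "(a - 1, b)"] z(1)[of "(a, b + 1)"] z(1)[of "(a, b - 1)"]
      unfolding ab discrete_laplacian_eq by linarith
  qed
  thus "h x \<le> h 0 + e * kernel x" using z(1)[of x] by (simp add: g_def)
qed

lemma bounded_subharmonic_constant:
  assumes "\<And>x. discrete_laplacian h x \<ge> 0" "\<And>x. h x \<le> C"
  shows "h x = h y"
proof -
  have *: "h x \<le> h y" for x y
  proof -
    have "(\<lambda>z. h (z + y)) (x - y) \<le> (\<lambda>z. h (z + y)) 0"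
      by (rule bounded_subharmonic_le_0[where C = C]) (use assms in \<open>auto simp: discrete_laplacian_translate\<close>)
    thus ?thesis by simp
  qed
  show ?thesis using *[of x y] *[of y x] by simp
qed

text \<open>According to the sign of \<open>S\<close>, either \<open>h\<close> or \<open>- h\<close> is bounded and subharmonic. So no bounded
  function has a nonzero point mass as its Laplacian.\<close>
lemma bounded_laplacian_point_mass:
  assumes "\<And>x. discrete_laplacian h x = S * indicator {0} x" "\<And>x. \<bar>h x\<bar> \<le> C"
  shows "S = 0" "h x = h y"
proof -
  have const: "h x = h y" for x y
  proof (cases "S \<ge> 0")
    case True
    show ?thesis by (rule bounded_subharmonic_constant[where C = C]) (use assms True in \<open>auto simp: abs_le_iff\<close>)
  next
    case False
    have "discrete_laplacian (\<lambda>x. - h x) x = - discrete_laplacian h x" for x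
      using discrete_laplacian_linear[of "-1" h 0 h 0 x] by simp
    hence "(\<lambda>x. - h x) x = (\<lambda>x. - h x) y"
      by (intro bounded_subharmonic_constant[where C = C]) (use assms False in \<open>auto simp: abs_le_iff mult_nonpos_nonneg\<close>)
    thus ?thesis by simp
  qed
  show "h x = h y" by (rule const)
  have "discrete_laplacian h 0 = 0" unfolding discrete_laplacian_def by (intro sum.neutral) (use const in auto)
  thus "S = 0" using assms(1)[of 0] by simp
qed

text \<open>The set \<open>E\<close> is empty for comparison on the whole lattice, and a ball for comparison with
  barriers that are meaningful only near infinity. Growth of order \<open>o(kernel)\<close> is harmless because a
  small multiple of the kernel can be subtracted; its Laplacian only disturbs the inequality
  at the origin, and there by less than \<open>\<Delta> w 0\<close> if the multiple is small enough.\<close>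
lemma maximum_principle:
  assumes sub: "\<And>x. x \<notin> E \<Longrightarrow> w x > 0 \<Longrightarrow> discrete_laplacian w x > 0"
    and E: "\<And>x. x \<in> E \<Longrightarrow> w x \<le> 0"
    and growth: "\<And>e. e > 0 \<Longrightarrow> \<exists>C. \<forall>x. w x \<le> e * kernel x + C"
  shows "w x \<le> 0"
proof (rule ccontr)
  assume "\<not> w x \<le> 0"
  hence wx: "w x > 0" by simp
  have w0: "discrete_laplacian w 0 > 0" if "w 0 > 0" using sub[of 0] E[of 0] that by fastforce
  \<comment> \<open>Small enough to keep the penalised function positive at x and below the value of the Laplacian of w at the origin.\<close>
  define e where "e = min (w x / (2 * (kernel x + 1))) (if w 0 > 0 then discrete_laplacian w 0 / 2 else 1)"
  have e: "e > 0" using wx w0 kernel_nonneg[of x] by (auto simp: e_def)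
  define g where "g = (\<lambda>x. w x + (- e) * kernel x)"
  obtain C where C: "\<And>x. w x \<le> e / 2 * kernel x + C" using growth[of "e / 2"] e by auto
  have "g x \<le> C - e / 2 * kernel x" for x using C[of x] by (simp add: g_def)
  then obtain z where z: "\<And>y. g y \<le> g z"
    using attains_rightmost_max[of g C "e / 2"] e by (metis half_gt_zero)
  have "e * kernel x \<le> w x / (2 * (kernel x + 1)) * kernel x" using kernel_nonneg[of x] by (intro mult_right_mono) (auto simp: e_def)
  also have "\<dots> < w x" using kernel_nonneg[of x] wx by (simp add: field_simps) (intro add_nonneg_pos mult_nonneg_nonneg; simp)
  finally have "g x > 0" by (simp add: g_def)
  hence "g z > 0" using z[of x] by linarith
  moreover have "0 \<le> e * kernel z" using e kernel_nonneg[of z] by simp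
  ultimately have wz: "w z > 0" by (simp add: g_def)
  hence Lz: "discrete_laplacian w z > 0" using sub[of z] E[of z] by fastforce
  have "discrete_laplacian w z - e * indicator {0} z \<le> 0"
    using discrete_laplacian_max[of g z, OF z] discrete_laplacian_linear[of 1 w "- e" kernel 0 z] 
    by (simp add: g_def kernel_laplacian)
  moreover from this have "z = 0" using Lz by (cases "z = 0") auto
  moreover from wz \<open>z = 0\<close> have "w 0 > 0" by simp
  hence "e \<le> discrete_laplacian w 0 / 2" unfolding e_def by (simp only: if_True min.cobounded2)
  ultimately show False using Lz by simp
qed

section \<open>Convolution with the kernel\<close>

text \<open>Subtracting \<open>kernel x\<close> inside the sum removes the logarithmic growth that the total mass of
  \<open>f\<close> would cause, and \<open>w\<close> then decays at the rate at which increments of the kernel do. The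
  price is a multiple of the point mass in the Laplacian.\<close>
lemma kernel_convolution:
  assumes f: "\<And>y. \<bar>f y\<bar> \<le> K * bracket y powr (- q)" and q: "q > 2" and \<theta>: "0 < \<theta>" "\<theta> < 1" "\<theta> < q - 2"
  obtains w C where "f summable_on UNIV"
    "\<And>x. discrete_laplacian w x = f x - infsum f UNIV * indicator {0} x"
    "\<And>x. \<bar>w x\<bar> \<le> C * bracket x powr (- \<theta>)"
proof -
  have K: "K \<ge> 0"
    using f[of 0] by (simp add: bracket_def)
  have "(\<lambda>y. K * bracket y powr (- q)) summable_on UNIV"
    by (intro summable_on_cmult_right bracket_powr_summable q)
  note ks = this
  have fs: "f summable_on UNIV"
    by (rule abs_summable_summable[OF Infinite_Sum.abs_summable_on_comparison_test'[where g = "\<lambda>y. K * bracket y powr (- q)"]]) (use f ks in auto)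
  \<comment> \<open>Above the desired rate, yet small enough for the increment bound and for the weighted sum to converge.\<close>
  define \<theta>' where "\<theta>' = (\<theta> + min 1 (q - 2)) / 2"
  have \<theta>': "\<theta> < \<theta>'" "\<theta>' \<le> 1" "q - \<theta>' > 2" using \<theta> by (auto simp: \<theta>'_def min_def field_simps)
  obtain C where C: "C > 0" "\<And>x y. \<bar>kernel (x - y) - kernel x\<bar> \<le> C * bracket y powr \<theta>' * bracket x powr (- \<theta>)"
    using kernel_increment_bound[OF \<theta>(1) \<theta>'(1,2)] by blast
  define T where "T = (\<lambda>x y. (kernel (x - y) - kernel x) * f y)"
  have T: "\<bar>T x y\<bar> \<le> (C * K * bracket x powr (- \<theta>)) * bracket y powr (- (q - \<theta>'))" for x y
  proof -
    have "\<bar>T x y\<bar> \<le> (C * bracket y powr \<theta>' * bracket x powr (- \<theta>)) * (K * bracket y powr (- q))"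
      unfolding T_def abs_mult by (intro mult_mono C f) (use C in auto)
    also have "bracket y powr (- (q - \<theta>')) = bracket y powr \<theta>' * bracket y powr (- q)" by (simp flip: powr_add)
    hence "(C * bracket y powr \<theta>' * bracket x powr (- \<theta>)) * (K * bracket y powr (- q)) = (C * K * bracket x powr (- \<theta>)) * bracket y powr (- (q - \<theta>'))"
      by simp
    finally show ?thesis .
  qed
  have js: "(\<lambda>y. bracket y powr (- (q - \<theta>'))) summable_on UNIV" by (rule bracket_powr_summable[OF \<theta>'(3)])
  have Ta: "(\<lambda>y. norm (T x y)) summable_on UNIV" for x
    by (rule summable_on_comparison_test[OF summable_on_cmult_right[OF js, of "C * K * bracket x powr (- \<theta>)"]]) (use T in auto)
  define w where "w = (\<lambda>x. infsum (T x) UNIV)"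
  have Tw: "(T x has_sum w x) UNIV" for x
    unfolding w_def by (rule has_sum_infsum[OF abs_summable_summable[OF Ta]])
  have bound: "\<bar>w x\<bar> \<le> (C * K * infsum (\<lambda>y. bracket y powr (- (q - \<theta>'))) UNIV) * bracket x powr (- \<theta>)" for x
  proof -
    have "norm (w x) \<le> infsum (\<lambda>y. norm (T x y)) UNIV" unfolding w_def by (rule norm_infsum_bound[OF Ta])
    also have "\<dots> \<le> infsum (\<lambda>y. (C * K * bracket x powr (- \<theta>)) * bracket y powr (- (q - \<theta>'))) UNIV"
      by (intro infsum_mono Ta summable_on_cmult_right js) (use T in auto)
    also have "\<dots> = (C * K * bracket x powr (- \<theta>)) * infsum (\<lambda>y. bracket y powr (- (q - \<theta>'))) UNIV"
      by (rule infsum_cmult_right) (use js in auto)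
    finally show ?thesis by (simp add: mult_ac)
  qed
  have lap: "discrete_laplacian w x = f x - infsum f UNIV * indicator {0} x" for x
  proof -
    obtain a b where x: "x = (a, b)" by (cases x)
    have "((\<lambda>y. T (a + 1, b) y + T (a - 1, b) y + T (a, b + 1) y + T (a, b - 1) y + (- 4) * T (a, b) y) has_sum
       (w (a + 1, b) + w (a - 1, b) + w (a, b + 1) + w (a, b - 1) + (- 4) * w (a, b))) UNIV"
      by (intro has_sum_add has_sum_cmult_right Tw)
    moreover have "T (a + 1, b) y + T (a - 1, b) y + T (a, b + 1) y + T (a, b - 1) y + (- 4) * T (a, b) y
       = (if y \<in> {x} then f y else 0) + (- indicator {0} x) * f y" for y
    proof -
      have "discrete_laplacian (\<lambda>z. kernel (z + (- y))) x = indicator {0} (x - y)"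
        by (simp only: discrete_laplacian_translate kernel_laplacian) simp
      moreover have "T (a + 1, b) y + T (a - 1, b) y + T (a, b + 1) y + T (a, b - 1) y + (- 4) * T (a, b) y
         = (discrete_laplacian (\<lambda>z. kernel (z + (- y))) x - discrete_laplacian kernel x) * f y"
        unfolding x discrete_laplacian_eq T_def by (simp add: algebra_simps)
      ultimately show ?thesis by (auto simp: kernel_laplacian indicator_def algebra_simps)
    qed
    ultimately have 1: "((\<lambda>y. (if y \<in> {x} then f y else 0) + (- indicator {0} x) * f y) has_sum discrete_laplacian w x) UNIV"
      unfolding x discrete_laplacian_eq by simp
    have 2: "((\<lambda>y. if y \<in> {x} then f y else 0) has_sum f x) UNIV"
    proof -
      have "(f has_sum f x) {x}" using has_sum_finite[of "{x}" f] by simp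
      thus ?thesis by (subst has_sum_cong_neutral[where g = f and T = "{x}"]) auto
    qed
    have "((\<lambda>y. (if y \<in> {x} then f y else 0) + (- indicator {0} x) * f y) has_sum (f x + (- indicator {0} x) * infsum f UNIV)) UNIV"
      by (intro has_sum_add 2 has_sum_cmult_right has_sum_infsum fs)
    with 1 show ?thesis using has_sum_unique by fastforce
  qed
  show ?thesis by (rule that[OF fs lap bound])
qed

section \<open>Sub- and supersolutions\<close>

text \<open>Since \<open>F x\<close> increases, the equation at a single site can be solved for \<open>u x\<close> in terms of
  the sum over the neighbours, and the solution \<open>T x\<close> increases with that sum. Solutions are the
  fixed points of a monotone operator, and the supremum of all its post-fixed
  points between \<open>l\<close> and \<open>h\<close> is one, as in the Knaster-Tarski theorem.\<close>
lemma sub_super_solution: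
  fixes F :: "int \<times> int \<Rightarrow> real \<Rightarrow> real"
  assumes mono: "\<And>x s t. s \<le> t \<Longrightarrow> F x s \<le> F x t" and cont: "\<And>x. continuous_on UNIV (F x)"
    and sub: "\<And>x. F x (l x) \<le> discrete_laplacian l x" and sup: "\<And>x. discrete_laplacian h x \<le> F x (h x)"
    and lh: "\<And>x. l x \<le> h x"
  obtains u where "\<And>x. l x \<le> u x" "\<And>x. u x \<le> h x" "\<And>x. discrete_laplacian u x = F x (u x)"
proof -
  define N where "N = (\<lambda>u x. discrete_laplacian u x + 4 * u x)"
  have Nmono: "N u x \<le> N v x" if "\<And>y. u y \<le> v y" for u v x
    by (cases x) (simp add: N_def discrete_laplacian_eq add_mono that)
  have "\<exists>t. 4 * t + F x t = s" for x s
  proof -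
    \<comment> \<open>By monotonicity of F, the left-hand side is at most s at - M and at least s at M.\<close>
    define M where "M = \<bar>s - F x 0\<bar>"
    have M: "M \<ge> 0" "s - F x 0 \<le> M" "F x 0 - s \<le> M" by (auto simp: M_def)
    have "4 * (- M) + F x (- M) \<le> s" using mono[of "- M" 0 x] M by simp
    moreover have "s \<le> 4 * M + F x M" using mono[of 0 M x] M by simp
    moreover have "continuous_on {-M..M} (\<lambda>t. 4 * t + F x t)"
      by (intro continuous_intros continuous_on_subset[OF cont]) auto
    ultimately show ?thesis using IVT'[of "\<lambda>t. 4 * t + F x t" "- M" s M] by (auto simp: M_def)
  qed
  then obtain T where T: "\<And>x s. 4 * T x s + F x (T x s) = s" by metis
  have T_ge: "t \<le> T x s" if "4 * t + F x t \<le> s" for t x s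
    using that T[of x s] mono[of "T x s" t x] by (cases "t \<le> T x s") auto
  have T_le: "T x s \<le> t" if "s \<le> 4 * t + F x t" for t x s
    using that T[of x s] mono[of t "T x s" x] by (cases "T x s \<le> t") auto
  have Tmono: "T x s \<le> T x s'" if "s \<le> s'" for x s s'
    using that by (intro T_le) (simp add: T)
  define S where "S = {w. \<forall>x. l x \<le> w x \<and> w x \<le> h x \<and> w x \<le> T x (N w x)}"
  have lS: "l \<in> S" using lh sub by (auto simp: S_def N_def intro!: T_ge)
  define u where "u = (\<lambda>x. SUP w\<in>S. w x)"
  have bdd: "bdd_above ((\<lambda>w. w x) ` S)" for x by (intro bdd_aboveI[of _ "h x"]) (unfold S_def, blast)
  have upper: "w x \<le> u x" if "w \<in> S" for w x
    unfolding u_def using that bdd by (intro cSUP_upper) auto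
  have least: "u x \<le> c" if "\<And>w. w \<in> S \<Longrightarrow> w x \<le> c" for x c
    unfolding u_def using lS that by (intro cSUP_least) auto
  have uh: "u x \<le> h x" for x by (rule least) (unfold S_def, blast)
  have uT: "u x \<le> T x (N u x)" for x
  proof (rule least)
    fix w assume w: "w \<in> S"
    hence "w x \<le> T x (N w x)" unfolding S_def by blast
    also have "\<dots> \<le> T x (N u x)" by (intro Tmono Nmono upper w)
    finally show "w x \<le> T x (N u x)" .
  qed
  have "(\<lambda>x. T x (N u x)) \<in> S"
    unfolding S_def
  proof (safe)
    fix a b
    show "l (a, b) \<le> T (a, b) (N u (a, b))" using upper[OF lS] uT order_trans by blast
    have "T (a, b) (N u (a, b)) \<le> T (a, b) (N h (a, b))" by (intro Tmono Nmono uh)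
    also have "\<dots> \<le> h (a, b)" using sup by (intro T_le) (simp add: N_def add.commute)
    finally show "T (a, b) (N u (a, b)) \<le> h (a, b)" .
    show "T (a, b) (N u (a, b)) \<le> T (a, b) (N (\<lambda>x. T x (N u x)) (a, b))" by (intro Tmono Nmono uT)
  qed
  from upper[OF this] uT have "u x = T x (N u x)" for x by (intro antisym) auto
  hence "4 * u x + F x (u x) = N u x" for x using T[of x "N u x"] by simp
  hence "discrete_laplacian u x = F x (u x)" for x by (simp add: N_def add.commute)
  thus ?thesis by (rule that[OF upper[OF lS] uh])
qed

section \<open>Solutions above the critical parameter\<close>

lemma is_solution_iff:
  "is_solution \<kappa> \<beta> u \<longleftrightarrow> (\<forall>x. discrete_laplacian u x = exp (\<kappa> * u x) - \<beta> * indicator {0} x)"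
proof -
  have "(- L + e = b) = (L = e - b)" for L e b :: real by auto
  thus ?thesis by (simp only: is_solution_def)
qed

lemma is_solutionD:
  "is_solution \<kappa> \<beta> u \<Longrightarrow> discrete_laplacian u x = exp (\<kappa> * u x) - \<beta> * indicator {0} x"
  unfolding is_solution_iff by blast

lemma exp_kernel_decay:
  assumes "\<kappa> * \<alpha> > 0"
  obtains C where "C > 0" "\<And>x. exp (- (\<kappa> * \<alpha> * kernel x)) \<le> C * bracket x powr (- (\<kappa> * \<alpha> / (2 * pi)))"
proof -
  obtain C where C: "C > 0" "\<And>x. \<bar>kernel x - ln (bracket x) / (2 * pi)\<bar> \<le> C" by (rule kernel_log_bound) blast
  show ?thesis
  proof (rule that[of "exp (\<kappa> * \<alpha> * C)"])
    fix x
    have "ln (bracket x) / (2 * pi) - C \<le> kernel x" using C(2)[of x] by linarith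
    hence "\<kappa> * \<alpha> * (ln (bracket x) / (2 * pi) - C) \<le> \<kappa> * \<alpha> * kernel x" using assms by (intro mult_left_mono) auto
    hence "exp (- (\<kappa> * \<alpha> * kernel x)) \<le> exp (- (\<kappa> * \<alpha> * (ln (bracket x) / (2 * pi) - C)))" by simp
    also have "- (\<kappa> * \<alpha> * (ln (bracket x) / (2 * pi) - C)) = \<kappa> * \<alpha> * C + - (\<kappa> * \<alpha> / (2 * pi)) * ln (bracket x)"
      by (simp add: algebra_simps)
    also have "exp \<dots> = exp (\<kappa> * \<alpha> * C) * bracket x powr (- (\<kappa> * \<alpha> / (2 * pi)))"
      using bracket_pos[of x] by (simp only: exp_add powr_def) simp
    finally show "exp (- (\<kappa> * \<alpha> * kernel x)) \<le> exp (\<kappa> * \<alpha> * C) * bracket x powr (- (\<kappa> * \<alpha> / (2 * pi)))" .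
  qed auto
qed

text \<open>For \<open>\<kappa> > 0\<close> these clauses determine \<open>u\<close>, because the growth condition makes the comparison
  principle apply. The last clause carries the supersolution of the construction over to the bound
  on the constant in the expansion.\<close>
definition admissible :: "real \<Rightarrow> real \<Rightarrow> real \<Rightarrow> (int \<times> int \<Rightarrow> real) \<Rightarrow> bool" where
  "admissible \<kappa> \<beta> \<alpha> u \<longleftrightarrow> is_solution \<kappa> \<beta> u \<and> (\<exists>B. \<forall>x. \<bar>u x + \<alpha> * kernel x\<bar> \<le> B) \<and> (\<forall>x. u x \<le> ln (\<beta> - \<alpha>) / \<kappa> - \<alpha> * kernel x)"

lemma decay_exponent_gt_2:
  assumes "\<kappa> * \<alpha> > 4 * pi" shows "\<kappa> * \<alpha> / (2 * pi) > 2"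
  using assms by (simp add: field_simps)

text \<open>With \<open>V = exp (- \<kappa> \<alpha> kernel)\<close> of total mass \<open>S\<close> and \<open>m = (\<beta> - \<alpha>) / S\<close>, the function
  \<open>m * w\<close> satisfies \<open>\<Delta> (m * w) = m * V - (\<beta> - \<alpha>) \<delta>\<^sub>0\<close>. Lowering it by a constant \<open>D\<close> makes
  \<open>exp (\<kappa> (m * w - D)) \<le> m\<close>, which is the subsolution inequality.\<close>
lemma admissible_exists:
  assumes \<kappa>: "\<kappa> > 0" and \<alpha>: "\<kappa> * \<alpha> > 4 * pi" and \<beta>: "\<alpha> < \<beta>"
  shows "\<exists>u. admissible \<kappa> \<beta> \<alpha> u"
proof -
  define p where "p = \<kappa> * \<alpha> / (2 * pi)"
  have p: "p > 2" unfolding p_def by (rule decay_exponent_gt_2[OF \<alpha>])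
  have \<kappa>\<alpha>: "\<kappa> * \<alpha> > 0" using \<alpha> pi_gt_zero by linarith
  hence \<alpha>0: "\<alpha> > 0" using \<kappa> by (simp add: zero_less_mult_iff)
  define V where "V = (\<lambda>x. exp (- (\<kappa> * \<alpha> * kernel x)))"
  obtain C0 where C0: "C0 > 0" "\<And>x. exp (- (\<kappa> * \<alpha> * kernel x)) \<le> C0 * bracket x powr (- p)"
    using exp_kernel_decay[OF \<kappa>\<alpha>] unfolding p_def by blast
  define \<theta> where "\<theta> = min 1 (p - 2) / 2"
  have \<theta>: "0 < \<theta>" "\<theta> < 1" "\<theta> < p - 2" using p by (auto simp: \<theta>_def)
  obtain w C where w: "V summable_on UNIV" "\<And>x. discrete_laplacian w x = V x - infsum V UNIV * indicator {0} x"
    "\<And>x. \<bar>w x\<bar> \<le> C * bracket x powr (- \<theta>)"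
    by (rule kernel_convolution[of V C0 p \<theta>]) (use C0 p \<theta> in \<open>auto simp: V_def\<close>)
  have C: "C \<ge> 0" using w(3)[of 0] by (simp add: bracket_def)
  have wC: "\<bar>w x\<bar> \<le> C" for x
    using w(3)[of x] mult_left_mono[OF bracket_powr_le_1[of \<theta> x] C] \<theta> by simp
  define S where "S = infsum V UNIV"
  have "sum V {0} \<le> S" unfolding S_def using w(1) by (intro finite_sum_le_infsum) (auto simp: V_def)
  hence S: "S > 0" by (simp add: V_def)
  define m where "m = (\<beta> - \<alpha>) / S"
  have m: "m > 0" "m * S = \<beta> - \<alpha>" using S \<beta> by (auto simp: m_def)
  define H where "H = ln (\<beta> - \<alpha>) / \<kappa>"
  have H: "exp (\<kappa> * H) = \<beta> - \<alpha>" using \<kappa> \<beta> by (simp add: H_def)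
  define D where "D = m * C + \<bar>ln m\<bar> / \<kappa> + \<bar>H\<bar>"
  define l where "l = (\<lambda>x. m * w x + (- \<alpha>) * kernel x + (- D))"
  define h where "h = (\<lambda>x. 0 * w x + (- \<alpha>) * kernel x + H)"
  have mw: "m * w x \<le> m * C" for x using wC[of x] m by (intro mult_left_mono) auto
  have Dm: "exp (\<kappa> * (m * w x - D)) \<le> m" for x
  proof -
    have "m * w x - D \<le> - (\<bar>ln m\<bar> / \<kappa>)" using mw[of x] by (simp add: D_def)
    hence "\<kappa> * (m * w x - D) \<le> \<kappa> * - (\<bar>ln m\<bar> / \<kappa>)" using \<kappa> by (intro mult_left_mono) auto
    also have "\<dots> = - \<bar>ln m\<bar>" using \<kappa> by simp
    also have "\<dots> \<le> ln m" by linarith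
    finally show ?thesis using m by (metis exp_le_cancel_iff exp_ln)
  qed
  define F where "F = (\<lambda>x t. exp (\<kappa> * t) - \<beta> * indicator {0::int \<times> int} x)"
  obtain u where u: "\<And>x. l x \<le> u x" "\<And>x. u x \<le> h x" "\<And>x. discrete_laplacian u x = F x (u x)"
  proof (rule sub_super_solution[of F l h])
    show "F x s \<le> F x t" if "s \<le> t" for x s t using that \<kappa> by (simp add: F_def)
    show "continuous_on UNIV (F x)" for x unfolding F_def by (intro continuous_intros)
    show "F x (l x) \<le> discrete_laplacian l x" for x
    proof -
      have "exp (\<kappa> * l x) = exp (\<kappa> * (m * w x - D)) * V x" 
        by (simp add: l_def V_def algebra_simps flip: exp_add)
      also have "\<dots> \<le> m * V x" by (intro mult_right_mono Dm) (simp add: V_def)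
      finally have 1: "exp (\<kappa> * l x) \<le> m * V x" .
      have "discrete_laplacian l x = m * (V x - S * indicator {0} x) + (- \<alpha>) * indicator {0} x"
        unfolding l_def discrete_laplacian_linear w(2) kernel_laplacian S_def ..
      also have "\<dots> = m * V x - (m * S + \<alpha>) * indicator {0} x" by (simp add: algebra_simps)
      finally show ?thesis using 1 by (simp add: F_def m(2))
    qed
    show "discrete_laplacian h x \<le> F x (h x)" for x
    proof -
      have "discrete_laplacian h x = - \<alpha> * indicator {0} x"
        unfolding h_def discrete_laplacian_linear kernel_laplacian by simp
      thus ?thesis using H by (cases "x = 0") (simp_all add: F_def h_def)
    qed
    show "l x \<le> h x" for x
    proof -
      have "m * w x - D \<le> H" using mw[of x] \<kappa> by (simp add: D_def) (smt (verit) divide_nonneg_pos abs_ge_zero)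
      thus ?thesis by (simp add: l_def h_def)
    qed
  qed blast
  have "is_solution \<kappa> \<beta> u" using u(3) by (simp add: is_solution_iff F_def)
  moreover have "\<bar>u x + \<alpha> * kernel x\<bar> \<le> m * C + \<bar>D\<bar> + \<bar>H\<bar>" for x
  proof -
    have "- (m * w x) \<le> m * C" using mult_left_mono[of "- w x" C m] wC[of x] m by (simp add: abs_le_iff)
    moreover have "0 \<le> m * C" using m C by simp
    ultimately show ?thesis using u(1)[of x] u(2)[of x] by (simp add: l_def h_def abs_le_iff) linarith
  qed
  moreover have "u x \<le> ln (\<beta> - \<alpha>) / \<kappa> - \<alpha> * kernel x" for x using u(2)[of x] by (simp add: h_def H_def)
  ultimately show ?thesis unfolding admissible_def by blast
qed

lemma solution_comparison:
  assumes \<kappa>: "\<kappa> > 0" and u: "is_solution \<kappa> \<beta> u" and v: "is_solution \<kappa> \<beta> v"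
    and growth: "\<And>e. e > 0 \<Longrightarrow> \<exists>C. \<forall>x. u x - v x \<le> e * kernel x + C"
  shows "u x \<le> v x"
proof -
  have "(\<lambda>x. u x - v x) x \<le> 0"
  proof (rule maximum_principle[where E = "{}"])
    fix x assume "u x - v x > 0"
    hence "exp (\<kappa> * u x) > exp (\<kappa> * v x)" using \<kappa> by simp
    thus "discrete_laplacian (\<lambda>x. u x - v x) x > 0"
      using discrete_laplacian_linear[of 1 u "-1" v 0 x] is_solutionD[OF u, of x] is_solutionD[OF v, of x] by simp
  qed (use growth in auto)
  thus ?thesis by simp
qed

text \<open>With \<open>v = u + \<alpha> * kernel\<close> the density \<open>f = \<Delta> v\<close> decays like a power with exponent below
  \<open>- 2\<close>. The
  difference \<open>h\<close> of \<open>v\<close> and the convolution of the kernel with \<open>f\<close> is bounded and its Laplacian is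
  the total mass of \<open>f\<close> times \<open>\<delta>\<^sub>0\<close>. Hence the mass is \<open>0\<close> and \<open>h\<close> is constant, which are the two claims.\<close>
lemma admissible_decay:
  assumes \<kappa>: "\<kappa> > 0" and \<alpha>: "\<kappa> * \<alpha> > 4 * pi" and \<beta>: "\<alpha> < \<beta>" and u: "admissible \<kappa> \<beta> \<alpha> u"
    and \<theta>: "0 < \<theta>" "\<theta> < 1" "\<theta> < \<kappa> * \<alpha> / (2 * pi) - 2"
  shows "((\<lambda>x. exp (\<kappa> * u x)) has_sum (\<beta> - \<alpha>)) UNIV"
    and "\<exists>D C. D \<le> ln (\<beta> - \<alpha>) / \<kappa> \<and> (\<forall>x. \<bar>u x + \<alpha> * kernel x - D\<bar> \<le> C * bracket x powr (- \<theta>))"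
proof -
  define p where "p = \<kappa> * \<alpha> / (2 * pi)"
  have p: "p > 2" unfolding p_def by (rule decay_exponent_gt_2[OF \<alpha>])
  have \<kappa>\<alpha>: "\<kappa> * \<alpha> > 0" using \<alpha> pi_gt_zero by linarith
  obtain C0 where C0: "C0 > 0" "\<And>x. exp (- (\<kappa> * \<alpha> * kernel x)) \<le> C0 * bracket x powr (- p)"
    using exp_kernel_decay[OF \<kappa>\<alpha>] unfolding p_def by blast
  obtain B where B: "\<And>x. \<bar>u x + \<alpha> * kernel x\<bar> \<le> B" and sol: "is_solution \<kappa> \<beta> u" 
    and up: "\<And>x. u x \<le> ln (\<beta> - \<alpha>) / \<kappa> - \<alpha> * kernel x"
    using u unfolding admissible_def by blast
  define f where "f = (\<lambda>x. exp (\<kappa> * u x) - (\<beta> - \<alpha>) * indicator {0} x)"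
  have f: "\<bar>f x\<bar> \<le> (exp (\<kappa> * B) * C0 + (\<beta> - \<alpha>)) * bracket x powr (- p)" for x
  proof -
    have "u x \<le> B - \<alpha> * kernel x" using B[of x] by linarith
    hence "exp (\<kappa> * u x) \<le> exp (\<kappa> * (B - \<alpha> * kernel x))" using \<kappa> by simp
    also have "\<dots> = exp (\<kappa> * B) * exp (- (\<kappa> * \<alpha> * kernel x))" by (simp add: algebra_simps flip: exp_add)
    also have "\<dots> \<le> exp (\<kappa> * B) * (C0 * bracket x powr (- p))" by (intro mult_left_mono C0) auto
    finally have 1: "exp (\<kappa> * u x) \<le> exp (\<kappa> * B) * C0 * bracket x powr (- p)" by simp
    have 2: "(\<beta> - \<alpha>) * indicator {0} x \<le> (\<beta> - \<alpha>) * bracket x powr (- p)"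
      using \<beta> by (intro mult_left_mono) (auto simp: indicator_def bracket_def)
    have "\<bar>f x\<bar> \<le> exp (\<kappa> * u x) + (\<beta> - \<alpha>) * indicator {0} x"
      using \<beta> abs_triangle_ineq4[of "exp (\<kappa> * u x)" "(\<beta> - \<alpha>) * indicator {0} x"] 
      by (simp add: f_def abs_mult)
    thus ?thesis using 1 2 by (simp add: distrib_right)
  qed
  obtain w C where w: "f summable_on UNIV" "\<And>x. discrete_laplacian w x = f x - infsum f UNIV * indicator {0} x"
    "\<And>x. \<bar>w x\<bar> \<le> C * bracket x powr (- \<theta>)"
    by (rule kernel_convolution[OF f p \<theta>(1,2) \<theta>(3)[folded p_def]]) blast
  have C: "C \<ge> 0" using w(3)[of 0] by (simp add: bracket_def)
  have wC: "\<bar>w x\<bar> \<le> C" for x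
    using w(3)[of x] mult_left_mono[OF bracket_powr_le_1[of \<theta> x] C] \<theta> by simp
  define v where "v = (\<lambda>x. 1 * u x + \<alpha> * kernel x + 0)"
  define h where "h = (\<lambda>x. 1 * v x + (-1) * w x + 0)"
  have "discrete_laplacian v x = f x" for x
    unfolding v_def discrete_laplacian_linear kernel_laplacian
    using is_solutionD[OF sol, of x] by (simp add: f_def algebra_simps)
  hence hL: "discrete_laplacian h x = infsum f UNIV * indicator {0} x" for x
    unfolding h_def discrete_laplacian_linear w(2) by simp
  have hB: "\<bar>h x\<bar> \<le> B + C" for x
    using B[of x] wC[of x] by (simp add: h_def v_def abs_le_iff)
  have S: "infsum f UNIV = 0" and hc: "\<And>x. h x = h 0"
    using bounded_laplacian_point_mass[OF hL hB] by blast+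
  have fs: "(f has_sum 0) UNIV" using has_sum_infsum[OF w(1)] S by simp
  have "((\<lambda>x. if x \<in> {0} then (\<beta> - \<alpha>) else 0) has_sum (\<beta> - \<alpha>)) (UNIV :: (int \<times> int) set)"
    using has_sum_finite[of "{0::int \<times> int}" "\<lambda>_. \<beta> - \<alpha>"]
    by (subst has_sum_cong_neutral[where g = "\<lambda>_. \<beta> - \<alpha>" and T = "{0}"]) auto
  note sum = has_sum_add[OF fs this]
  have "(\<lambda>x. f x + (if x \<in> {0} then \<beta> - \<alpha> else 0)) = (\<lambda>x. exp (\<kappa> * u x))" by (auto simp: f_def)
  with sum show "((\<lambda>x. exp (\<kappa> * u x)) has_sum (\<beta> - \<alpha>)) UNIV" by simp
  have vw: "v x = h 0 + w x" for x using hc[of x] by (simp add: h_def)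
  \<comment> \<open>The constant is the limit of v along a ray, and v lies below the supersolution.\<close>
  have "h 0 \<le> ln (\<beta> - \<alpha>) / \<kappa>"
  proof (rule le_of_le_eps[where c = C])
    fix e :: real assume e: "e > 0"
    define X where "X = e powr (- 1 / \<theta>)"
    define n where "n = \<lceil>X\<rceil>"
    have "X > 0" using e by (simp add: X_def)
    have "X \<le> of_int n" by (simp add: n_def)
    also have "\<dots> \<le> lattice_norm (n, 0)" using abs_le_lattice_norm(1)[of "(n, 0)"] by simp
    also have "\<dots> \<le> bracket (n, 0)" by (simp add: bracket_def)
    finally have "bracket (n, 0) powr (- \<theta>) \<le> X powr (- \<theta>)" using \<open>X > 0\<close> \<theta> by (intro powr_mono2') auto
    also have "\<dots> = e" using e \<theta> by (simp add: X_def powr_powr)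
    finally have "C * bracket (n, 0) powr (- \<theta>) \<le> C * e" using C by (intro mult_left_mono)
    moreover have "v (n, 0) \<le> ln (\<beta> - \<alpha>) / \<kappa>" using up[of "(n, 0)"] by (simp add: v_def)
    ultimately show "h 0 \<le> ln (\<beta> - \<alpha>) / \<kappa> + e * C" using vw[of "(n, 0)"] w(3)[of "(n, 0)"]
      by (simp add: mult.commute[of e] abs_le_iff)
  qed (rule C)
  moreover have "\<bar>u x + \<alpha> * kernel x - h 0\<bar> \<le> C * bracket x powr (- \<theta>)" for x
    using vw[of x] w(3)[of x] by (simp add: v_def)
  ultimately show "\<exists>D C. D \<le> ln (\<beta> - \<alpha>) / \<kappa> \<and> (\<forall>x. \<bar>u x + \<alpha> * kernel x - D\<bar> \<le> C * bracket x powr (- \<theta>))"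
    by blast
qed

lemma admissible_mass:
  assumes \<kappa>: "\<kappa> > 0" and \<alpha>: "\<kappa> * \<alpha> > 4 * pi" and \<beta>: "\<alpha> < \<beta>" and u: "admissible \<kappa> \<beta> \<alpha> u"
  shows "((\<lambda>x. exp (\<kappa> * u x)) has_sum (\<beta> - \<alpha>)) UNIV"
proof -
  define p where "p = \<kappa> * \<alpha> / (2 * pi)"
  have p: "p > 2" unfolding p_def by (rule decay_exponent_gt_2[OF \<alpha>])
  show ?thesis
    by (rule admissible_decay(1)[OF assms, of "min 1 (p - 2) / 2", folded p_def]) (use p in auto)
qed

lemma admissible_mono:
  assumes \<kappa>: "\<kappa> > 0" and le: "\<alpha>1 \<le> \<alpha>2" and u1: "admissible \<kappa> \<beta> \<alpha>1 u1" and u2: "admissible \<kappa> \<beta> \<alpha>2 u2"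
  shows "u2 x \<le> u1 x"
proof (rule solution_comparison[OF \<kappa>])
  fix e :: real assume e: "e > 0"
  obtain B1 B2 where B: "\<And>x. \<bar>u1 x + \<alpha>1 * kernel x\<bar> \<le> B1" "\<And>x. \<bar>u2 x + \<alpha>2 * kernel x\<bar> \<le> B2"
    using u1 u2 unfolding admissible_def by blast
  have "u2 x - u1 x \<le> e * kernel x + (B1 + B2)" for x
  proof -
    have "\<alpha>1 * kernel x \<le> \<alpha>2 * kernel x" "0 \<le> e * kernel x" using le e kernel_nonneg[of x] by (auto intro: mult_right_mono)
    thus ?thesis using B(1)[of x] B(2)[of x] by linarith
  qed
  thus "\<exists>C. \<forall>x. u2 x - u1 x \<le> e * kernel x + C" by blast
qed (use u1 u2 in \<open>auto simp: admissible_def\<close>)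

section \<open>Dependence on the parameter\<close>

text \<open>At a contact point the two Laplacians agree, so the four nonnegative differences at the
  neighbours add up to zero.\<close>
lemma touching_solutions_propagate:
  assumes u: "is_solution \<kappa> \<beta> u" and v: "is_solution \<kappa> \<beta> v" and le: "\<And>x. v x \<le> u x" and eq: "u x = v x"
  shows "u (x + (1, 0)) = v (x + (1, 0))"
proof -
  obtain a b where ab: "x = (a, b)" by (cases x)
  have "discrete_laplacian u x = discrete_laplacian v x" 
    by (simp only: is_solutionD[OF u] is_solutionD[OF v] eq)
  thus ?thesis using le[of "(a + 1, b)"] le[of "(a - 1, b)"] le[of "(a, b + 1)"] le[of "(a, b - 1)"] eq
    unfolding ab discrete_laplacian_eq by simp
qed

text \<open>If two ordered solutions touched at one point, they would agree on a whole horizontal ray,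
  along which their difference \<open>(\<alpha>2 - \<alpha>1) * kernel + O(1)\<close> is unbounded.\<close>
lemma admissible_strict_mono:
  assumes \<kappa>: "\<kappa> > 0" and less: "\<alpha>1 < \<alpha>2" and u1: "admissible \<kappa> \<beta> \<alpha>1 u1" and u2: "admissible \<kappa> \<beta> \<alpha>2 u2"
  shows "u2 x < u1 x"
proof (rule ccontr)
  have le: "u2 y \<le> u1 y" for y using less by (intro admissible_mono[OF \<kappa> _ u1 u2]) auto
  assume "\<not> u2 x < u1 x"
  hence eq: "u1 x = u2 x" using le[of x] by simp
  have ray: "u1 (x + (int n, 0)) = u2 (x + (int n, 0))" for n
  proof (induction n)
    case 0
    thus ?case using eq by (simp flip: zero_prod_def)
  next
    case (Suc n)
    have "u1 (x + (int n, 0) + (1, 0)) = u2 (x + (int n, 0) + (1, 0))"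
      using u1 u2 le Suc unfolding admissible_def
      by (intro touching_solutions_propagate[where u = u1 and v = u2 and \<kappa> = \<kappa> and \<beta> = \<beta>]) blast+
    moreover have "x + (int n, 0) + (1, 0) = x + (int (Suc n), 0)" by (cases x) simp
    ultimately show ?case by simp
  qed
  obtain B1 B2 where B: "\<And>x. \<bar>u1 x + \<alpha>1 * kernel x\<bar> \<le> B1" "\<And>x. \<bar>u2 x + \<alpha>2 * kernel x\<bar> \<le> B2"
    using u1 u2 unfolding admissible_def by blast
  have "range (\<lambda>n. x + (int n, 0)) \<subseteq> {y. kernel y \<le> (B1 + B2) / (\<alpha>2 - \<alpha>1)}"
  proof (rule image_subsetI)
    fix n
    let ?y = "x + (int n, 0)"
    have "(\<alpha>2 - \<alpha>1) * kernel ?y \<le> B1 + B2" using B(1)[of ?y] B(2)[of ?y] ray[of n] by (simp add: algebra_simps abs_le_iff)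
    thus "?y \<in> {y. kernel y \<le> (B1 + B2) / (\<alpha>2 - \<alpha>1)}" using less by (simp add: field_simps)
  qed
  hence "finite (range (\<lambda>n. x + (int n, 0)))" using finite_kernel_sublevel finite_subset by blast
  moreover have "inj (\<lambda>n. x + (int n, 0))" by (auto simp: inj_def)
  ultimately show False using finite_imageD by blast
qed

lemma solution_limit:
  assumes F: "F \<noteq> bot" and lim: "\<And>x. ((\<lambda>\<alpha>. U \<alpha> x) \<longlongrightarrow> v x) F" and sol: "\<forall>\<^sub>F \<alpha> in F. is_solution \<kappa> \<beta> (U \<alpha>)"
  shows "is_solution \<kappa> \<beta> v"
  unfolding is_solution_iff
proof
  fix x
  have "((\<lambda>\<alpha>. discrete_laplacian (U \<alpha>) x) \<longlongrightarrow> discrete_laplacian v x) F"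
    by (cases x) (simp only: discrete_laplacian_eq, intro tendsto_intros lim)
  moreover have "((\<lambda>\<alpha>. exp (\<kappa> * U \<alpha> x) - \<beta> * indicator {0} x) \<longlongrightarrow> exp (\<kappa> * v x) - \<beta> * indicator {0} x) F"
    by (intro tendsto_intros lim)
  hence "((\<lambda>\<alpha>. discrete_laplacian (U \<alpha>) x) \<longlongrightarrow> exp (\<kappa> * v x) - \<beta> * indicator {0} x) F"
    by (rule Lim_transform_eventually) (use sol in \<open>auto elim!: eventually_mono simp: is_solutionD\<close>)
  ultimately show "discrete_laplacian v x = exp (\<kappa> * v x) - \<beta> * indicator {0} x"
    using F tendsto_unique by blast
qed

lemma tendsto_at_right_SUP:
  fixes g :: "real \<Rightarrow> real"
  assumes ab: "a < b" and mono: "\<And>s t. \<lbrakk>a < s; s \<le> t; t < b\<rbrakk> \<Longrightarrow> g t \<le> g s" and bound: "\<And>t. \<lbrakk>a < t; t < b\<rbrakk> \<Longrightarrow> g t \<le> M"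
  shows "(g \<longlongrightarrow> (SUP t\<in>{a<..<b}. g t)) (at_right a)"
proof (rule order_tendstoI)
  have bdd: "bdd_above (g ` {a<..<b})" using bound by (intro bdd_aboveI[of _ M]) auto
  have ne: "{a<..<b} \<noteq> {}" using ab by simp
  {
    fix c assume "c < (SUP t\<in>{a<..<b}. g t)"
    then obtain s where s: "s \<in> {a<..<b}" "c < g s" using less_cSUP_iff[OF ne bdd] by blast
    have "\<forall>\<^sub>F t in at_right a. t \<in> {a<..<s}" using s by (intro eventually_at_right_real) auto
    thus "\<forall>\<^sub>F t in at_right a. c < g t"
    proof eventually_elim
      case (elim t)
      have "g s \<le> g t" using elim s by (intro mono) auto
      thus ?case using s by simp
    qed
  next
    fix c assume c: "(SUP t\<in>{a<..<b}. g t) < c"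
    have "\<forall>\<^sub>F t in at_right a. t \<in> {a<..<b}" using ab by (rule eventually_at_right_real)
    thus "\<forall>\<^sub>F t in at_right a. g t < c"
    proof eventually_elim
      case (elim t)
      from cSUP_upper[OF this bdd] c show ?case by simp
    qed
  }
qed

lemma tendsto_at_left_INF:
  fixes g :: "real \<Rightarrow> real"
  assumes ab: "a < b" and mono: "\<And>s t. \<lbrakk>a < s; s \<le> t; t < b\<rbrakk> \<Longrightarrow> g t \<le> g s" and bound: "\<And>t. \<lbrakk>a < t; t < b\<rbrakk> \<Longrightarrow> M \<le> g t"
  shows "(g \<longlongrightarrow> (INF t\<in>{a<..<b}. g t)) (at_left b)"
proof (rule order_tendstoI)
  have bdd: "bdd_below (g ` {a<..<b})" using bound by (intro bdd_belowI[of _ M]) auto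
  have ne: "{a<..<b} \<noteq> {}" using ab by simp
  {
    fix c assume "(INF t\<in>{a<..<b}. g t) < c"
    then obtain s where s: "s \<in> {a<..<b}" "g s < c" using cINF_less_iff[OF ne bdd] by blast
    have "\<forall>\<^sub>F t in at_left b. t \<in> {s<..<b}" using s by (intro eventually_at_left_real) auto
    thus "\<forall>\<^sub>F t in at_left b. g t < c"
    proof eventually_elim
      case (elim t)
      have "g t \<le> g s" using elim s by (intro mono) auto
      thus ?case using s by simp
    qed
  next
    fix c assume c: "c < (INF t\<in>{a<..<b}. g t)"
    have "\<forall>\<^sub>F t in at_left b. t \<in> {a<..<b}" using ab by (rule eventually_at_left_real)
    thus "\<forall>\<^sub>F t in at_left b. c < g t"
    proof eventually_elim
      case (elim t)
      from cINF_lower[OF bdd this] c show ?case by simp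
    qed
  }
qed

lemma admissible_difference:
  assumes "admissible \<kappa> \<beta> \<alpha>1 u1" "admissible \<kappa> \<beta> \<alpha>2 u2" "\<alpha>2 - \<alpha>1 \<le> e"
  shows "\<exists>C. \<forall>x. u1 x - u2 x \<le> e * kernel x + C"
proof -
  obtain B1 B2 where B: "\<And>x. \<bar>u1 x + \<alpha>1 * kernel x\<bar> \<le> B1" "\<And>x. \<bar>u2 x + \<alpha>2 * kernel x\<bar> \<le> B2"
    using assms unfolding admissible_def by blast
  have "u1 x - u2 x \<le> e * kernel x + (B1 + B2)" for x
  proof -
    have "(\<alpha>2 - \<alpha>1) * kernel x \<le> e * kernel x" using assms(3) kernel_nonneg[of x] by (intro mult_right_mono)
    thus ?thesis using B(1)[of x] B(2)[of x] by (simp add: left_diff_distrib abs_le_iff)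
  qed
  thus ?thesis by blast
qed

text \<open>Both one-sided limits exist by monotonicity and solve the equation. Each differs from
  \<open>U c\<close> by at most \<open>e * kernel + O(1)\<close> for every \<open>e > 0\<close>, as parameters within \<open>e\<close> of \<open>c\<close>
  show, and the comparison principle then makes it equal to \<open>U c\<close>.\<close>
lemma admissible_continuous:
  assumes \<kappa>: "\<kappa> > 0" and U: "\<And>\<alpha>. \<lbrakk>a < \<alpha>; \<alpha> < \<beta>\<rbrakk> \<Longrightarrow> admissible \<kappa> \<beta> \<alpha> (U \<alpha>)" and c: "a < c" "c < \<beta>"
  shows "((\<lambda>\<alpha>. U \<alpha> x) \<longlongrightarrow> U c x) (at c)"
  unfolding filterlim_at_split
proof
  have mono: "U t x \<le> U s x" if "a < s" "s \<le> t" "t < \<beta>" for s t x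
    using that by (intro admissible_mono[OF \<kappa> that(2), of \<beta>] U) auto
  have solc: "is_solution \<kappa> \<beta> (U c)" using U[OF c] by (simp add: admissible_def)
  show "((\<lambda>\<alpha>. U \<alpha> x) \<longlongrightarrow> U c x) (at_left c)"
  proof -
    define v where "v = (\<lambda>x. INF t\<in>{a<..<c}. U t x)"
    have lim: "((\<lambda>\<alpha>. U \<alpha> x) \<longlongrightarrow> v x) (at_left c)" for x
      unfolding v_def by (rule tendsto_at_left_INF[where M = "U c x"]) (use c in \<open>auto intro!: mono\<close>)
    have bdd: "bdd_below ((\<lambda>t. U t x) ` {a<..<c})" for x
      using c by (intro bdd_belowI[of _ "U c x"]) (auto intro!: mono)
    have "is_solution \<kappa> \<beta> v"
    proof (rule solution_limit[OF _ lim])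
      show "\<forall>\<^sub>F \<alpha> in at_left c. is_solution \<kappa> \<beta> (U \<alpha>)"
        using eventually_at_left_real[OF c(1)] by eventually_elim (use U c in \<open>auto simp: admissible_def\<close>)
    qed auto
    hence "v x \<le> U c x" for x
    proof (rule solution_comparison[OF \<kappa> _ solc])
      fix e :: real assume e: "e > 0"
      define \<alpha> where "\<alpha> = max ((a + c) / 2) (c - e)"
      have \<alpha>: "a < \<alpha>" "\<alpha> < c" "c - \<alpha> \<le> e" using c e by (auto simp: \<alpha>_def max_def field_simps)
      have "v x \<le> U \<alpha> x" for x unfolding v_def using \<alpha> bdd by (intro cINF_lower) auto
      moreover have "\<exists>C. \<forall>x. U \<alpha> x - U c x \<le> e * kernel x + C"
        using \<alpha> c by (intro admissible_difference[OF U U \<alpha>(3)]) auto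
      ultimately show "\<exists>C. \<forall>x. v x - U c x \<le> e * kernel x + C" by (meson diff_right_mono order_trans)
    qed
    moreover have "U c x \<le> v x" for x
      unfolding v_def using c by (intro cINF_greatest) (auto intro!: mono)
    ultimately have "v x = U c x" by (intro antisym)
    thus ?thesis using lim[of x] by simp
  qed
  show "((\<lambda>\<alpha>. U \<alpha> x) \<longlongrightarrow> U c x) (at_right c)"
  proof -
    define v where "v = (\<lambda>x. SUP t\<in>{c<..<\<beta>}. U t x)"
    have lim: "((\<lambda>\<alpha>. U \<alpha> x) \<longlongrightarrow> v x) (at_right c)" for x
      unfolding v_def by (rule tendsto_at_right_SUP[where M = "U c x"]) (use c in \<open>auto intro!: mono\<close>)
    have bdd: "bdd_above ((\<lambda>t. U t x) ` {c<..<\<beta>})" for x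
      using c by (intro bdd_aboveI[of _ "U c x"]) (auto intro!: mono)
    have "is_solution \<kappa> \<beta> v"
    proof (rule solution_limit[OF _ lim])
      show "\<forall>\<^sub>F \<alpha> in at_right c. is_solution \<kappa> \<beta> (U \<alpha>)"
        using eventually_at_right_real[OF c(2)] by eventually_elim (use U c in \<open>auto simp: admissible_def\<close>)
    qed auto
    hence "U c x \<le> v x" for x
    proof (rule solution_comparison[OF \<kappa> solc])
      fix e :: real assume e: "e > 0"
      define \<alpha> where "\<alpha> = min ((c + \<beta>) / 2) (c + e)"
      have \<alpha>: "c < \<alpha>" "\<alpha> < \<beta>" "\<alpha> - c \<le> e" using c e by (auto simp: \<alpha>_def min_def field_simps)
      have "U \<alpha> x \<le> v x" for x unfolding v_def using \<alpha> bdd by (intro cSUP_upper) auto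
      moreover have "\<exists>C. \<forall>x. U c x - U \<alpha> x \<le> e * kernel x + C"
        using \<alpha> c by (intro admissible_difference[OF U U \<alpha>(3)]) auto
      ultimately show "\<exists>C. \<forall>x. U c x - v x \<le> e * kernel x + C" by (meson diff_left_mono order_trans)
    qed
    moreover have "v x \<le> U c x" for x
      unfolding v_def using c by (intro cSUP_least) (auto intro!: mono)
    ultimately have "v x = U c x" by (intro antisym)
    thus ?thesis using lim[of x] by simp
  qed
qed

section \<open>Logarithmic barriers for the critical solution\<close>

text \<open>In terms of \<open>s = |x|\<^sup>2\<close>, the expected profile \<open>2 ln |x| + 2 ln (ln |x|)\<close> is \<open>log_profile s\<close> up to an
  additive constant.\<close>
definition log_profile :: "real \<Rightarrow> real" where "log_profile t = ln t + 2 * ln (ln t)"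
text \<open>The first three derivatives of the profile, written as polynomials in \<open>inverse t\<close> and
  \<open>inverse (ln t)\<close>.\<close>
definition log_profile1 :: "real \<Rightarrow> real" where "log_profile1 t = inverse t + 2 * (inverse t * inverse (ln t))"
definition log_profile2 :: "real \<Rightarrow> real" where 
  "log_profile2 t = - ((inverse t)^2 + 2 * (inverse t)^2 * inverse (ln t) + 2 * (inverse t)^2 * (inverse (ln t))^2)"
definition log_profile3 :: "real \<Rightarrow> real" where 
  "log_profile3 t = 2 * (inverse t)^3 + 4 * (inverse t)^3 * inverse (ln t) + 6 * (inverse t)^3 * (inverse (ln t))^2 + 4 * (inverse t)^3 * (inverse (ln t))^3"

lemma log_profile_derivs:
  assumes "t > 1"
  shows "(log_profile has_real_derivative log_profile1 t) (at t)" "(log_profile1 has_real_derivative log_profile2 t) (at t)" "(log_profile2 has_real_derivative log_profile3 t) (at t)"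
proof -
  have l: "ln t > 0" "t > 0" "t \<noteq> 0" "ln t \<noteq> 0" using assms by auto
  have d0: "(ln has_real_derivative inverse t) (at t)" using l by (intro DERIV_ln)
  have di: "(inverse has_real_derivative (- ((inverse t)^2))) (at t)"
    using DERIV_inverse[OF l(3)] by (simp add: numeral_2_eq_2)
  have dj: "((\<lambda>t. inverse (ln t)) has_real_derivative (- ((inverse (ln t))^2)) * inverse t) (at t)"
    using DERIV_chain2[OF DERIV_inverse[OF l(4)] d0] by (simp add: numeral_2_eq_2)
  have dl: "((\<lambda>t. ln (ln t)) has_real_derivative inverse (ln t) * inverse t) (at t)"
    using DERIV_chain2[OF DERIV_ln[OF l(1)] d0] .
  define i j where "i = inverse t" and "j = inverse (ln t)"
  note fold = i_def[symmetric] j_def[symmetric]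
  show "(log_profile has_real_derivative log_profile1 t) (at t)"
    unfolding log_profile_def[abs_def] log_profile1_def
    by (rule DERIV_cong[OF DERIV_add[OF d0 DERIV_cmult[OF dl]]]) simp
  show "(log_profile1 has_real_derivative log_profile2 t) (at t)"
    unfolding log_profile1_def[abs_def] log_profile2_def
    by (rule DERIV_cong[OF DERIV_add[OF di DERIV_cmult[OF DERIV_mult[OF di dj]]]])
      (unfold fold, simp add: algebra_simps power2_eq_square)
  have di2: "((\<lambda>t. (inverse t)^2) has_real_derivative - 2 * (inverse t)^3) (at t)"
    by (rule DERIV_cong[OF DERIV_power[OF di]]) (unfold fold, simp add: power2_eq_square power3_eq_cube)
  have dj2: "((\<lambda>t. (inverse (ln t))^2) has_real_derivative - 2 * (inverse (ln t))^3 * inverse t) (at t)"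
    by (rule DERIV_cong[OF DERIV_power[OF dj]]) (unfold fold, simp add: power2_eq_square power3_eq_cube)
  show "(log_profile2 has_real_derivative log_profile3 t) (at t)"
    unfolding log_profile2_def[abs_def] log_profile3_def
    by (rule DERIV_cong[OF DERIV_minus[OF DERIV_add[OF DERIV_add[OF di2 DERIV_mult[OF DERIV_cmult[OF di2] dj]] DERIV_mult[OF DERIV_cmult[OF di2] dj2]]]])
      (unfold fold, simp add: algebra_simps power2_eq_square power3_eq_cube)
qed

text \<open>The third derivative is at most \<open>16 / t\<^sup>3\<close> where \<open>ln t \<ge> 1\<close>, hence at most \<open>128 / s\<^sup>3\<close> between
  \<open>s\<close> and \<open>s + h\<close>, and \<open>128 / 6 < 22\<close>.\<close>
lemma log_profile_taylor:
  assumes s: "s \<ge> 6" and h: "\<bar>h\<bar> \<le> s / 2"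
  shows "\<bar>log_profile (s + h) - log_profile s - log_profile1 s * h - log_profile2 s * h\<^sup>2 / 2\<bar> \<le> 22 * \<bar>h\<bar> ^ 3 / s ^ 3"
proof (cases "h = 0")
  case False
  define diff where "diff = (\<lambda>m::nat. [log_profile, log_profile1, log_profile2, log_profile3] ! m)"
  have "\<exists>t. (if s + h < s then s + h < t \<and> t < s else s < t \<and> t < s + h) \<and>
    log_profile (s + h) = (\<Sum>m<3. (diff m s / fact m) * (s + h - s)^m) + (diff 3 t / fact 3) * (s + h - s)^3"
  proof (rule Taylor[where a = "s / 2" and b = "3 * s / 2"])
    show "\<forall>m t. m < 3 \<and> s / 2 \<le> t \<and> t \<le> 3 * s / 2 \<longrightarrow> (diff m has_real_derivative diff (Suc m) t) (at t)"
    proof (intro allI impI)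
      fix m :: nat and t :: real assume *: "m < 3 \<and> s / 2 \<le> t \<and> t \<le> 3 * s / 2"
      hence "t > 1" using s by linarith
      note log_profile_derivs[OF this]
      moreover have "m = 0 \<or> m = 1 \<or> m = 2" using * by auto
      ultimately show "(diff m has_real_derivative diff (Suc m) t) (at t)" by (auto simp: diff_def numeral_2_eq_2)
    qed
  qed (use s h False in \<open>auto simp: diff_def abs_le_iff\<close>)
  then obtain t where t: "if s + h < s then s + h < t \<and> t < s else s < t \<and> t < s + h"
    "log_profile (s + h) = (\<Sum>m<3. (diff m s / fact m) * h^m) + (diff 3 t / fact 3) * h^3" by auto
  have ts: "t \<ge> s / 2" using t(1) h by (auto split: if_splits)
  have "exp 1 \<le> t" using exp_le s ts by linarith
  hence l: "ln t \<ge> 1" using ln_mono[of "exp 1" t] by simp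
  define i j where "i = inverse t" and "j = inverse (ln t)"
  have i: "0 \<le> i" "i \<le> 2 / s" using ts s by (auto simp: i_def field_simps)
  have sp: "s > 0" using s by simp
  have j: "0 \<le> j" "j \<le> 1" "j^2 \<le> 1" "j^3 \<le> 1" using l by (auto simp: j_def inverse_le_1_iff power_le_one)
  have "\<bar>log_profile3 t\<bar> = i^3 * (2 + 4 * j + 6 * j^2 + 4 * j^3)"
    unfolding log_profile3_def i_def[symmetric] j_def[symmetric] using i j by (simp add: algebra_simps)
  also have "\<dots> \<le> (2 / s)^3 * 16" using i j sp by (intro mult_mono power_mono) auto
  also have "\<dots> = 128 / s^3" by (simp add: power_divide)
  finally have log_profile3: "\<bar>log_profile3 t\<bar> \<le> 128 / s^3" .
  have "log_profile (s + h) - log_profile s - log_profile1 s * h - log_profile2 s * h\<^sup>2 / 2 = log_profile3 t / 6 * h^3"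
    unfolding t(2) by (simp add: diff_def eval_nat_numeral)
  also have "\<bar>\<dots>\<bar> = \<bar>log_profile3 t\<bar> / 6 * \<bar>h\<bar>^3" by (simp add: abs_mult power_abs)
  also have "\<dots> \<le> (128 / s^3) / 6 * \<bar>h\<bar>^3" by (intro mult_right_mono divide_right_mono log_profile3) auto
  also have "\<dots> \<le> 22 * \<bar>h\<bar>^3 / s^3" using s by (simp add: field_simps)
  finally show ?thesis .
qed simp

lemma ln_square_le_sqrt:
  assumes "K > 0"
  obtains s0 where "s0 \<ge> 36" "\<And>s::real. s \<ge> s0 \<Longrightarrow> K * (ln s)\<^sup>2 \<le> sqrt s"
proof (rule that[of "max 36 ((64 * K) ^ 4)"])
  fix s :: real assume s: "s \<ge> max 36 ((64 * K) ^ 4)"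
  hence s1: "s \<ge> 1" "s > 0" by auto
  \<comment> \<open>An eighth root of s makes the comparison of ln s with a small power of s polynomial.\<close>
  define r where "r = s powr (1 / 8)"
  have r: "r \<ge> 0" "r ^ 8 = s" using s1 by (simp_all add: r_def powr_power)
  have "(64 * K) ^ 4 \<le> (r ^ 2) ^ 4" using s r(2) by (simp flip: power_mult)
  moreover have "(4::nat) = Suc 3" by simp
  ultimately have "(64 * K) ^ Suc 3 \<le> (r ^ 2) ^ Suc 3" by metis
  hence K: "64 * K \<le> r ^ 2" by (rule power_le_imp_le_base) simp
  have "ln s \<le> 8 * r" using ln_powr_bound[OF s1(1), of "1/8"] by (simp add: r_def)
  hence "(ln s)\<^sup>2 \<le> (8 * r)\<^sup>2" using s1 by (intro power_mono) auto
  hence "K * (ln s)\<^sup>2 \<le> K * (8 * r)\<^sup>2" using assms by (intro mult_left_mono) auto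
  also have "\<dots> = (64 * K) * r^2" by (simp add: power_mult_distrib)
  also have "\<dots> \<le> r^2 * r^2" by (intro mult_right_mono K) auto
  also have "\<dots> = r ^ 4" by (simp flip: power_add)
  also have "\<dots> = sqrt s"
  proof (rule sym, rule real_sqrt_unique)
    show "(r ^ 4)\<^sup>2 = s" using r(2) by (simp flip: power_mult)
  qed (use r in auto)
  finally show "K * (ln s)\<^sup>2 \<le> sqrt s" .
qed auto

definition log_barrier :: "int \<times> int \<Rightarrow> real" where "log_barrier x = log_profile ((lattice_norm x)\<^sup>2)"

text \<open>A second-order Taylor expansion at \<open>s\<close>. The four increments \<open>1 \<plusminus> 2 a\<close>, \<open>1 \<plusminus> 2 b\<close> of \<open>s\<close> have sum
  \<open>4\<close> and sum of squares \<open>8 s + 4\<close>, which gives the main term \<open>- 8 / (s (ln s)\<^sup>2)\<close>. The cubic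
  remainders are \<open>O(s powr (- 3/2))\<close> and hence negligible for large \<open>s\<close>.\<close>
lemma log_barrier_laplacian:
  obtains s0 where "s0 \<ge> 36" "\<And>x s. \<lbrakk>s = (lattice_norm x)\<^sup>2; s \<ge> s0\<rbrakk> \<Longrightarrow>
     - 12 / (s * (ln s)\<^sup>2) \<le> discrete_laplacian log_barrier x \<and> discrete_laplacian log_barrier x \<le> - 4 / (s * (ln s)\<^sup>2)"
proof -
  \<comment> \<open>The errors below add up to 2386 / (s * sqrt s), and 2386 is at most 4 * 597.\<close>
  obtain s0 :: real where s0: "s0 \<ge> 36" "\<And>s. s \<ge> s0 \<Longrightarrow> 597 * (ln s)\<^sup>2 \<le> sqrt s"
    by (rule ln_square_le_sqrt[of 597]) auto
  show ?thesis
  proof (rule that[of s0, OF s0(1)])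
    fix x s assume s: "s = (lattice_norm x)\<^sup>2" "s \<ge> s0"
    obtain a b where x: "x = (a, b)" by (cases x)
    define \<alpha> \<beta> where "\<alpha> = real_of_int a" and "\<beta> = real_of_int b"
    have sab: "s = \<alpha>\<^sup>2 + \<beta>\<^sup>2" by (simp add: s lattice_norm_power2 x \<alpha>_def \<beta>_def)
    have s36: "s \<ge> 36" using s s0 by simp
    define r where "r = sqrt s"
    have "sqrt 36 \<le> r" unfolding r_def using s36 by (rule real_sqrt_le_mono)
    moreover have "sqrt 36 = (6::real)" by (rule real_sqrt_unique) auto
    ultimately have r6: "r \<ge> 6" by simp
    have rr: "r * r = s" using s36 by (simp add: r_def)
    have ab: "\<bar>\<alpha>\<bar> \<le> r" "\<bar>\<beta>\<bar> \<le> r" unfolding r_def sab by (rule real_sqrt_ge_abs1 real_sqrt_ge_abs2)+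
    define R where "R = (\<lambda>h. log_profile (s + h) - log_profile s - log_profile1 s * h - log_profile2 s * h\<^sup>2 / 2)"
    have R: "\<bar>R h\<bar> \<le> 594 / (s * r)" if "\<bar>h\<bar> \<le> 2 * r + 1" for h
    proof -
      have h3: "\<bar>h\<bar> \<le> 3 * r" using that r6 by simp
      have "3 * r \<le> s / 2" unfolding rr[symmetric] using r6 mult_right_mono[of 6 r r] by simp
      hence "\<bar>R h\<bar> \<le> 22 * \<bar>h\<bar> ^ 3 / s ^ 3" unfolding R_def using h3 s36 by (intro log_profile_taylor) auto
      also have "\<dots> \<le> 22 * (3 * r) ^ 3 / s ^ 3" using h3 s36 by (intro divide_right_mono mult_left_mono power_mono) auto
      also have "\<dots> = 594 * (r * r * r) / (s * s * s)" by (simp add: power3_eq_cube)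
      also have "\<dots> = 594 / (s * r)" using r6 unfolding rr[symmetric] by (simp add: divide_simps)
      finally show ?thesis .
    qed
    have log_barrier: "log_barrier (a + 1, b) = log_profile (s + (2 * \<alpha> + 1))" "log_barrier (a - 1, b) = log_profile (s + (- 2 * \<alpha> + 1))" 
      "log_barrier (a, b + 1) = log_profile (s + (2 * \<beta> + 1))" "log_barrier (a, b - 1) = log_profile (s + (- 2 * \<beta> + 1))" "log_barrier (a, b) = log_profile s"
      by (simp_all only: log_barrier_def lattice_norm_power2 fst_conv snd_conv sab \<alpha>_def \<beta>_def of_int_add of_int_diff of_int_1)
        (simp_all add: power2_eq_square algebra_simps)
    have lap: "discrete_laplacian log_barrier x = 4 * log_profile1 s + (4 * s + 2) * log_profile2 s + (R (2 * \<alpha> + 1) + R (- 2 * \<alpha> + 1) + R (2 * \<beta> + 1) + R (- 2 * \<beta> + 1))"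
    proof -
      have 1: "log_profile1 s * (2 * \<alpha> + 1) + log_profile1 s * (- 2 * \<alpha> + 1) + log_profile1 s * (2 * \<beta> + 1) + log_profile1 s * (- 2 * \<beta> + 1) = 4 * log_profile1 s"
        by (simp add: algebra_simps)
      have "(2 * \<alpha> + 1)\<^sup>2 + (- 2 * \<alpha> + 1)\<^sup>2 + (2 * \<beta> + 1)\<^sup>2 + (- 2 * \<beta> + 1)\<^sup>2 = 8 * s + 4"
        unfolding sab by (simp add: power2_eq_square algebra_simps)
      hence "log_profile2 s * ((2 * \<alpha> + 1)\<^sup>2 + (- 2 * \<alpha> + 1)\<^sup>2 + (2 * \<beta> + 1)\<^sup>2 + (- 2 * \<beta> + 1)\<^sup>2) / 2 = (4 * s + 2) * log_profile2 s"
        by simp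
      hence 2: "log_profile2 s * (2 * \<alpha> + 1)\<^sup>2 / 2 + log_profile2 s * (- 2 * \<alpha> + 1)\<^sup>2 / 2 + log_profile2 s * (2 * \<beta> + 1)\<^sup>2 / 2 + log_profile2 s * (- 2 * \<beta> + 1)\<^sup>2 / 2 = (4 * s + 2) * log_profile2 s"
        by (simp only: distrib_left add_divide_distrib)
      show ?thesis unfolding x discrete_laplacian_eq log_barrier R_def using 1 2 by linarith
    qed
    have Rs: "\<bar>R (2 * \<alpha> + 1) + R (- 2 * \<alpha> + 1) + R (2 * \<beta> + 1) + R (- 2 * \<beta> + 1)\<bar> \<le> 2376 / (s * r)"
    proof -
      have four: "\<bar>w + x + y + z\<bar> \<le> 4 * t" if "\<bar>w\<bar> \<le> t" "\<bar>x\<bar> \<le> t" "\<bar>y\<bar> \<le> t" "\<bar>z\<bar> \<le> t" for w x y z t :: real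
        using that by linarith
      have "\<bar>R (2 * \<alpha> + 1)\<bar> \<le> 594 / (s * r)" "\<bar>R (- 2 * \<alpha> + 1)\<bar> \<le> 594 / (s * r)" "\<bar>R (2 * \<beta> + 1)\<bar> \<le> 594 / (s * r)" "\<bar>R (- 2 * \<beta> + 1)\<bar> \<le> 594 / (s * r)"
        by (rule R, use ab in linarith)+
      note four[OF this]
      also have "4 * (594 / (s * r)) = 2376 / (s * r)" by simp
      finally show ?thesis .
    qed
    have "exp 1 \<le> s" using exp_le s36 by linarith
    hence l: "ln s \<ge> 1" using ln_mono[of "exp 1" s] by simp
    define i j where "i = inverse s" and "j = inverse (ln s)"
    have si: "s * i = 1" using s36 by (simp add: i_def)
    have i: "i \<ge> 0" and j: "0 \<le> j" "j \<le> 1" "j^2 \<le> 1" using l s36 by (auto simp: i_def j_def inverse_le_1_iff power_le_one)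
    have q12: "4 * log_profile1 s + (4 * s + 2) * log_profile2 s = - 8 * i * j^2 - 2 * i^2 * (1 + 2 * j + 2 * j^2)"
    proof -
      have "s * i^2 = i" using si by (simp add: power2_eq_square flip: mult.assoc)
      moreover have log_profile2: "log_profile2 s = - (i^2 * (1 + 2 * j + 2 * j^2))"
        unfolding log_profile2_def i_def[symmetric] j_def[symmetric] by (simp add: algebra_simps)
      moreover have "s * log_profile2 s = - (s * i^2 * (1 + 2 * j + 2 * j^2))" unfolding log_profile2 by simp
      ultimately have "s * log_profile2 s = - (i * (1 + 2 * j + 2 * j^2))" by simp
      moreover have "log_profile1 s = i + 2 * (i * j)" unfolding log_profile1_def i_def[symmetric] j_def[symmetric] ..
      moreover have "4 * log_profile1 s + (4 * s + 2) * log_profile2 s = 4 * log_profile1 s + 4 * (s * log_profile2 s) + 2 * log_profile2 s" by (simp add: algebra_simps)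
      ultimately show ?thesis unfolding log_profile2 by (simp add: algebra_simps)
    qed
    have "2 * i^2 * (1 + 2 * j + 2 * j^2) \<le> 2 * i^2 * 5" using j by (intro mult_left_mono) auto
    also have "\<dots> = 10 / (s * s)" by (simp add: i_def power2_eq_square divide_inverse)
    also have "\<dots> \<le> 10 / (s * r)"
      using s36 r6 rr mult_right_mono[of 1 r r] by (intro divide_left_mono mult_left_mono mult_pos_pos) auto
    finally have i2: "2 * i^2 * (1 + 2 * j + 2 * j^2) \<le> 10 / (s * r)" .
    have i2': "0 \<le> 2 * i^2 * (1 + 2 * j + 2 * j^2)" using j by (intro mult_nonneg_nonneg add_nonneg_nonneg) auto
    have main: "10 / (s * r) + 2376 / (s * r) \<le> 4 * i * j^2"
    proof -
      have "597 * (ln s)\<^sup>2 \<le> r" unfolding r_def by (rule s0(2)[OF s(2)])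
      moreover have "0 \<le> (ln s)\<^sup>2" by simp
      ultimately have "2386 * (ln s)\<^sup>2 \<le> 4 * r" by linarith
      hence "s * (2386 * (ln s)\<^sup>2) \<le> s * (4 * r)" using s36 by (intro mult_left_mono) auto
      hence "2386 * (s * (ln s)\<^sup>2) \<le> 4 * (s * r)" by (simp only: mult.left_commute)
      hence "2386 / (s * r) \<le> 4 / (s * (ln s)\<^sup>2)"
      proof -
        have "0 < s * r" "0 < s * (ln s)\<^sup>2" using s36 r6 l by (auto intro!: mult_pos_pos)
        moreover have "x / y \<le> z / t" if "x * t \<le> z * y" "y > 0" "t > 0" for x y z t :: real
          using that by (simp add: divide_simps mult.commute)
        ultimately show ?thesis using \<open>2386 * (s * (ln s)\<^sup>2) \<le> 4 * (s * r)\<close> by blast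
      qed
      also have "\<dots> = 4 * i * j^2" by (simp add: i_def j_def divide_inverse power_inverse)
      finally show ?thesis by (simp flip: add_divide_distrib)
    qed
    have e: "12 / (s * (ln s)\<^sup>2) = 12 * (i * j^2)" "4 / (s * (ln s)\<^sup>2) = 4 * (i * j^2)"
      by (simp_all add: i_def j_def divide_inverse power_inverse)
    have "\<bar>discrete_laplacian log_barrier x + 8 * (i * j^2)\<bar> \<le> 4 * (i * j^2)"
      unfolding lap q12 using Rs i2 i2' main by (simp only: abs_le_iff mult.assoc) linarith
    thus "- 12 / (s * (ln s)\<^sup>2) \<le> discrete_laplacian log_barrier x \<and> discrete_laplacian log_barrier x \<le> - 4 / (s * (ln s)\<^sup>2)"
      using e by (simp add: abs_le_iff)
  qed
qed

lemma exp_minus_log_barrier: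
  assumes "s = (lattice_norm x)\<^sup>2" "s > 1"
  shows "exp (- log_barrier x) = 1 / (s * (ln s)\<^sup>2)"
proof -
  have l: "ln s > 0" using assms(2) by (rule ln_gt_zero)
  have "log_barrier x = ln s + ln ((ln s)\<^sup>2)" using l by (simp add: log_barrier_def log_profile_def assms(1)[symmetric] ln_realpow)
  also have "\<dots> = ln (s * (ln s)\<^sup>2)" using l assms by (subst ln_mult_pos) auto
  finally have Qx: "log_barrier x = ln (s * (ln s)\<^sup>2)" .
  have "0 < s * (ln s)\<^sup>2" using l assms(2) by (intro mult_pos_pos zero_less_power) auto
  thus ?thesis by (simp only: Qx exp_minus exp_ln inverse_eq_divide)
qed

lemma log_barrier_lower:
  obtains C where "\<And>x. 4 * pi * kernel x - C \<le> log_barrier x"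
proof -
  obtain C where C: "C > 0" "\<And>x. \<bar>kernel x - ln (bracket x) / (2 * pi)\<bar> \<le> C" by (rule kernel_log_bound) blast
  have "4 * pi * kernel x - (4 * pi * C + 2 * ln 2 + 1) \<le> log_barrier x" for x
  proof (cases "x = 0")
    case True
    have "0 \<le> 4 * pi * C + 2 * ln 2 + 1" using C(1) by (intro add_nonneg_nonneg) auto
    thus ?thesis using True by (simp add: log_barrier_def log_profile_def)
  next
    case False
    note r = lattice_norm_ge_1[OF False]
    define s where "s = (lattice_norm x)\<^sup>2"
    have "s \<ge> 1" using r by (simp add: s_def)
    have ls: "ln s = 2 * ln (lattice_norm x)" using r by (simp add: s_def ln_realpow)
    have "ln (bracket x) \<le> ln (2 * lattice_norm x)" using bracket_le[OF False] bracket_pos[of x] r by (subst ln_le_cancel_iff) auto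
    hence "2 * ln (bracket x) \<le> 2 * ln 2 + ln s" using r by (simp add: ls ln_mult)
    moreover have "4 * pi * kernel x \<le> 4 * pi * (ln (bracket x) / (2 * pi) + C)"
      using C(2)[of x] by (intro mult_left_mono) auto
    hence "4 * pi * kernel x \<le> 2 * ln (bracket x) + 4 * pi * C" by (simp add: algebra_simps)
    moreover have "2 * ln (ln s) \<ge> - 1"
    proof (cases "s < 2")
      case True
      define N where "N = (fst x)\<^sup>2 + (snd x)\<^sup>2"
      have N: "s = of_int N" by (simp add: s_def lattice_norm_power2 N_def)
      have "N < 2" "N \<ge> 1" using True \<open>s \<ge> 1\<close> unfolding N by linarith+
      hence "s = 1" unfolding N by simp
      thus ?thesis by simp
    next
      case False
      hence "ln s \<ge> ln 2" by simp
      hence ls: "ln s \<ge> 2/3" using ln2_ge_two_thirds by linarith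
      have "ln (2/3) \<le> ln (ln s)" using ls by simp
      moreover have "ln (3/2) \<le> 3/2 - (1::real)" by (intro ln_le_minus_one) auto
      hence "ln (2/3) \<ge> - (1/2 :: real)" by (simp add: ln_div)
      ultimately show ?thesis by linarith
    qed
    ultimately show ?thesis unfolding log_barrier_def log_profile_def s_def[symmetric] by linarith
  qed
  thus ?thesis by (rule that)
qed

lemma log_barrier_upper:
  assumes e: "e > 0"
  obtains C where "\<And>x. log_barrier x \<le> (4 * pi + e) * kernel x + C"
proof -
  obtain C where C: "C > 0" "\<And>x. \<bar>kernel x - ln (bracket x) / (2 * pi)\<bar> \<le> C" by (rule kernel_log_bound) blast
  define \<delta> where "\<delta> = e / (8 * pi)"
  have \<delta>: "\<delta> > 0" using e by (simp add: \<delta>_def)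
  have "log_barrier x \<le> (4 * pi + e) * kernel x + ((4 * pi + e) * C + 2 * \<bar>1 + ln \<delta>\<bar>)" for x
  proof (cases "x = 0")
    case True
    thus ?thesis using C(1) e by (simp add: log_barrier_def log_profile_def add_nonneg_nonneg)
  next
    case False
    note r = lattice_norm_ge_1[OF False]
    define s where "s = (lattice_norm x)\<^sup>2"
    have "s \<ge> 1" using r by (simp add: s_def)
    have "ln s = 2 * ln (lattice_norm x)" using r by (simp add: s_def ln_realpow)
    also have "\<dots> \<le> 2 * ln (bracket x)" using r by (simp add: bracket_def)
    finally have 1: "ln s \<le> 2 * ln (bracket x)" .
    have "4 * pi * (ln (bracket x) / (2 * pi)) \<le> 4 * pi * (kernel x + C)"
      using C(2)[of x] by (intro mult_left_mono) auto
    hence 2: "ln s \<le> 4 * pi * (kernel x + C)" using 1 by simp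
    have "ln (ln s) \<le> \<delta> * ln s + \<bar>1 + ln \<delta>\<bar>"
    proof (cases "ln s > 0")
      case True
      have "ln (\<delta> * ln s) \<le> \<delta> * ln s - 1" using True \<delta> by (intro ln_le_minus_one) auto
      thus ?thesis using True \<delta> by (simp add: ln_mult)
    next
      case False
      hence "ln s = 0" using \<open>s \<ge> 1\<close> ln_ge_zero[of s] by linarith
      thus ?thesis by simp
    qed
    also have "\<delta> * ln s \<le> \<delta> * (4 * pi * (kernel x + C))" using 2 \<delta> by (intro mult_left_mono) auto
    also have "\<dots> = e / 2 * (kernel x + C)" by (simp add: \<delta>_def)
    finally have "2 * ln (ln s) \<le> e * (kernel x + C) + 2 * \<bar>1 + ln \<delta>\<bar>" by simp
    thus ?thesis using 2 unfolding log_barrier_def log_profile_def s_def[symmetric] by (simp add: algebra_simps)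
  qed
  thus ?thesis by (rule that)
qed

lemma finite_upper_bound:
  fixes f :: "'a \<Rightarrow> real"
  assumes "finite E" obtains M where "\<And>x. x \<in> E \<Longrightarrow> f x \<le> M"
  using assms by (metis bdd_above_finite finite_imageI bdd_above.unfold image_eqI)

text \<open>Outside a large ball \<open>(C - log_barrier) / \<kappa>\<close> is a supersolution once \<open>exp C \<ge> 12 / \<kappa>\<close>,
  and on the ball it exceeds the uniform bound \<open>ln (\<beta> - 4 pi / \<kappa>) / \<kappa>\<close> of all the solutions.
  Therefore \<open>C\<close> is independent of \<open>\<alpha>\<close> and the bound survives the limit \<open>\<alpha> \<down> 4 pi / \<kappa>\<close>.\<close>
lemma upper_barrier:
  assumes \<kappa>: "\<kappa> > 0" and \<beta>: "4 * pi < \<kappa> * \<beta>"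
  obtains C where "\<And>\<alpha> u x. \<lbrakk>4 * pi < \<kappa> * \<alpha>; \<alpha> < \<beta>; admissible \<kappa> \<beta> \<alpha> u\<rbrakk> \<Longrightarrow> u x \<le> (C - log_barrier x) / \<kappa>"
proof -
  obtain s0 where s0: "s0 \<ge> 36" "\<And>x s. \<lbrakk>s = (lattice_norm x)\<^sup>2; s \<ge> s0\<rbrakk> \<Longrightarrow>
     - 12 / (s * (ln s)\<^sup>2) \<le> discrete_laplacian log_barrier x \<and> discrete_laplacian log_barrier x \<le> - 4 / (s * (ln s)\<^sup>2)"
    by (rule log_barrier_laplacian) blast
  define E where "E = {x. (lattice_norm x)\<^sup>2 < s0}"
  have "E \<subseteq> {x. lattice_norm x \<le> sqrt s0}" by (auto simp: E_def intro: real_le_rsqrt)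
  hence "finite E" using finite_lattice_ball finite_subset by blast
  then obtain M where M: "\<And>x. x \<in> E \<Longrightarrow> log_barrier x \<le> M" by (rule finite_upper_bound[where f = log_barrier]) blast
  define K where "K = ln (\<beta> - 4 * pi / \<kappa>) / \<kappa>"
  define C where "C = max (ln (12 / \<kappa>)) (\<kappa> * K + M)"
  have "exp (ln (12 / \<kappa>)) \<le> exp C" unfolding C_def exp_le_cancel_iff by simp
  hence C: "12 / \<kappa> \<le> exp C" using \<kappa> by simp
  show ?thesis
  proof (rule that[of C])
    fix \<alpha> u x assume \<alpha>: "4 * pi < \<kappa> * \<alpha>" "\<alpha> < \<beta>" and u: "admissible \<kappa> \<beta> \<alpha> u"
    obtain B where B: "\<And>x. \<bar>u x + \<alpha> * kernel x\<bar> \<le> B" and sol: "is_solution \<kappa> \<beta> u" 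
      and up: "\<And>x. u x \<le> ln (\<beta> - \<alpha>) / \<kappa> - \<alpha> * kernel x"
      using u unfolding admissible_def by blast
    have "\<kappa> * \<alpha> > 0" using \<alpha> pi_gt_zero by linarith
    hence \<alpha>0: "\<alpha> > 0" using \<kappa> by (simp add: zero_less_mult_iff)
    have \<alpha>': "4 * pi / \<kappa> < \<alpha>" using \<alpha> \<kappa> by (simp add: field_simps)
    have uK: "u x \<le> K" for x
    proof -
      have "ln (\<beta> - \<alpha>) / \<kappa> \<le> K" unfolding K_def using \<alpha> \<alpha>' \<kappa> by (intro divide_right_mono) auto
      moreover have "0 \<le> \<alpha> * kernel x" using \<alpha>0 kernel_nonneg by simp
      ultimately show ?thesis using up[of x] by linarith
    qed
    define w where "w = (\<lambda>x. 1 * u x + (1 / \<kappa>) * log_barrier x + (- C / \<kappa>))"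
    have w_eq: "w x = u x - (C - log_barrier x) / \<kappa>" for x by (simp add: w_def diff_divide_distrib)
    have "w x \<le> 0" for x
    proof (rule maximum_principle[where E = E])
      fix x assume "x \<in> E"
      hence "\<kappa> * K + log_barrier x \<le> C" using M[of x] by (simp add: C_def)
      hence "K \<le> (C - log_barrier x) / \<kappa>" using \<kappa> by (simp add: field_simps)
      thus "w x \<le> 0" using uK[of x] by (simp add: w_eq)
    next
      fix x assume x: "x \<notin> E" "w x > 0"
      define s where "s = (lattice_norm x)\<^sup>2"
      have s: "s \<ge> s0" using x by (simp add: E_def s_def)
      have x0: "x \<noteq> 0" using x s0 by (auto simp: E_def)
      have "(C - log_barrier x) / \<kappa> < u x" using x by (simp add: w_eq)
      hence "C - log_barrier x < \<kappa> * u x" using \<kappa> by (simp add: field_simps)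
      hence "exp (C - log_barrier x) < exp (\<kappa> * u x)" by simp
      moreover have "exp (C - log_barrier x) = exp C * exp (- log_barrier x)" by (simp flip: exp_add)
      moreover define P where "P = 1 / (s * (ln s)\<^sup>2)"
      have P: "exp (- log_barrier x) = P" unfolding P_def using s s0 by (intro exp_minus_log_barrier s_def) auto
      have "12 / \<kappa> * P \<le> exp C * P" unfolding P[symmetric] using C by (intro mult_right_mono) auto
      ultimately have 1: "12 / \<kappa> * P < exp (\<kappa> * u x)" unfolding P by linarith
      have "- 12 * P \<le> discrete_laplacian log_barrier x"
        using s0(2)[OF s_def s] by (simp add: P_def)
      hence "(1 / \<kappa>) * (- 12 * P) \<le> (1 / \<kappa>) * discrete_laplacian log_barrier x"
        using \<kappa> by (intro mult_left_mono) auto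
      hence 2: "- (12 / \<kappa> * P) \<le> (1 / \<kappa>) * discrete_laplacian log_barrier x" by simp
      have "discrete_laplacian w x = exp (\<kappa> * u x) + (1 / \<kappa>) * discrete_laplacian log_barrier x"
        unfolding w_def discrete_laplacian_linear is_solutionD[OF sol] using x0 by simp
      thus "discrete_laplacian w x > 0" using 1 2 by linarith
    next
      fix e :: real assume "e > 0"
      \<comment> \<open>The distance of the parameter from the critical one leaves room for the iterated logarithm.\<close>
      define e' where "e' = \<kappa> * (\<alpha> - 4 * pi / \<kappa>)"
      have e': "e' > 0" using \<alpha>' \<kappa> by (simp add: e'_def)
      obtain D where D: "\<And>x. log_barrier x \<le> (4 * pi + e') * kernel x + D" by (rule log_barrier_upper[OF e']) blast
      have ee: "4 * pi + e' = \<kappa> * \<alpha>" using \<kappa> by (simp add: e'_def algebra_simps)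
      have "w x \<le> e * kernel x + (B + D / \<kappa> - C / \<kappa>)" for x
      proof -
        have "log_barrier x / \<kappa> \<le> (\<kappa> * \<alpha> * kernel x + D) / \<kappa>" using D[of x] \<kappa> unfolding ee by (intro divide_right_mono) auto
        hence "log_barrier x / \<kappa> \<le> \<alpha> * kernel x + D / \<kappa>" using \<kappa> by (simp add: add_divide_distrib)
        moreover have "0 \<le> e * kernel x" using \<open>e > 0\<close> kernel_nonneg[of x] by simp
        ultimately show ?thesis using B[of x] by (simp add: w_eq diff_divide_distrib abs_le_iff)
      qed
      thus "\<exists>C. \<forall>x. w x \<le> e * kernel x + C" by blast
    qed
    thus "u x \<le> (C - log_barrier x) / \<kappa>" by (simp add: w_eq)
  qed
qed

text \<open>The barrier lowered by a constant is a subsolution outside a ball. The minorants \<open>u\<close> of \<open>v\<close>, with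
  parameters arbitrarily close to the critical one, provide the growth condition at infinity.\<close>
lemma lower_barrier:
  assumes \<kappa>: "\<kappa> > 0" and \<beta>: "4 * pi < \<kappa> * \<beta>" and v: "is_solution \<kappa> \<beta> v"
    and U: "\<And>\<alpha>. \<lbrakk>4 * pi < \<kappa> * \<alpha>; \<alpha> < \<beta>\<rbrakk> \<Longrightarrow> \<exists>u. admissible \<kappa> \<beta> \<alpha> u \<and> (\<forall>x. u x \<le> v x)"
  obtains C where "\<And>x. (- C - log_barrier x) / \<kappa> \<le> v x"
proof -
  obtain s0 where s0: "s0 \<ge> 36" "\<And>x s. \<lbrakk>s = (lattice_norm x)\<^sup>2; s \<ge> s0\<rbrakk> \<Longrightarrow>
     - 12 / (s * (ln s)\<^sup>2) \<le> discrete_laplacian log_barrier x \<and> discrete_laplacian log_barrier x \<le> - 4 / (s * (ln s)\<^sup>2)"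
    by (rule log_barrier_laplacian) blast
  define E where "E = {x. (lattice_norm x)\<^sup>2 < s0}"
  have "E \<subseteq> {x. lattice_norm x \<le> sqrt s0}" by (auto simp: E_def intro: real_le_rsqrt)
  hence "finite E" using finite_lattice_ball finite_subset by blast
  then obtain M where M: "\<And>x. x \<in> E \<Longrightarrow> - (\<kappa> * v x + log_barrier x) \<le> M"
    by (rule finite_upper_bound[where f = "\<lambda>x. - (\<kappa> * v x + log_barrier x)"]) blast
  define C where "C = max (- ln (4 / \<kappa>)) M"
  have "exp (- C) \<le> exp (ln (4 / \<kappa>))" unfolding C_def exp_le_cancel_iff by simp
  hence C: "exp (- C) \<le> 4 / \<kappa>" using \<kappa> by simp
  define w where "w = (\<lambda>x. (- 1) * v x + (- 1 / \<kappa>) * log_barrier x + (- C / \<kappa>))"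
  have w_eq: "w x = (- C - log_barrier x) / \<kappa> - v x" for x by (simp add: w_def diff_divide_distrib)
  have "w x \<le> 0" for x
  proof (rule maximum_principle[where E = E])
    fix x assume "x \<in> E"
    hence "- C - log_barrier x \<le> \<kappa> * v x" using M[of x] by (simp add: C_def)
    thus "w x \<le> 0" using \<kappa> by (simp add: w_eq field_simps)
  next
    fix x assume x: "x \<notin> E" "w x > 0"
    define s where "s = (lattice_norm x)\<^sup>2"
    have s: "s \<ge> s0" using x by (simp add: E_def s_def)
    have x0: "x \<noteq> 0" using x s0 by (auto simp: E_def)
    have "v x < (- C - log_barrier x) / \<kappa>" using x by (simp add: w_eq)
    hence "\<kappa> * v x < - C - log_barrier x" using \<kappa> by (simp add: field_simps)
    hence "exp (\<kappa> * v x) < exp (- C - log_barrier x)" by simp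
    moreover have "exp (- C - log_barrier x) = exp (- C) * exp (- log_barrier x)" by (simp flip: exp_add)
    moreover define P where "P = 1 / (s * (ln s)\<^sup>2)"
    have P: "exp (- log_barrier x) = P" unfolding P_def using s s0 by (intro exp_minus_log_barrier s_def) auto
    have "exp (- C) * P \<le> 4 / \<kappa> * P" unfolding P[symmetric] using C by (intro mult_right_mono) auto
    ultimately have 1: "exp (\<kappa> * v x) < 4 / \<kappa> * P" unfolding P by linarith
    have "discrete_laplacian log_barrier x \<le> - 4 * P"
      using s0(2)[OF s_def s] by (simp add: P_def)
    hence "(1 / \<kappa>) * discrete_laplacian log_barrier x \<le> (1 / \<kappa>) * (- 4 * P)"
      using \<kappa> by (intro mult_left_mono) auto
    hence 2: "(1 / \<kappa>) * discrete_laplacian log_barrier x \<le> - (4 / \<kappa> * P)" by simp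
    have "discrete_laplacian w x = - exp (\<kappa> * v x) - (1 / \<kappa>) * discrete_laplacian log_barrier x"
      unfolding w_def discrete_laplacian_linear is_solutionD[OF v] using x0 by simp
    thus "discrete_laplacian w x > 0" using 1 2 by linarith
  next
    fix e :: real assume e: "e > 0"
    obtain D where D: "\<And>x. 4 * pi * kernel x - D \<le> log_barrier x" by (rule log_barrier_lower) blast
    have \<beta>': "4 * pi / \<kappa> < \<beta>" using \<beta> \<kappa> by (simp add: field_simps)
    define \<alpha> where "\<alpha> = min ((4 * pi / \<kappa> + \<beta>) / 2) (4 * pi / \<kappa> + e)"
    have \<alpha>: "4 * pi / \<kappa> < \<alpha>" "\<alpha> < \<beta>" "\<alpha> - 4 * pi / \<kappa> \<le> e" 
    proof -
      have "c < min ((c + b) / 2) (c + e) \<and> min ((c + b) / 2) (c + e) < b \<and> min ((c + b) / 2) (c + e) - c \<le> e" if "c < b" for b c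
        using that e by (auto simp: min_def field_simps)
      from this[OF \<beta>'] show "4 * pi / \<kappa> < \<alpha>" "\<alpha> < \<beta>" "\<alpha> - 4 * pi / \<kappa> \<le> e" unfolding \<alpha>_def by blast+
    qed
    have "4 * pi < \<kappa> * \<alpha>" using \<alpha>(1) \<kappa> by (simp add: field_simps)
    from U[OF this \<alpha>(2)] obtain u where u: "admissible \<kappa> \<beta> \<alpha> u" "\<And>x. u x \<le> v x" by blast
    obtain B where B: "\<And>x. \<bar>u x + \<alpha> * kernel x\<bar> \<le> B" using u(1) unfolding admissible_def by blast
    have "w x \<le> e * kernel x + (B + D / \<kappa> - C / \<kappa>)" for x
    proof -
      have "- log_barrier x / \<kappa> \<le> (D - 4 * pi * kernel x) / \<kappa>" using D[of x] \<kappa> by (intro divide_right_mono) auto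
      hence "- log_barrier x / \<kappa> \<le> D / \<kappa> - 4 * pi / \<kappa> * kernel x" by (simp add: diff_divide_distrib)
      moreover have "(\<alpha> - 4 * pi / \<kappa>) * kernel x \<le> e * kernel x" using \<alpha>(3) kernel_nonneg by (intro mult_right_mono) auto
      hence "\<alpha> * kernel x - 4 * pi / \<kappa> * kernel x \<le> e * kernel x" by (simp only: left_diff_distrib)
      moreover have "w x = - C / \<kappa> + - log_barrier x / \<kappa> - v x" by (simp add: w_eq diff_divide_distrib)
      ultimately show ?thesis using B[of x] u(2)[of x] by (simp only: abs_le_iff) linarith
    qed
    thus "\<exists>C. \<forall>x. w x \<le> e * kernel x + C" by blast
  qed
  thus ?thesis by (intro that[of C]) (simp add: w_eq)
qed

section \<open>The family of solutions\<close>

text \<open>With \<open>p = \<kappa> \<alpha> / (2 pi)\<close> the exponent in the statement is \<open>- (p - 2) / (p + 1)\<close>, strictly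
  weaker than both the rate \<open>p - 2\<close> of the tails and the rate \<open>1\<close> of the kernel.\<close>
lemma admissible_asymptotics:
  assumes \<kappa>: "\<kappa> > 0" and \<alpha>: "\<kappa> * \<alpha> > 4 * pi" and \<beta>: "\<alpha> < \<beta>" and u: "admissible \<kappa> \<beta> \<alpha> u"
  shows "\<exists>d. (\<lambda>x. u x - (- \<alpha> / (2 * pi) * ln (lattice_norm x) + d))
          \<in> O[lattice_at_infinity](\<lambda>x.
              lattice_norm x powr ((4 * pi - \<alpha> * \<kappa>) / (\<alpha> * \<kappa> + 2 * pi)) *
              ln (lattice_norm x) powr (2 * pi / (\<alpha> * \<kappa> + 2 * pi))) \<and>
        d \<le> 1 / \<kappa> * ln (\<beta> - \<alpha>) - gamma0 / 2 * \<alpha>"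
proof -
  have \<kappa>\<alpha>: "\<kappa> * \<alpha> > 0" using \<alpha> pi_gt_zero by linarith
  hence \<alpha>0: "\<alpha> > 0" using \<kappa> by (simp add: zero_less_mult_iff)
  define p where "p = \<kappa> * \<alpha> / (2 * pi)"
  have p: "p > 2" unfolding p_def by (rule decay_exponent_gt_2[OF \<alpha>])
  have pk: "\<kappa> * \<alpha> = p * (2 * pi)" by (simp add: p_def)
  define \<theta> where "\<theta> = (p - 2) / (p + 1)"
  have \<theta>: "0 < \<theta>" "\<theta> < 1" "\<theta> < p - 2"
  proof -
    show "0 < \<theta>" "\<theta> < 1" using p by (auto simp: \<theta>_def)
    have "(p - 2) / (p + 1) < (p - 2) / 1" using p by (intro divide_strict_left_mono) auto
    thus "\<theta> < p - 2" by (simp add: \<theta>_def)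
  qed
  have exponent: "(4 * pi - \<alpha> * \<kappa>) / (\<alpha> * \<kappa> + 2 * pi) = - \<theta>"
  proof -
    have "4 * pi - \<alpha> * \<kappa> = - (p - 2) * (2 * pi)" "\<alpha> * \<kappa> + 2 * pi = (p + 1) * (2 * pi)"
      using pk by (simp_all add: algebra_simps)
    thus ?thesis unfolding \<theta>_def by (simp add: minus_divide_left)
  qed
  obtain D C where DC: "D \<le> ln (\<beta> - \<alpha>) / \<kappa>" "\<And>x. \<bar>u x + \<alpha> * kernel x - D\<bar> \<le> C * bracket x powr (- \<theta>)"
    using admissible_decay(2)[OF \<kappa> \<alpha> \<beta> u \<theta>(1,2)] \<theta>(3) unfolding p_def by blast
  obtain C1 where C1: "C1 > 0" "\<And>x. x \<noteq> 0 \<Longrightarrow> \<bar>kernel x - ln (lattice_norm x) / (2 * pi) - c_kernel\<bar> \<le> C1 / lattice_norm x"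
    by (rule kernel_asymp) blast
  have C: "C \<ge> 0" using DC(2)[of 0] by (simp add: bracket_def)
  define d where "d = D - \<alpha> * c_kernel"
  define b where "b = 2 * pi / (\<alpha> * \<kappa> + 2 * pi)"
  have b: "b \<ge> 0" using \<kappa>\<alpha> by (simp add: b_def mult.commute)
  have bound: "\<bar>u x - (- \<alpha> / (2 * pi) * ln (lattice_norm x) + d)\<bar> 
      \<le> (C + \<alpha> * C1) * (lattice_norm x powr (- \<theta>) * ln (lattice_norm x) powr b)" if x: "lattice_norm x \<ge> 3" for x
  proof -
    define r where "r = lattice_norm x"
    have r: "r \<ge> 3" using x by (simp add: r_def)
    have x0: "x \<noteq> 0" using x by auto
    have "ln r \<ge> ln (exp 1)" using r exp_le by (subst ln_le_cancel_iff) auto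
    hence l: "ln r \<ge> 1" by simp
    have near: "C * bracket x powr (- \<theta>) \<le> C * r powr (- \<theta>)"
      using C r \<theta> by (intro mult_left_mono powr_mono2') (auto simp: bracket_def r_def)
    have "C1 / r \<le> C1 * r powr (- \<theta>)"
    proof -
      have "r powr (- 1) \<le> r powr (- \<theta>)" using r \<theta> by (intro powr_mono) auto
      hence "C1 * r powr (- 1) \<le> C1 * r powr (- \<theta>)" using C1(1) by (intro mult_left_mono) auto
      thus ?thesis using r by (simp add: powr_minus_divide)
    qed
    hence kern: "\<alpha> * \<bar>kernel x - ln r / (2 * pi) - c_kernel\<bar> \<le> \<alpha> * (C1 * r powr (- \<theta>))"
      using C1(2)[OF x0] \<alpha>0 by (intro mult_left_mono) (auto simp: r_def)
    have split: "\<bar>u x - (- \<alpha> / (2 * pi) * ln r + d)\<bar> \<le> \<bar>u x + \<alpha> * kernel x - D\<bar> + \<bar>\<alpha> * (kernel x - ln r / (2 * pi) - c_kernel)\<bar>"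
    proof -
      have "u x - (- \<alpha> / (2 * pi) * ln r + d) = (u x + \<alpha> * kernel x - D) - \<alpha> * (kernel x - ln r / (2 * pi) - c_kernel)"
        by (simp add: d_def algebra_simps)
      thus ?thesis using abs_triangle_ineq4 by metis
    qed
    have "\<bar>\<alpha> * (kernel x - ln r / (2 * pi) - c_kernel)\<bar> \<le> \<alpha> * (C1 * r powr (- \<theta>))"
      using kern \<alpha>0 by (simp add: abs_mult)
    from order_trans[OF split add_mono[OF order_trans[OF DC(2) near] this]]
    have "\<bar>u x - (- \<alpha> / (2 * pi) * ln r + d)\<bar> \<le> C * r powr (- \<theta>) + \<alpha> * (C1 * r powr (- \<theta>))" .
    also have "\<dots> = (C + \<alpha> * C1) * (r powr (- \<theta>) * 1)" by (simp add: algebra_simps)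
    also have "\<dots> \<le> (C + \<alpha> * C1) * (r powr (- \<theta>) * ln r powr b)"
      using l b C C1 \<alpha>0 by (intro mult_left_mono ge_one_powr_ge_zero add_nonneg_nonneg) auto
    finally show ?thesis by (simp add: r_def)
  qed
  have "(\<lambda>x. u x - (- \<alpha> / (2 * pi) * ln (lattice_norm x) + d))
          \<in> O[lattice_at_infinity](\<lambda>x. lattice_norm x powr (- \<theta>) * ln (lattice_norm x) powr b)"
  proof (rule bigoI)
    show "\<forall>\<^sub>F x in lattice_at_infinity. norm (u x - (- \<alpha> / (2 * pi) * ln (lattice_norm x) + d)) 
       \<le> (C + \<alpha> * C1) * norm (lattice_norm x powr (- \<theta>) * ln (lattice_norm x) powr b)"
      unfolding lattice_at_infinity_def eventually_filtercomap_at_top_linorder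
      by (intro exI[of _ 3] allI impI) (use bound in \<open>simp add: abs_mult\<close>)
  qed
  moreover have "d \<le> 1 / \<kappa> * ln (\<beta> - \<alpha>) - gamma0 / 2 * \<alpha>"
  proof -
    have "gamma0 / 2 * \<alpha> \<le> c_kernel * \<alpha>" using gamma0_le_c_kernel \<alpha>0 by (intro mult_right_mono) auto
    thus ?thesis using DC(1) by (simp add: d_def mult.commute)
  qed
  ultimately show ?thesis unfolding exponent b_def by blast
qed

text \<open>As \<open>log_barrier x = 2 ln |x| + 2 ln (ln |x|) + 2 ln 2\<close> for \<open>|x| > 1\<close>, a function between two
  vertical translates of \<open>- log_barrier / \<kappa>\<close> has the asserted behaviour.\<close>
lemma critical_asymptotics:
  assumes \<kappa>: "\<kappa> > 0" and lower: "\<And>x. (- C1 - log_barrier x) / \<kappa> \<le> v x" and upper: "\<And>x. v x \<le> (C2 - log_barrier x) / \<kappa>"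
  shows "(\<lambda>x. v x - (- 2 / \<kappa> * ln (lattice_norm x) - 2 / \<kappa> * ln (ln (lattice_norm x)))) \<in> O[lattice_at_infinity](\<lambda>_. 1)"
proof (rule bigoI)
  have "\<bar>v x - (- 2 / \<kappa> * ln (lattice_norm x) - 2 / \<kappa> * ln (ln (lattice_norm x)))\<bar> \<le> (\<bar>C1\<bar> + \<bar>C2\<bar> + 2 * ln 2) / \<kappa>"
    if x: "lattice_norm x \<ge> 3" for x
  proof -
    define r where "r = lattice_norm x"
    have r: "r \<ge> 3" using x by (simp add: r_def)
    have "ln r > 0" using r by (intro ln_gt_zero) auto
    hence "ln (ln (r\<^sup>2)) = ln 2 + ln (ln r)" using r by (simp add: ln_realpow ln_mult)
    hence Qx: "log_barrier x = 2 * ln r + 2 * ln (ln r) + 2 * ln 2" using r by (simp add: log_barrier_def log_profile_def r_def[symmetric] ln_realpow)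
    define W where "W = \<kappa> * v x + 2 * ln r + 2 * ln (ln r)"
    have "- C1 - log_barrier x \<le> \<kappa> * v x" "\<kappa> * v x \<le> C2 - log_barrier x" using lower[of x] upper[of x] \<kappa> by (simp_all add: field_simps)
    hence "\<bar>W\<bar> \<le> \<bar>C1\<bar> + \<bar>C2\<bar> + 2 * ln 2" unfolding W_def Qx using ln_ge_zero[of "2::real"] by linarith
    hence "\<bar>W\<bar> / \<kappa> \<le> (\<bar>C1\<bar> + \<bar>C2\<bar> + 2 * ln 2) / \<kappa>" using \<kappa> by (intro divide_right_mono) auto
    moreover have "v x - (- 2 / \<kappa> * ln r - 2 / \<kappa> * ln (ln r)) = W / \<kappa>"
      using \<kappa> by (simp add: W_def add_divide_distrib)
    ultimately show ?thesis using \<kappa> by (simp add: r_def abs_divide)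
  qed
  thus "\<forall>\<^sub>F x in lattice_at_infinity. norm (v x - (- 2 / \<kappa> * ln (lattice_norm x) - 2 / \<kappa> * ln (ln (lattice_norm x)))) 
       \<le> (\<bar>C1\<bar> + \<bar>C2\<bar> + 2 * ln 2) / \<kappa> * norm (1::real)"
    unfolding lattice_at_infinity_def eventually_filtercomap_at_top_linorder
    by (intro exI[of _ 3]) simp
qed

text \<open>Monotone convergence for sums along an arbitrary filter: the limit dominates
  each \<open>f \<alpha>\<close>, and its finite partial sums are limits of partial sums that are at most \<open>m \<alpha>\<close>.\<close>
lemma has_sum_increasing_limit:
  fixes f :: "real \<Rightarrow> 'a \<Rightarrow> real" 
  assumes F: "F \<noteq> bot" and sums: "\<forall>\<^sub>F \<alpha> in F. (f \<alpha> has_sum m \<alpha>) UNIV \<and> (\<forall>x. 0 \<le> f \<alpha> x \<and> f \<alpha> x \<le> g x)"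
    and lim: "\<And>x. ((\<lambda>\<alpha>. f \<alpha> x) \<longlongrightarrow> g x) F" and m: "(m \<longlongrightarrow> M) F"
  shows "(g has_sum M) UNIV"
proof -
  have g0: "0 \<le> g x" for x
    using sums eventually_happens'[OF F sums] by (meson order_trans)
  have part: "sum g X \<le> M" if "finite X" for X
  proof (rule tendsto_le[OF F m])
    show "((\<lambda>\<alpha>. sum (f \<alpha>) X) \<longlongrightarrow> sum g X) F" by (intro tendsto_sum lim)
    show "\<forall>\<^sub>F \<alpha> in F. sum (f \<alpha>) X \<le> m \<alpha>"
      using sums
    proof eventually_elim
      case (elim \<alpha>)
      hence "sum (f \<alpha>) X \<le> infsum (f \<alpha>) UNIV"
        using that by (intro finite_sum_le_infsum) (auto simp: summable_on_def)
      thus ?case using elim infsumI by metis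
    qed
  qed
  have sm: "g summable_on UNIV"
    by (rule nonneg_bdd_above_summable_on) (use g0 part in \<open>auto intro!: bdd_aboveI[of _ M]\<close>)
  have "infsum g UNIV \<le> M"
    by (rule infsum_le_finite_sums[OF sm]) (use part in auto)
  moreover have "M \<le> infsum g UNIV"
  proof (rule tendsto_upperbound[OF m _ F])
    show "\<forall>\<^sub>F \<alpha> in F. m \<alpha> \<le> infsum g UNIV"
      using sums
    proof eventually_elim
      case (elim \<alpha>)
      show ?case by (rule has_sum_mono[OF _ has_sum_infsum[OF sm]]) (use elim in auto)
    qed
  qed
  ultimately show ?thesis using has_sum_infsum[OF sm] by simp
qed

theorem theorem1p3:
  fixes \<kappa> \<alpha>\<^sub>0 \<beta> :: real
  assumes "\<kappa> > 0" and "\<alpha>\<^sub>0 = 4 * pi / \<kappa>" and "\<beta> > \<alpha>\<^sub>0"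
  shows "\<exists>u :: real \<Rightarrow> int \<times> int \<Rightarrow> real.
    (\<forall>\<alpha>\<in>{\<alpha>\<^sub>0..<\<beta>}. is_solution \<kappa> \<beta> (u \<alpha>)) \<and>
    (\<forall>\<alpha>\<in>{\<alpha>\<^sub>0<..<\<beta>}. \<exists>d::real.
        (\<lambda>x. u \<alpha> x - (- \<alpha> / (2 * pi) * ln (lattice_norm x) + d))
          \<in> O[lattice_at_infinity](\<lambda>x.
              lattice_norm x powr ((4 * pi - \<alpha> * \<kappa>) / (\<alpha> * \<kappa> + 2 * pi)) *
              ln (lattice_norm x) powr (2 * pi / (\<alpha> * \<kappa> + 2 * pi))) \<and>
        d \<le> 1 / \<kappa> * ln (\<beta> - \<alpha>) - gamma0 / 2 * \<alpha>) \<and>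
    (\<lambda>x. u \<alpha>\<^sub>0 x - (- 2 / \<kappa> * ln (lattice_norm x) - 2 / \<kappa> * ln (ln (lattice_norm x))))
      \<in> O[lattice_at_infinity](\<lambda>_. 1) \<and>
    (\<forall>\<alpha>\<^sub>1 \<alpha>\<^sub>2 x. \<alpha>\<^sub>0 \<le> \<alpha>\<^sub>1 \<and> \<alpha>\<^sub>1 \<le> \<alpha>\<^sub>2 \<and> \<alpha>\<^sub>2 < \<beta> \<longrightarrow> u \<alpha>\<^sub>1 x \<ge> u \<alpha>\<^sub>2 x) \<and>
    (\<forall>\<alpha>\<^sub>1 \<alpha>\<^sub>2 x. \<alpha>\<^sub>0 \<le> \<alpha>\<^sub>1 \<and> \<alpha>\<^sub>1 < \<alpha>\<^sub>2 \<and> \<alpha>\<^sub>2 < \<beta> \<longrightarrow> u \<alpha>\<^sub>1 x > u \<alpha>\<^sub>2 x) \<and>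
    (\<forall>\<alpha>'\<in>{\<alpha>\<^sub>0<..<\<beta>}. \<forall>x. ((\<lambda>\<alpha>. u \<alpha> x) \<longlongrightarrow> u \<alpha>' x) (at \<alpha>')) \<and>
    (\<forall>x. ((\<lambda>\<alpha>. u \<alpha> x) \<longlongrightarrow> u \<alpha>\<^sub>0 x) (at_right \<alpha>\<^sub>0)) \<and>
    (\<forall>\<alpha>\<in>{\<alpha>\<^sub>0..<\<beta>}. ((\<lambda>x. exp (\<kappa> * u \<alpha> x)) has_sum (\<beta> - \<alpha>)) UNIV)"
proof -
  note \<kappa> = assms(1) and \<beta> = assms(3)
  have crit: "4 * pi < \<kappa> * \<alpha> \<longleftrightarrow> \<alpha>\<^sub>0 < \<alpha>" for \<alpha> using \<kappa> by (simp add: assms(2) field_simps)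
  have "\<exists>u. admissible \<kappa> \<beta> \<alpha> u" if "\<alpha>\<^sub>0 < \<alpha>" "\<alpha> < \<beta>" for \<alpha>
    using that by (intro admissible_exists \<kappa>) (auto simp: crit)
  then obtain U where U: "\<And>\<alpha>. \<alpha>\<^sub>0 < \<alpha> \<Longrightarrow> \<alpha> < \<beta> \<Longrightarrow> admissible \<kappa> \<beta> \<alpha> (U \<alpha>)" by metis
  have Usol: "is_solution \<kappa> \<beta> (U \<alpha>)" if "\<alpha>\<^sub>0 < \<alpha>" "\<alpha> < \<beta>" for \<alpha> using U[OF that] by (simp add: admissible_def)
  have Umono: "U t x \<le> U s x" if "\<alpha>\<^sub>0 < s" "s \<le> t" "t < \<beta>" for s t x
    using that by (intro admissible_mono[OF \<kappa> that(2), of \<beta> "U s" "U t"] U) auto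
  obtain C2 where C2: "\<And>\<alpha> u x. \<lbrakk>4 * pi < \<kappa> * \<alpha>; \<alpha> < \<beta>; admissible \<kappa> \<beta> \<alpha> u\<rbrakk> \<Longrightarrow> u x \<le> (C2 - log_barrier x) / \<kappa>"
    using upper_barrier[OF \<kappa>, of \<beta>] \<beta> by (auto simp: crit)
  have Ub: "U \<alpha> x \<le> (C2 - log_barrier x) / \<kappa>" if "\<alpha>\<^sub>0 < \<alpha>" "\<alpha> < \<beta>" for \<alpha> x
    using that by (intro C2[of \<alpha>] U) (auto simp: crit)
  define V where "V = (\<lambda>x. SUP t\<in>{\<alpha>\<^sub>0<..<\<beta>}. U t x)"
  have Vlim: "((\<lambda>\<alpha>. U \<alpha> x) \<longlongrightarrow> V x) (at_right \<alpha>\<^sub>0)" for x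
    unfolding V_def by (rule tendsto_at_right_SUP[OF \<beta>, where M = "(C2 - log_barrier x) / \<kappa>"]) (use Umono Ub in auto)
  have ev: "\<forall>\<^sub>F \<alpha> in at_right \<alpha>\<^sub>0. \<alpha> \<in> {\<alpha>\<^sub>0<..<\<beta>}" by (rule eventually_at_right_real[OF \<beta>])
  have Vsol: "is_solution \<kappa> \<beta> V"
    by (rule solution_limit[OF _ Vlim]) (use ev Usol in \<open>auto elim!: eventually_mono\<close>)
  have bdd: "bdd_above ((\<lambda>t. U t x) ` {\<alpha>\<^sub>0<..<\<beta>})" for x
    by (rule bdd_aboveI2[where M = "(C2 - log_barrier x) / \<kappa>"]) (auto intro: Ub)
  have UV: "U \<alpha> x \<le> V x" if "\<alpha>\<^sub>0 < \<alpha>" "\<alpha> < \<beta>" for \<alpha> x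
    unfolding V_def using that bdd by (intro cSUP_upper) auto
  have VC2: "V x \<le> (C2 - log_barrier x) / \<kappa>" for x
    unfolding V_def using \<beta> by (intro cSUP_least) (auto intro: Ub)
  obtain C1 where C1: "\<And>x. (- C1 - log_barrier x) / \<kappa> \<le> V x"
  proof (rule lower_barrier[OF \<kappa> _ Vsol])
    show "4 * pi < \<kappa> * \<beta>" using \<beta> by (simp add: crit)
    show "\<exists>u. admissible \<kappa> \<beta> \<alpha> u \<and> (\<forall>x. u x \<le> V x)" if "4 * pi < \<kappa> * \<alpha>" "\<alpha> < \<beta>" for \<alpha>
      using that U UV unfolding crit by blast
  qed blast
  have Ustrict: "U t x < U s x" if "\<alpha>\<^sub>0 < s" "s < t" "t < \<beta>" for s t x
    using that by (intro admissible_strict_mono[OF \<kappa> that(2), of \<beta> "U s" "U t"] U) auto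
  have UVstrict: "U t x < V x" if "\<alpha>\<^sub>0 < t" "t < \<beta>" for t x
  proof -
    define s where "s = (\<alpha>\<^sub>0 + t) / 2"
    have "\<alpha>\<^sub>0 < s" "s < t" "s < \<beta>" using that by (auto simp: s_def)
    thus ?thesis using Ustrict[of s t x] UV[of s x] that by linarith
  qed
  have Umass: "((\<lambda>x. exp (\<kappa> * U \<alpha> x)) has_sum (\<beta> - \<alpha>)) UNIV" if "\<alpha>\<^sub>0 < \<alpha>" "\<alpha> < \<beta>" for \<alpha>
    using that by (intro admissible_mass[OF \<kappa>] U) (auto simp: crit)
  have Vmass: "((\<lambda>x. exp (\<kappa> * V x)) has_sum (\<beta> - \<alpha>\<^sub>0)) UNIV"
  proof (rule has_sum_increasing_limit)
    show "at_right \<alpha>\<^sub>0 \<noteq> bot" by simp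
    show "((\<lambda>\<alpha>. exp (\<kappa> * U \<alpha> x)) \<longlongrightarrow> exp (\<kappa> * V x)) (at_right \<alpha>\<^sub>0)" for x
      by (intro tendsto_intros Vlim)
    show "((\<lambda>\<alpha>. \<beta> - \<alpha>) \<longlongrightarrow> \<beta> - \<alpha>\<^sub>0) (at_right \<alpha>\<^sub>0)" by (intro tendsto_intros)
    show "\<forall>\<^sub>F \<alpha> in at_right \<alpha>\<^sub>0. ((\<lambda>x. exp (\<kappa> * U \<alpha> x)) has_sum (\<beta> - \<alpha>)) UNIV \<and> (\<forall>x. 0 \<le> exp (\<kappa> * U \<alpha> x) \<and> exp (\<kappa> * U \<alpha> x) \<le> exp (\<kappa> * V x))"
      using ev by eventually_elim (use Umass UV \<kappa> in auto)
  qed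
  define u where "u = (\<lambda>\<alpha>. if \<alpha> = \<alpha>\<^sub>0 then V else U \<alpha>)"
  have u0: "u \<alpha>\<^sub>0 = V" by (simp add: u_def)
  have u1: "u \<alpha> = U \<alpha>" if "\<alpha>\<^sub>0 < \<alpha>" for \<alpha> using that by (simp add: u_def)
  show ?thesis
  proof (intro exI[of _ u] conjI ballI allI impI)
    fix \<alpha> assume "\<alpha> \<in> {\<alpha>\<^sub>0..<\<beta>}"
    then consider "\<alpha> = \<alpha>\<^sub>0" | "\<alpha>\<^sub>0 < \<alpha>" "\<alpha> < \<beta>" by force
    note cs = this
    show "is_solution \<kappa> \<beta> (u \<alpha>)" using cs Vsol Usol by cases (auto simp: u0 u1)
    show "((\<lambda>x. exp (\<kappa> * u \<alpha> x)) has_sum (\<beta> - \<alpha>)) UNIV"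
      using cs Vmass Umass by cases (auto simp: u0 u1)
  next
    fix \<alpha> assume \<alpha>: "\<alpha> \<in> {\<alpha>\<^sub>0<..<\<beta>}"
    hence gt: "\<alpha>\<^sub>0 < \<alpha>" by simp
    show "\<exists>d::real.
        (\<lambda>x. u \<alpha> x - (- \<alpha> / (2 * pi) * ln (lattice_norm x) + d))
          \<in> O[lattice_at_infinity](\<lambda>x.
              lattice_norm x powr ((4 * pi - \<alpha> * \<kappa>) / (\<alpha> * \<kappa> + 2 * pi)) *
              ln (lattice_norm x) powr (2 * pi / (\<alpha> * \<kappa> + 2 * pi))) \<and>
        d \<le> 1 / \<kappa> * ln (\<beta> - \<alpha>) - gamma0 / 2 * \<alpha>"
      unfolding u1[OF gt] using \<alpha> by (intro admissible_asymptotics \<kappa> U) (auto simp: crit)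
  next
    show "(\<lambda>x. u \<alpha>\<^sub>0 x - (- 2 / \<kappa> * ln (lattice_norm x) - 2 / \<kappa> * ln (ln (lattice_norm x)))) \<in> O[lattice_at_infinity](\<lambda>_. 1)"
      unfolding u0 by (rule critical_asymptotics[OF \<kappa> C1 VC2])
  next
    fix \<alpha>\<^sub>1 \<alpha>\<^sub>2 x assume *: "\<alpha>\<^sub>0 \<le> \<alpha>\<^sub>1 \<and> \<alpha>\<^sub>1 < \<alpha>\<^sub>2 \<and> \<alpha>\<^sub>2 < \<beta>"
    show "u \<alpha>\<^sub>2 x < u \<alpha>\<^sub>1 x"
      using * UVstrict[of \<alpha>\<^sub>2 x] Ustrict[of \<alpha>\<^sub>1 \<alpha>\<^sub>2 x] by (cases "\<alpha>\<^sub>1 = \<alpha>\<^sub>0") (auto simp: u0 u1)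
  next
    fix \<alpha>\<^sub>1 \<alpha>\<^sub>2 x assume *: "\<alpha>\<^sub>0 \<le> \<alpha>\<^sub>1 \<and> \<alpha>\<^sub>1 \<le> \<alpha>\<^sub>2 \<and> \<alpha>\<^sub>2 < \<beta>"
    show "u \<alpha>\<^sub>2 x \<le> u \<alpha>\<^sub>1 x"
    proof (cases "\<alpha>\<^sub>1 = \<alpha>\<^sub>2")
      case False
      thus ?thesis using * UV[of \<alpha>\<^sub>2 x] Umono[of \<alpha>\<^sub>1 \<alpha>\<^sub>2 x] by (cases "\<alpha>\<^sub>1 = \<alpha>\<^sub>0") (auto simp: u0 u1)
    qed simp
  next
    fix \<alpha>' x assume \<alpha>': "\<alpha>' \<in> {\<alpha>\<^sub>0<..<\<beta>}"
    have "((\<lambda>\<alpha>. U \<alpha> x) \<longlongrightarrow> U \<alpha>' x) (at \<alpha>')"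
      using \<alpha>' by (intro admissible_continuous[OF \<kappa> U]) auto
    moreover have "\<forall>\<^sub>F \<alpha> in at \<alpha>'. U \<alpha> x = u \<alpha> x"
      using eventually_at_in_open'[of "{\<alpha>\<^sub>0<..<\<beta>}" \<alpha>'] \<alpha>' by (auto elim!: eventually_mono simp: u1)
    ultimately show "((\<lambda>\<alpha>. u \<alpha> x) \<longlongrightarrow> u \<alpha>' x) (at \<alpha>')"
      using \<alpha>' u1[of \<alpha>'] by (auto intro: Lim_transform_eventually)
  next
    fix x
    have "\<forall>\<^sub>F \<alpha> in at_right \<alpha>\<^sub>0. U \<alpha> x = u \<alpha> x" using ev by (auto elim!: eventually_mono simp: u1)
    thus "((\<lambda>\<alpha>. u \<alpha> x) \<longlongrightarrow> u \<alpha>\<^sub>0 x) (at_right \<alpha>\<^sub>0)"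
      unfolding u0 using Vlim[of x] by (rule Lim_transform_eventually[rotated])
  qed
qed

end
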